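(* Let $q$ be a probability measure on $([\mathbb{R}],\mathscr{B}([\mathbb{R}]))$ and let $\rho$ be the exchangeable probability measure on $(\mathbb{R}^\infty,\mathscr{B}(\mathbb{R}^\infty))$ given by $\rho(C)=\int_{[\mathbb{R}]}\mathfrak{p}^\infty(C)\,q(\mathrm{d}\mathfrak{p})$ for $C\in\mathscr{B}(\mathbb{R}^\infty)$. Let $\mathbb{R}$ have the Euclidean distance, and let $[\mathbb{R}]$, $[[\mathbb{R}]]$, $\mathbb{R}^m_\sigma$ and $[\mathbb{R}^m_\sigma]$ be metrized by the order-1 Gini-Monge-Wasserstein-based distances $\mathrm{d}^{(G_1)}_{[\mathbb{R}]}$, $\mathrm{d}^{(G_1)}_{[[\mathbb{R}]]}$, $\mathrm{d}^{(G_1)}_{\mathbb{R}^m_\sigma}$ and $\mathrm{d}^{(G_1)}_{[\mathbb{R}^m_\sigma]}$ defined in the context. Assume that $\int_{\mathbb{R}}|x|^{2+\delta}\,\overline{\mathfrak{p}}(\mathrm{d}x)<+\infty$ for some $\delta>0$, where $\overline{\mathfrak{p}}(B):=\int_{[\mathbb{R}]}\mathfrak{p}(B)\,q(\mathrm{d}\mathfrak{p})$ for every $B\in\mathscr{B}(\mathbb{R})$. Put $\tilde{F}(x):=\tilde{\mathfrak{p}}((-\infty,x])$. Then $$\limsup_{n\to\infty}\sqrt{\frac{n}{\log\log n}}\;\mathrm{d}^{(G_1)}_{[[\mathbb{R}]]}\big(q(\tilde{\boldsymbol{\xi}}^{(n)}),\delta_{\tilde{\mathfrak{e}}_n}\big)\le\int_{\mathbb{R}}\sqrt{2\tilde{F}(x)[1-\tilde{F}(x)]}\,\mathrm{d}x\qquad(\rho\text{-a.s.})$$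 and, for every $m\in\mathbb{N}$, $$\limsup_{n\to\infty}\sqrt{\frac{n}{\log\log n}}\;\mathrm{d}^{(G_1)}_{[\mathbb{R}^m_\sigma]}\big(p_m(\tilde{\boldsymbol{\xi}}^{(n)}),\tilde{\mathfrak{e}}_n^m\big)\le\int_{\mathbb{R}}\sqrt{2\tilde{F}(x)[1-\tilde{F}(x)]}\,\mathrm{d}x\qquad(\rho\text{-a.s.}).$$
   Context: For a separable metrizable space $\mathbb{S}$ with Borel $\sigma$-algebra $\mathscr{B}(\mathbb{S})$, $[\mathbb{S}]$ denotes the set of all probability measures on $(\mathbb{S},\mathscr{B}(\mathbb{S}))$, endowed with the topology of weak convergence and its Borel $\sigma$-algebra; $[[\mathbb{S}]]$ is the set of probability measures on $[\mathbb{S}]$. $\mathfrak{p}^m$ is the $m$-fold product measure. $\tilde{\xi}_1,\tilde{\xi}_2,\dots$ are the coordinate random variables of $\mathbb{R}^\infty$ and $\tilde{\boldsymbol{\xi}}^{(n)}:=(\tilde{\xi}_1,\dots,\tilde{\xi}_n)$. The empirical measure is $\tilde{\mathfrak{e}}_n:=\frac1n\sum_{i=1}^n\delta_{\tilde{\xi}_i}$, and $\delta_{\tilde{\mathfrak{e}}_n}\in[[\mathbb{R}]]$ is the point mass at $\tilde{\mathfrak{e}}_n$. Under $\rho$ there is a random probability measure $\tilde{\mathfrak{p}}$ ($\mathscr{B}(\mathbb{R}^\infty)/\mathscr{B}([\mathbb{R}])$-measurable, $\rho$-a.s. unique) with distribution $q$ such that $\tilde{\mathfrak{e}}_n$ converges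 weakly to $\tilde{\mathfrak{p}}$, $\rho$-a.s. The posterior distribution $q(\tilde{\boldsymbol{\xi}}^{(n)})=q(\tilde{\boldsymbol{\xi}}^{(n)},\cdot)$ is a (fixed) regular conditional distribution of $\tilde{\mathfrak{p}}$ given $\tilde{\boldsymbol{\xi}}^{(n)}$ under $\rho$. The predictive distribution is $p_m(\tilde{\boldsymbol{\xi}}^{(n)},C):=\int_{[\mathbb{R}]}\mathfrak{p}^m(C)\,q(\tilde{\boldsymbol{\xi}}^{(n)},\mathrm{d}\mathfrak{p})$ for $C\in\mathscr{B}(\mathbb{R}^m)$. Metrics. For a metric space $(\mathbb{S},\mathrm{d}_{\mathbb{S}})$ let $[\mathbb{S}]_1$ be the set of $\mu\in[\mathbb{S}]$ with $\int_{\mathbb{S}}\mathrm{d}_{\mathbb{S}}(x,x_0)\,\mu(\mathrm{d}x)<+\infty$ for some $x_0\in\mathbb{S}$. For $\mu_1,\mu_2\in[\mathbb{S}]_1$ the Gini-Monge-Wasserstein distance of order 1 is $$\mathrm{d}^{(G_1)}_{[\mathbb{S}]}(\mu_1,\mu_2):=\inf_{\gamma}\int_{\mathbb{S}^2}\mathrm{d}_{\mathbb{S}}(x,y)\,\gamma(\mathrm{d}x\,\mathrm{d}y),$$ the infimum being over all probability measures $\gamma$ on $\mathbb{S}^2$ with marginals $\mu_1$ and $\mu_2$. Then: - $\mathrm{d}^{(G_1)}_{[\mathbb{R}]}$ is this distance for $\mathbb{S}=\mathbb{R}$ and $\mathrm{d}_{\mathbb{R}}(x,y)=|x-y|$; it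 is a metric on $[\mathbb{R}]_1$. - $\mathrm{d}^{(G_1)}_{[[\mathbb{R}]]}$ is obtained by the same formula with $\mathbb{S}$ replaced by $[\mathbb{R}]$ and ground distance $\mathrm{d}^{(G_1)}_{[\mathbb{R}]}$; it is understood for measures on $[\mathbb{R}]$ concentrated on $[\mathbb{R}]_1$ with finite first moment for this ground distance. Under the moment assumption, the measures compared are $\rho$-a.s. of this kind. - $\mathbb{R}^m_\sigma:=\mathbb{R}^m/\!\sim$, where $\sim$ identifies $(x_1,\dots,x_m)$ with $(x_{\tau(1)},\dots,x_{\tau(m)})$ for every permutation $\tau$ of $\{1,\dots,m\}$. With $[(x_1,\dots,x_m)]$ denoting the equivalence class, $\mathrm{d}^{(G_1)}_{\mathbb{R}^m_\sigma}([(x_1,\dots,x_m)],[(y_1,\dots,y_m)]):=\mathrm{d}^{(G_1)}_{[\mathbb{R}]}\big(\frac1m\sum_{i=1}^m\delta_{x_i},\frac1m\sum_{i=1}^m\delta_{y_i}\big)$. - $\mathrm{d}^{(G_1)}_{[\mathbb{R}^m_\sigma]}$ is the order-1 Gini-Monge-Wasserstein distance on probability measures on $\mathbb{R}^m_\sigma$ with ground distance $\mathrm{d}^{(G_1)}_{\mathbb{R}^m_\sigma}$. The measures $p_m(\tilde{\boldsymbol{\xi}}^{(n)})$ and $\tilde{\mathfrak{e}}_n^m$ on $\mathbb{R}^m$ are identified with their images on $\mathbb{R}^m_\sigma$ under the quotient map. *)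

theory Defs
  imports "HOL-Probability.Probability"
begin

definition prob_measures :: "'a::topological_space measure set" where
  "prob_measures = {\<mu>. prob_space \<mu> \<and> sets \<mu> = sets borel}"

(* Coarsest topology on the Borel probability measures for which integration of every bounded
   continuous real function is continuous. *)
definition weak_topology :: "'a::topological_space measure topology" where
  "weak_topology = topology_generated_by
     {{\<mu> \<in> prob_measures. (\<integral>x. f x \<partial>\<mu>) \<in> U} | (f :: 'a \<Rightarrow> real) U.
        continuous_on UNIV f \<and> bounded (range f) \<and> open U}"

definition borel_of :: "'a topology \<Rightarrow> 'a measure" where
  "borel_of X = sigma (topspace X) {U. openin X U}"

abbreviation borel_prob :: "real measure measure" where
  "borel_prob \<equiv> borel_of weak_topology"

definition couplings :: "'a measure \<Rightarrow> 'a measure \<Rightarrow> ('a \<times> 'a) measure set" where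
  "couplings \<mu> \<nu> = {\<gamma>. prob_space \<gamma> \<and> sets \<gamma> = sets (\<mu> \<Otimes>\<^sub>M \<nu>) \<and>
                       distr \<gamma> \<mu> fst = \<mu> \<and> distr \<gamma> \<nu> snd = \<nu>}"

(* Order-1 Gini-Monge-Wasserstein distance for the ground distance d. It takes values in ennreal,
   so that it is the usual infimum on measures with finite first moment, and no convention is needed
   to give it a value on the remaining ones. *)
definition gmw :: "('a \<Rightarrow> 'a \<Rightarrow> ennreal) \<Rightarrow> 'a measure \<Rightarrow> 'a measure \<Rightarrow> ennreal" where
  "gmw d \<mu> \<nu> = (INF \<gamma>\<in>couplings \<mu> \<nu>. \<integral>\<^sup>+ z. d (fst z) (snd z) \<partial>\<gamma>)"

definition gmw_real :: "real measure \<Rightarrow> real measure \<Rightarrow> ennreal" where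
  "gmw_real = gmw (\<lambda>x y. ennreal (dist x y))"

definition gmw_prob :: "real measure measure \<Rightarrow> real measure measure \<Rightarrow> ennreal" where
  "gmw_prob = gmw gmw_real"

(* The image of the uniform distribution on the indices: mass 1/n at each of x 0, ..., x (n - 1),
   counted with multiplicity; see emeasure_empirical. *)
definition empirical :: "nat \<Rightarrow> (nat \<Rightarrow> real) \<Rightarrow> real measure" where
  "empirical n x = distr (uniform_count_measure {..<n}) borel x"

lemma emeasure_empirical:
  assumes "n \<ge> 1" "A \<in> sets borel"
  shows "emeasure (empirical n x) A = (\<Sum>i<n. emeasure (return borel (x i)) A) / of_nat n"
proof -
  have "emeasure (empirical n x) A = emeasure (uniform_count_measure {..<n}) (x -` A \<inter> {..<n})"
    unfolding empirical_def using assms(2)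
    by (subst emeasure_distr) (auto simp: measurable_def space_uniform_count_measure sets_uniform_count_measure)
  also have "\<dots> = ennreal (card (x -` A \<inter> {..<n}) / n)"
    by (subst emeasure_uniform_count_measure) auto
  also have "real (card (x -` A \<inter> {..<n})) = (\<Sum>i<n. indicator A (x i))"
    by (simp add: indicator_def sum.If_cases Int_def vimage_def conj_commute)
  also have "ennreal ((\<Sum>i<n. indicator A (x i)) / n) = (\<Sum>i<n. indicator A (x i)) / of_nat n"
    using assms(1) by (simp add: divide_ennreal[symmetric] sum_nonneg ennreal_of_nat_eq_real_of_nat
        flip: sum_ennreal ennreal_indicator)
  finally show ?thesis
    using assms(2) by simp
qed

abbreviation borel_pow :: "nat set \<Rightarrow> (nat \<Rightarrow> real) measure" where
  "borel_pow I \<equiv> Pi\<^sub>M I (\<lambda>_. borel)"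

(* For I = UNIV the sigma-algebra of borel_pow I is the Borel sigma-algebra of the product topology,
   by sets_PiM_equal_borel. *)
definition product_mixture :: "nat set \<Rightarrow> real measure measure \<Rightarrow> (nat \<Rightarrow> real) measure" where
  "product_mixture I q = measure_of (space (borel_pow I)) (sets (borel_pow I))
     (\<lambda>C. \<integral>\<^sup>+ p. emeasure (Pi\<^sub>M I (\<lambda>_. p)) C \<partial>q)"

definition mean_measure :: "real measure measure \<Rightarrow> real measure" where
  "mean_measure q = measure_of UNIV (sets borel) (\<lambda>B. \<integral>\<^sup>+ p. emeasure p B \<partial>q)"

(* K is a version of the regular conditional distribution of Y (with values in N) given X (with
   values in L) on the probability space M. *)
definition regular_cond_distr ::
  "'w measure \<Rightarrow> 'a measure \<Rightarrow> ('w \<Rightarrow> 'a) \<Rightarrow> 'b measure \<Rightarrow> ('w \<Rightarrow> 'b) \<Rightarrow> ('a \<Rightarrow> 'b measure) \<Rightarrow> bool" where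
  "regular_cond_distr M L X N Y K \<longleftrightarrow>
     K \<in> L \<rightarrow>\<^sub>M prob_algebra N \<and>
     (\<forall>A\<in>sets N. AE w in M. measure (K (X w)) A =
        real_cond_exp M (vimage_algebra (space M) X L) (\<lambda>v. indicator A (Y v)) w)"

definition perm_rel :: "nat \<Rightarrow> ((nat \<Rightarrow> real) \<times> (nat \<Rightarrow> real)) set" where
  "perm_rel m = {(x, y). x \<in> extensional {..<m} \<and> y \<in> extensional {..<m} \<and>
                         (\<exists>\<tau>. \<tau> permutes {..<m} \<and> y = x \<circ> \<tau>)}"

definition sym_space :: "nat \<Rightarrow> (nat \<Rightarrow> real) set set" where
  "sym_space m = extensional {..<m} // perm_rel m"

definition sym_class :: "nat \<Rightarrow> (nat \<Rightarrow> real) \<Rightarrow> (nat \<Rightarrow> real) set" where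
  "sym_class m x = perm_rel m `` {x}"

(* The empirical measure is constant on each class, so its image of a class is a singleton;
   see sym_dist_class. *)
definition sym_dist :: "nat \<Rightarrow> (nat \<Rightarrow> real) set \<Rightarrow> (nat \<Rightarrow> real) set \<Rightarrow> real" where
  "sym_dist m a b = enn2real (gmw_real (the_elem (empirical m ` a)) (the_elem (empirical m ` b)))"

lemma empirical_permute:
  assumes "\<tau> permutes {..<m}"
  shows "empirical m (x \<circ> \<tau>) = empirical m x"
proof (cases "m = 0")
  case True
  then show ?thesis using assms by simp
next
  case False
  show ?thesis
  proof (rule measure_eqI)
    fix A assume "A \<in> sets (empirical m (x \<circ> \<tau>))"
    then have A: "A \<in> sets borel" by (simp add: empirical_def)
    have "(\<Sum>i<m. emeasure (return borel ((x \<circ> \<tau>) i)) A) = (\<Sum>i<m. emeasure (return borel (x i)) A)"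
      using sum.permute[OF assms, of "\<lambda>i. emeasure (return borel (x i)) A"] by (simp add: o_def)
    then show "emeasure (empirical m (x \<circ> \<tau>)) A = emeasure (empirical m x) A"
      using False A by (simp add: emeasure_empirical)
  qed (simp add: empirical_def)
qed

lemma the_elem_empirical_class:
  assumes "x \<in> extensional {..<m}"
  shows "the_elem (empirical m ` sym_class m x) = empirical m x"
proof -
  have "x \<in> sym_class m x"
    using assms unfolding sym_class_def perm_rel_def by (auto intro!: exI[of _ id] permutes_id)
  moreover have "empirical m y = empirical m x" if "y \<in> sym_class m x" for y
    using that empirical_permute by (auto simp: sym_class_def perm_rel_def)
  ultimately have "empirical m ` sym_class m x = {empirical m x}" by blast
  then show ?thesis by simp
qed

lemma sym_dist_class:
  assumes "x \<in> extensional {..<m}" "y \<in> extensional {..<m}"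
  shows "sym_dist m (sym_class m x) (sym_class m y) = enn2real (gmw_real (empirical m x) (empirical m y))"
  using assms by (simp add: sym_dist_def the_elem_empirical_class)

definition borel_sym :: "nat \<Rightarrow> (nat \<Rightarrow> real) set measure" where
  "borel_sym m = borel_of (Metric_space.mtopology (sym_space m) (sym_dist m))"

(* The arguments are measures on m-tuples, which are compared through their images under the
   quotient map. *)
definition gmw_sym :: "nat \<Rightarrow> (nat \<Rightarrow> real) measure \<Rightarrow> (nat \<Rightarrow> real) measure \<Rightarrow> ennreal" where
  "gmw_sym m \<mu> \<nu> = gmw (\<lambda>a b. ennreal (sym_dist m a b))
     (distr \<mu> (borel_sym m) (sym_class m)) (distr \<nu> (borel_sym m) (sym_class m))"

end

theory Submission
  imports Defs "HOL-Real_Asymp.Real_Asymp"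
begin

text \<open>The product coupling of the posterior with a point mass, and the quantile coupling on the line,
  bound both distances by the posterior mean of the L1-distance \<open>W\<close> between the distribution functions of
  the random limit and of the empirical measure, that is, by the conditional expectation of \<open>W\<close> given
  the first \<open>n\<close> coordinates. Let \<open>Z\<close> be the supremum of the normalized distances \<open>W\<close> over all \<open>n \<ge> m\<close>. If \<open>Z\<close> is
  integrable, the upper limit of the conditional expectations is at most \<open>Z\<close> by Levy's upward theorem,
  and letting \<open>m\<close> tend to infinity replaces \<open>Z\<close> by the upper limit of the normalized distances. The latter is at
  most the asserted integral by the law of the iterated logarithm at each point and the reverse Fatou lemma.
  Both the integrability and the domination rest on the bound \<open>41 * sqrt (F x * (1 - F x))\<close> for the mean of
  the supremum over \<open>n\<close> of the normalized deviation of the empirical distribution function at \<open>x\<close>, which is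
  integrable under the moment condition.\<close>

section \<open>The Borel sigma-algebra of the weak topology\<close>

text \<open>The obstacle is that \<open>W\<close> and the conditioning sigma-algebra both depend on
  n, so martingale convergence does not apply to \<open>W\<close> directly. A supremum over n frees
  the variable from n, at the price of an integrability requirement. Hence the maximal bound must
  hold in mean and scale like the standard deviation at \<open>x\<close>: a bound that does not
  decay in the tails cannot be integrated over the line. The exponential inequality yields this
  scaling only while n times the variance is at least about \<open>ln (ln n)\<close>. For smaller n
  the sum is governed by rare events; there the first moment is used, which for a centred indicator
  is twice the variance and hence small enough.

  Almost sure statements under the mixture are reduced to i.i.d. sequences with a fixed law
  \<open>p\<close>, by showing that under \<open>iid p\<close> the random limit is \<open>p\<close>
  itself. The law of large numbers behind this is a by-product of the law of the iterated logarithm.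

  On the quotient by permutations, the same uniform variables are inserted into the quantile
  functions in every coordinate, so that the bound does not depend on the number of
  coordinates.\<close>

lemma topspace_weak_topology:
  "topspace (weak_topology :: 'a::topological_space measure topology) = prob_measures"
proof -
  have "prob_measures \<in> {{\<mu> \<in> prob_measures. (\<integral>x. f x \<partial>\<mu>) \<in> U} | (f :: 'a \<Rightarrow> real) U.
        continuous_on UNIV f \<and> bounded (range f) \<and> open U}"
    by (rule CollectI, rule exI[of _ "\<lambda>_. 0"], rule exI[of _ UNIV]) auto
  then show ?thesis
    unfolding weak_topology_def topology_generated_by_topspace by blast
qed

lemma space_borel_prob: "space borel_prob = {\<mu>. prob_space \<mu> \<and> sets \<mu> = sets borel}"
  by (simp add: borel_of_def topspace_weak_topology prob_measures_def space_measure_of_conv)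

lemma sets_borel_prob:
  "sets borel_prob = sigma_sets (topspace weak_topology) {U. openin weak_topology U}"
  unfolding borel_of_def by (intro sets_measure_of) (blast dest: openin_subset)

lemma openin_weak_topology_integral:
  fixes f :: "'a::topological_space \<Rightarrow> real"
  assumes "continuous_on UNIV f" "bounded (range f)" "open U"
  shows "openin weak_topology {\<mu> \<in> prob_measures. (\<integral>x. f x \<partial>\<mu>) \<in> U}"
  unfolding weak_topology_def
  by (rule topology_generated_by_Basis, rule CollectI, rule exI[of _ f], rule exI[of _ U])
    (use assms in simp)

lemma measurable_integral_borel_prob:
  fixes f :: "real \<Rightarrow> real"
  assumes "continuous_on UNIV f" "bounded (range f)"
  shows "(\<lambda>\<mu>. \<integral>x. f x \<partial>\<mu>) \<in> borel_measurable borel_prob"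
proof (rule borel_measurableI)
  fix U :: "real set" assume "open U"
  then have "openin weak_topology {\<mu> \<in> prob_measures. (\<integral>x. f x \<partial>\<mu>) \<in> U}"
    using assms by (intro openin_weak_topology_integral)
  then show "(\<lambda>\<mu>. \<integral>x. f x \<partial>\<mu>) -` U \<inter> space borel_prob \<in> sets borel_prob"
    unfolding sets_borel_prob
    by (intro sigma_sets.Basic) (simp add: space_borel_prob prob_measures_def vimage_def Int_def conj_commute)
qed

lemma borel_prob_real_distribution: "p \<in> space borel_prob \<Longrightarrow> real_distribution p"
  by (auto simp: space_borel_prob real_distribution_def real_distribution_axioms_def)

lemma cts_step_continuous_bounded:
  assumes "a < b"
  shows "continuous_on UNIV (cts_step a b)" "bounded (range (cts_step a b))"
proof -
  show "continuous_on UNIV (cts_step a b)"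
    using assms by (intro uniformly_continuous_imp_continuous cts_step_uniformly_continuous)
  have "\<bar>cts_step a b x\<bar> \<le> 1" for x
    using assms by (auto simp: cts_step_def field_simps)
  then show "bounded (range (cts_step a b))"
    by (intro boundedI[of _ 1]) auto
qed

text \<open>A half-line need not be a continuity set, so \<open>cdf\<close> at \<open>x\<close> is
  not weakly continuous. It is a limit of integrals of continuous cut-offs, squeezed between the
  values at \<open>x\<close> and at \<open>x + 1 / Suc i\<close>; right continuity closes the
  gap.\<close>

lemma measurable_cdf_borel_prob: "(\<lambda>p. cdf p x) \<in> borel_measurable borel_prob"
proof (rule borel_measurable_LIMSEQ_real)
  fix i :: nat
  show "(\<lambda>p. \<integral>y. cts_step x (x + 1 / real (Suc i)) y \<partial>p) \<in> borel_measurable borel_prob"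
    by (intro measurable_integral_borel_prob cts_step_continuous_bounded) auto
next
  fix p assume "p \<in> space borel_prob"
  then interpret real_distribution p by (rule borel_prob_real_distribution)
  have "((\<lambda>i. x + 1 / real (Suc i)) \<longlongrightarrow> x + 0) sequentially"
    using LIMSEQ_inverse_real_of_nat by (intro tendsto_add) (auto simp: inverse_eq_divide)
  then have "filterlim (\<lambda>i. x + 1 / real (Suc i)) (at_right x) sequentially"
    by (auto simp: filterlim_at)
  moreover have "(cdf p \<longlongrightarrow> cdf p x) (at_right x)"
    using cdf_is_right_cont[of x] by (simp add: continuous_within)
  ultimately have "(\<lambda>i. cdf p (x + 1 / real (Suc i))) \<longlonglongrightarrow> cdf p x"
    by (rule filterlim_compose[rotated])
  then show "(\<lambda>i. \<integral>y. cts_step x (x + 1 / real (Suc i)) y \<partial>p) \<longlonglongrightarrow> cdf p x"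
    by (rule tendsto_sandwich[rotated 3, where f="\<lambda>_. cdf p x"]) (auto intro!: always_eventually cdf_cts_step)
qed

text \<open>The bridge from the weak topology to the sigma-algebra generated by evaluations, on
  which kernels and \<open>bind\<close> are built: half-lines form an intersection-stable generator,
  so measurability of \<open>cdf\<close> suffices.\<close>

lemma measurable_id_borel_prob: "(\<lambda>p. p) \<in> borel_prob \<rightarrow>\<^sub>M prob_algebra borel"
proof (rule measurable_prob_algebra_generated[where \<Omega>=UNIV and G="range atMost"])
  show "sets borel = sigma_sets (UNIV::real set) (range atMost)"
    by (simp add: borel_eq_atMost)
  show "Int_stable (range (atMost :: real \<Rightarrow> real set))"
    by (auto simp: Int_stable_def)
next
  fix A :: "real set" assume "A \<in> range atMost"
  then obtain x where A: "A = {..x}" by auto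
  have "(\<lambda>p. ennreal (cdf p x)) \<in> borel_measurable borel_prob"
    using measurable_cdf_borel_prob by measurable
  then show "(\<lambda>p. emeasure p A) \<in> borel_measurable borel_prob"
  proof (rule measurable_cong[THEN iffD1, rotated])
    fix p assume "p \<in> space borel_prob"
    then interpret real_distribution p by (rule borel_prob_real_distribution)
    show "ennreal (cdf p x) = emeasure p A"
      by (simp add: A cdf_def emeasure_eq_measure)
  qed
qed (auto simp: space_borel_prob)

lemma measurable_emeasure_borel_prob:
  "A \<in> sets borel \<Longrightarrow> (\<lambda>p. emeasure p A) \<in> borel_measurable borel_prob"
  by (rule measurable_compose[OF measurable_prob_algebraD[OF measurable_id_borel_prob]]) simp

text \<open>Measure and argument vary together, so the value is read as the
  \<open>P x\<close>-measure of a section of the measurable set of pairs with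
  \<open>snd z \<le> f (fst z)\<close>.\<close>

lemma measurable_cdf:
  assumes P: "P \<in> M \<rightarrow>\<^sub>M borel_prob" and [measurable]: "f \<in> borel_measurable M"
  shows "(\<lambda>x. cdf (P x) (f x)) \<in> borel_measurable M"
  unfolding cdf_def
proof (rule measure_measurable_prob_algebra2[where N=borel])
  have "Sigma (space M) (\<lambda>x. {..f x}) = {z \<in> space (M \<Otimes>\<^sub>M borel). snd z \<le> f (fst z)}"
    by (auto simp: space_pair_measure)
  also have "\<dots> \<in> sets (M \<Otimes>\<^sub>M borel)" by measurable
  finally show "Sigma (space M) (\<lambda>x. {..f x}) \<in> sets (M \<Otimes>\<^sub>M borel)" .
  show "P \<in> M \<rightarrow>\<^sub>M prob_algebra borel"
    using measurable_compose[OF P measurable_id_borel_prob] by simp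
qed

section \<open>Mixtures of product measures\<close>

lemma prob_space_PiM_const: "p \<in> space borel_prob \<Longrightarrow> prob_space (Pi\<^sub>M I (\<lambda>_. p))"
  by (intro prob_space_PiM) (auto simp: space_borel_prob)

lemma sets_PiM_const: "p \<in> space borel_prob \<Longrightarrow> sets (Pi\<^sub>M I (\<lambda>_. p)) = sets (borel_pow I)"
  by (intro sets_PiM_cong) (auto simp: space_borel_prob)

lemma measurable_PiM_borel_prob: "(\<lambda>p. Pi\<^sub>M I (\<lambda>_. p)) \<in> borel_prob \<rightarrow>\<^sub>M prob_algebra (borel_pow I)"
proof (rule measurable_prob_algebra_generated[OF sets_PiM Int_stable_prod_algebra prod_algebra_sets_into_space])
  fix A assume "A \<in> prod_algebra I (\<lambda>_. borel :: real measure)"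
  then obtain J E where A: "A = prod_emb I (\<lambda>_. borel) J (Pi\<^sub>E J E)" "finite J" "J \<subseteq> I"
    "\<And>i. i \<in> J \<Longrightarrow> E i \<in> sets borel"
    by (elim prod_algebraE) blast
  have "(\<lambda>p. \<Prod>i\<in>J. emeasure p (E i)) \<in> borel_measurable borel_prob"
    using A by (intro borel_measurable_prod_ennreal measurable_emeasure_borel_prob) auto
  then show "(\<lambda>p. emeasure (Pi\<^sub>M I (\<lambda>_. p)) A) \<in> borel_measurable borel_prob"
  proof (rule measurable_cong[THEN iffD1, rotated])
    fix p assume p: "p \<in> space borel_prob"
    have "A = prod_emb I (\<lambda>_. p) J (Pi\<^sub>E J E)"
      using p unfolding A prod_emb_def by (auto simp: space_borel_prob dest!: sets_eq_imp_space_eq)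
    then show "(\<Prod>i\<in>J. emeasure p (E i)) = emeasure (Pi\<^sub>M I (\<lambda>_. p)) A"
      using A p by (simp add: emeasure_PiM_emb space_borel_prob)
  qed
qed (auto intro: prob_space_PiM_const simp: sets_PiM_const)

lemma in_space_prob_algebra_borel_prob:
  "prob_space q \<Longrightarrow> sets q = sets borel_prob \<Longrightarrow> q \<in> space (prob_algebra borel_prob)"
  by (simp add: space_prob_algebra)

text \<open>\<open>measure_of\<close> keeps a prescribed set function only if that function is
  countably additive. Agreement with an existing measure supplies this, and the mixtures become
  instances of \<open>bind\<close>.\<close>

lemma measure_of_eq_measure:
  assumes "\<And>A. A \<in> sets N \<Longrightarrow> f A = emeasure N A" "\<A> = sets N" "\<Omega> = space N"
  shows "measure_of \<Omega> \<A> f = N"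
  using measure_of_eq[of "sets N" "space N" f "emeasure N"] assms
  by (simp add: sets.space_closed sets.sigma_sets_eq measure_of_of_measure)

lemma product_mixture_eq_bind:
  assumes "prob_space q" "sets q = sets borel_prob"
  shows "product_mixture I q = q \<bind> (\<lambda>p. Pi\<^sub>M I (\<lambda>_. p))"
  unfolding product_mixture_def
proof (rule measure_of_eq_measure)
  note q = in_space_prob_algebra_borel_prob[OF assms]
  show "sets (borel_pow I) = sets (q \<bind> (\<lambda>p. Pi\<^sub>M I (\<lambda>_. p)))"
    using sets_bind'[OF q measurable_PiM_borel_prob[of I]] by simp
  then show "space (borel_pow I) = space (q \<bind> (\<lambda>p. Pi\<^sub>M I (\<lambda>_. p)))"
    by (rule sets_eq_imp_space_eq)
  fix A assume "A \<in> sets (q \<bind> (\<lambda>p. Pi\<^sub>M I (\<lambda>_. p)))"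
  then have "A \<in> sets (borel_pow I)"
    using sets_bind'[OF q measurable_PiM_borel_prob[of I]] by simp
  then show "(\<integral>\<^sup>+ p. emeasure (Pi\<^sub>M I (\<lambda>_. p)) A \<partial>q) = emeasure (q \<bind> (\<lambda>p. Pi\<^sub>M I (\<lambda>_. p))) A"
    using emeasure_bind_prob_algebra[OF q measurable_PiM_borel_prob] by simp
qed

lemma mean_measure_eq_bind:
  assumes "prob_space q" "sets q = sets borel_prob"
  shows "mean_measure q = q \<bind> (\<lambda>p. p)"
  unfolding mean_measure_def
proof (rule measure_of_eq_measure)
  note q = in_space_prob_algebra_borel_prob[OF assms]
  show "sets borel = sets (q \<bind> (\<lambda>p. p))"
    using sets_bind'[OF q measurable_id_borel_prob] by simp
  then show "UNIV = space (q \<bind> (\<lambda>p. p))"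
    by (auto dest: sets_eq_imp_space_eq)
  fix A assume "A \<in> sets (q \<bind> (\<lambda>p. p))"
  then have "A \<in> sets borel"
    using sets_bind'[OF q measurable_id_borel_prob] by simp
  then show "(\<integral>\<^sup>+ p. emeasure p A \<partial>q) = emeasure (q \<bind> (\<lambda>p. p)) A"
    using emeasure_bind_prob_algebra[OF q measurable_id_borel_prob] by simp
qed

section \<open>Quantile coupling\<close>

definition quantile :: "real measure \<Rightarrow> real \<Rightarrow> real" where
  "quantile p u = Inf {x. u \<le> cdf p x}"

definition unif :: "real measure" where
  "unif = restrict_space lborel {0<..<1}"

lemma space_unif: "space unif = {0<..<1}"
  by (simp add: unif_def space_restrict_space)

lemma prob_space_unif: "prob_space unif"
  by (rule prob_spaceI) (simp add: unif_def emeasure_restrict_space space_restrict_space)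

lemma measurable_unif_borel: "(\<lambda>u. u) \<in> borel_measurable unif"
  unfolding unif_def by (intro measurable_restrict_space1) simp

text \<open>The Galois connection that trades events about \<open>quantile\<close> for events about
  \<open>cdf\<close>, whose joint measurability is known.\<close>

lemma quantile_le_iff:
  assumes "p \<in> space borel_prob" "0 < u" "u < 1"
  shows "quantile p u \<le> x \<longleftrightarrow> u \<le> cdf p x"
proof -
  interpret cdf_distribution p
    using assms(1) by (simp add: cdf_distribution_def borel_prob_real_distribution)
  show ?thesis unfolding quantile_def using pseudoinverse[of u x] assms by simp
qed

lemma measurable_quantile [measurable]:
  "(\<lambda>z. quantile (fst z) (snd z)) \<in> borel_measurable (borel_prob \<Otimes>\<^sub>M unif)"
proof (rule borel_measurableI_le)
  fix x
  have "{z \<in> space (borel_prob \<Otimes>\<^sub>M unif). quantile (fst z) (snd z) \<le> x} =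
    {z \<in> space (borel_prob \<Otimes>\<^sub>M unif). snd z \<le> cdf (fst z) x}"
    by (auto simp: space_pair_measure space_unif quantile_le_iff)
  also have "\<dots> \<in> sets (borel_prob \<Otimes>\<^sub>M unif)"
  proof -
    have [measurable]: "snd \<in> borel_measurable (borel_prob \<Otimes>\<^sub>M unif)"
      using measurable_compose[OF measurable_snd[of borel_prob unif] measurable_unif_borel] by simp
    have [measurable]: "(\<lambda>z. cdf (fst z) x) \<in> borel_measurable (borel_prob \<Otimes>\<^sub>M unif)"
      by (intro measurable_cdf) auto
    show ?thesis by measurable
  qed
  finally show "{z \<in> space (borel_prob \<Otimes>\<^sub>M unif). quantile (fst z) (snd z) \<le> x} \<in> sets (borel_prob \<Otimes>\<^sub>M unif)" .
qed

lemma measurable_quantile_compose [measurable (raw)]: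
  assumes "P \<in> M \<rightarrow>\<^sub>M borel_prob" "U \<in> M \<rightarrow>\<^sub>M unif"
  shows "(\<lambda>w. quantile (P w) (U w)) \<in> borel_measurable M"
  using measurable_compose[OF measurable_Pair[OF assms] measurable_quantile] by simp

lemma distr_quantile:
  assumes "p \<in> space borel_prob"
  shows "distr unif borel (quantile p) = p"
proof -
  interpret cdf_distribution p
    using assms by (simp add: cdf_distribution_def borel_prob_real_distribution)
  show ?thesis
    using distr_I_eq_M by (simp add: unif_def quantile_def[abs_def])
qed

text \<open>The closed form of the order-1 distance on the line, see
  \<open>gmw_real_eq_cdf_dist\<close>. In contrast to an infimum over couplings it is visibly
  measurable in \<open>p\<close>, so it can be averaged over a posterior.\<close>

definition cdf_dist :: "real measure \<Rightarrow> real measure \<Rightarrow> ennreal" where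
  "cdf_dist p e = (\<integral>\<^sup>+ x. ennreal \<bar>cdf p x - cdf e x\<bar> \<partial>lborel)"

lemma measurable_cdf_const: "p \<in> space borel_prob \<Longrightarrow> cdf p \<in> borel_measurable borel"
  using measurable_cdf[of "\<lambda>_. p" borel "\<lambda>x. x"] by simp

lemma cdf_in_unit: "p \<in> space borel_prob \<Longrightarrow> 0 \<le> cdf p x \<and> cdf p x \<le> 1"
proof -
  assume "p \<in> space borel_prob"
  then interpret real_distribution p by (rule borel_prob_real_distribution)
  show ?thesis using cdf_nonneg cdf_bounded_prob by blast
qed

lemma emeasure_unif_Ioc:
  assumes "0 \<le> a" "a \<le> b" "b \<le> 1"
  shows "emeasure unif ({a<..b} \<inter> {0<..<1}) = ennreal (b - a)"
proof -
  have "emeasure unif ({a<..b} \<inter> {0<..<1}) = emeasure lborel ({a<..b} \<inter> {0<..<1})"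
    unfolding unif_def by (intro emeasure_restrict_space) auto
  also have "\<dots> = ennreal (b - a)"
  proof -
    \<comment> \<open>The right endpoint falls out of the open unit interval exactly when it is
      1.\<close>
    have "{a<..b} \<inter> {0<..<1} = (if b = 1 then {a<..<b} else {a<..b})"
      using assms by auto
    then show ?thesis using assms by simp
  qed
  finally show ?thesis .
qed

text \<open>Both sides are the area between the two graphs: horizontal slices run between the
  quantiles, vertical slices between the distribution functions, and Tonelli equates the two
  computations.\<close>

lemma nn_integral_quantile_diff:
  assumes p: "p \<in> space borel_prob" and e: "e \<in> space borel_prob"
  shows "(\<integral>\<^sup>+ u. ennreal \<bar>quantile p u - quantile e u\<bar> \<partial>unif) = cdf_dist p e"
proof -
  interpret U: prob_space unif by (rule prob_space_unif)
  interpret pair_sigma_finite unif lborel ..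
  note [measurable] = measurable_cdf_const[OF p] measurable_cdf_const[OF e]
  define a where "a x = min (cdf p x) (cdf e x)" for x
  define b where "b x = max (cdf p x) (cdf e x)" for x
  have [measurable]: "a \<in> borel_measurable borel" "b \<in> borel_measurable borel"
    unfolding a_def[abs_def] b_def[abs_def] by measurable
  have ab: "0 \<le> a x" "a x \<le> b x" "b x \<le> 1" for x
    using cdf_in_unit[OF p, of x] cdf_in_unit[OF e, of x] by (auto simp: a_def b_def)
  have [measurable]: "fst \<in> borel_measurable (unif \<Otimes>\<^sub>M lborel)"
    using measurable_compose[OF measurable_fst[of unif lborel] measurable_unif_borel] by simp
  have 1: "ennreal \<bar>quantile p u - quantile e u\<bar> = (\<integral>\<^sup>+ x. (if a x < u \<and> u \<le> b x then 1 else 0) \<partial>lborel)"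
    if u: "u \<in> space unif" for u
  proof -
    let ?m = "min (quantile p u) (quantile e u)" and ?M = "max (quantile p u) (quantile e u)"
    have "(\<integral>\<^sup>+ x. (if a x < u \<and> u \<le> b x then 1 else 0) \<partial>lborel) = (\<integral>\<^sup>+ x. indicator {?m..<?M} x \<partial>lborel)"
    proof (intro nn_integral_cong)
      fix x
      have "u \<le> cdf p x \<longleftrightarrow> quantile p u \<le> x" "u \<le> cdf e x \<longleftrightarrow> quantile e u \<le> x"
        using quantile_le_iff p e u by (auto simp: space_unif)
      then show "(if a x < u \<and> u \<le> b x then 1 else 0 :: ennreal) = indicator {?m..<?M} x"
        by (auto simp: a_def b_def min_def max_def indicator_def not_le not_less split: if_splits)
    qed
    also have "\<dots> = ennreal (?M - ?m)"
      by simp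
    also have "?M - ?m = \<bar>quantile p u - quantile e u\<bar>" by auto
    finally show ?thesis by simp
  qed
  have 2: "(\<integral>\<^sup>+ u. (if a x < u \<and> u \<le> b x then 1 else 0) \<partial>unif) = ennreal \<bar>cdf p x - cdf e x\<bar>" for x
  proof -
    have "(\<integral>\<^sup>+ u. (if a x < u \<and> u \<le> b x then 1 else 0) \<partial>unif) = (\<integral>\<^sup>+ u. indicator ({a x<..b x} \<inter> {0<..<1}) u \<partial>unif)"
      by (intro nn_integral_cong) (auto simp: space_unif indicator_def)
    also have "\<dots> = emeasure unif ({a x<..b x} \<inter> {0<..<1})"
      by (intro nn_integral_indicator) (auto simp: unif_def sets_restrict_space)
    also have "\<dots> = ennreal (b x - a x)"
      by (rule emeasure_unif_Ioc[OF ab])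
    also have "b x - a x = \<bar>cdf p x - cdf e x\<bar>" by (auto simp: a_def b_def)
    finally show ?thesis .
  qed
  have "(\<integral>\<^sup>+ u. ennreal \<bar>quantile p u - quantile e u\<bar> \<partial>unif) =
    (\<integral>\<^sup>+ u. (\<integral>\<^sup>+ x. (if a x < u \<and> u \<le> b x then 1 else 0) \<partial>lborel) \<partial>unif)"
    by (intro nn_integral_cong 1)
  also have "\<dots> = (\<integral>\<^sup>+ x. (\<integral>\<^sup>+ u. (if a x < u \<and> u \<le> b x then 1 else 0) \<partial>unif) \<partial>lborel)"
    by (rule Fubini'[symmetric]) measurable
  also have "\<dots> = cdf_dist p e"
    unfolding 2 cdf_dist_def ..
  finally show ?thesis .
qed

section \<open>Upper bounds for transport distances\<close>

lemma distr_sets_cong: "sets N = sets L \<Longrightarrow> distr M N f = distr M L f"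
  by (rule distr_cong) auto

text \<open>No measurability of the integrand is required here; the ground distances below need not be
  measurable for the product sigma-algebra.\<close>

lemma nn_integral_distr_le:
  assumes T: "T \<in> M \<rightarrow>\<^sub>M N"
  shows "(\<integral>\<^sup>+ y. f y \<partial>distr M N T) \<le> (\<integral>\<^sup>+ x. f (T x) \<partial>M)"
  unfolding nn_integral_def[of "distr M N T"]
proof (rule SUP_least)
  fix g assume g: "g \<in> {g. simple_function (distr M N T) g \<and> g \<le> f}"
  then have "integral\<^sup>S (distr M N T) g = (\<integral>\<^sup>+ y. g y \<partial>distr M N T)"
    by (simp add: nn_integral_eq_simple_integral)
  also have "\<dots> = (\<integral>\<^sup>+ x. g (T x) \<partial>M)"
    using g borel_measurable_simple_function[of "distr M N T" g]
    by (intro nn_integral_distr T) auto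
  also have "\<dots> \<le> (\<integral>\<^sup>+ x. f (T x) \<partial>M)"
    using g by (intro nn_integral_mono) (auto simp: le_fun_def)
  finally show "integral\<^sup>S (distr M N T) g \<le> (\<integral>\<^sup>+ x. f (T x) \<partial>M)" .
qed

text \<open>Two maps on a common probability space with the right laws give a coupling through their
  joint law. Bounding the cost by a function \<open>h\<close> moves all further computation to
  \<open>N\<close>.\<close>

lemma gmw_le:
  assumes N: "prob_space N"
    and T1 [measurable]: "T1 \<in> N \<rightarrow>\<^sub>M \<mu>" and T2 [measurable]: "T2 \<in> N \<rightarrow>\<^sub>M \<nu>"
    and "distr N \<mu> T1 = \<mu>" "distr N \<nu> T2 = \<nu>"
    and d: "\<And>w. w \<in> space N \<Longrightarrow> d (T1 w) (T2 w) \<le> h w"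
  shows "gmw d \<mu> \<nu> \<le> (\<integral>\<^sup>+ w. h w \<partial>N)"
proof -
  let ?\<gamma> = "distr N (\<mu> \<Otimes>\<^sub>M \<nu>) (\<lambda>w. (T1 w, T2 w))"
  have "distr ?\<gamma> \<mu> fst = \<mu>" "distr ?\<gamma> \<nu> snd = \<nu>"
    using assms by (simp_all add: distr_distr o_def)
  moreover have "prob_space ?\<gamma>"
    by (intro prob_space.prob_space_distr N) measurable
  ultimately have "?\<gamma> \<in> couplings \<mu> \<nu>"
    by (simp add: couplings_def)
  then have "gmw d \<mu> \<nu> \<le> (\<integral>\<^sup>+ z. d (fst z) (snd z) \<partial>?\<gamma>)"
    unfolding gmw_def by (rule INF_lower)
  also have "\<dots> \<le> (\<integral>\<^sup>+ w. d (fst (T1 w, T2 w)) (snd (T1 w, T2 w)) \<partial>N)"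
    by (intro nn_integral_distr_le) measurable
  also have "\<dots> \<le> (\<integral>\<^sup>+ w. h w \<partial>N)"
    using d by (intro nn_integral_mono) simp
  finally show ?thesis .
qed

lemma measurable_quantile1:
  assumes "p \<in> space borel_prob"
  shows "quantile p \<in> unif \<rightarrow>\<^sub>M p"
proof -
  have "quantile p \<in> borel_measurable unif"
    using measurable_quantile_compose[of "\<lambda>_. p" unif "\<lambda>u. u"] assms by simp
  then show ?thesis
    using assms by (simp add: space_borel_prob cong: measurable_cong_sets)
qed

lemma distr_quantile':
  assumes "p \<in> space borel_prob"
  shows "distr unif p (quantile p) = p"
  using distr_quantile[OF assms] assms distr_sets_cong[of p borel unif "quantile p"]
  by (simp add: space_borel_prob)

lemma gmw_real_le_cdf_dist:
  assumes "p \<in> space borel_prob" "e \<in> space borel_prob"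
  shows "gmw_real p e \<le> cdf_dist p e"
  unfolding gmw_real_def nn_integral_quantile_diff[OF assms, symmetric]
  by (rule gmw_le[OF prob_space_unif, of "quantile p" _ "quantile e"])
    (simp_all add: assms measurable_quantile1 distr_quantile' dist_real_def)

text \<open>The coupling with a point mass is the image of \<kappa> under pairing each
  \<open>p\<close> with \<open>e\<close>.\<close>

lemma gmw_prob_le:
  assumes \<kappa>: "prob_space \<kappa>" "sets \<kappa> = sets borel_prob" and e: "e \<in> space borel_prob"
  shows "gmw_prob \<kappa> (return borel_prob e) \<le> (\<integral>\<^sup>+ p. cdf_dist p e \<partial>\<kappa>)"
  unfolding gmw_prob_def
proof (rule gmw_le[OF \<kappa>(1), of "\<lambda>p. p" _ "\<lambda>_. e"])
  show "distr \<kappa> (return borel_prob e) (\<lambda>_. e) = return borel_prob e"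
    using e prob_space.distr_const[OF \<kappa>(1), of e "return borel_prob e"]
      return_cong[of "return borel_prob e" borel_prob] by simp
  show "gmw_real p e \<le> cdf_dist p e" if "p \<in> space \<kappa>" for p
    using that e sets_eq_imp_space_eq[OF \<kappa>(2)] by (intro gmw_real_le_cdf_dist) auto
qed (use e in \<open>auto simp: distr_id\<close>)

section \<open>Symmetrized tuples\<close>

lemma gmw_real_empirical_le:
  assumes m: "m \<ge> 1"
  shows "gmw_real (empirical m x) (empirical m y) \<le> ennreal ((\<Sum>i<m. \<bar>x i - y i\<bar>) / real m)"
proof -
  let ?N = "uniform_count_measure {..<m}"
  have meas: "f \<in> ?N \<rightarrow>\<^sub>M empirical m z" for f z :: "nat \<Rightarrow> real"
    by (simp add: empirical_def measurable_def sets_uniform_count_measure space_uniform_count_measure)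
  have "distr ?N (empirical m z) z = empirical m z" for z
    using distr_sets_cong[of "empirical m z" borel ?N z] by (simp add: empirical_def)
  moreover have "prob_space ?N"
    using m by (intro prob_space_uniform_count_measure) (auto simp: lessThan_empty_iff)
  \<comment> \<open>The common space is the index set: the i-th atom of one measure is moved to the
    i-th atom of the other. This matching need not be optimal, but its cost is continuous in the
    coordinates.\<close>
  ultimately have "gmw_real (empirical m x) (empirical m y) \<le> (\<integral>\<^sup>+ i. ennreal (dist (x i) (y i)) \<partial>?N)"
    unfolding gmw_real_def by (intro gmw_le[of ?N x _ y] meas) auto
  also have "\<dots> = (\<Sum>i<m. ennreal (dist (x i) (y i)) * ennreal (1 / real m))"
    unfolding uniform_count_measure_def by (subst nn_integral_point_measure_finite) (auto simp: mult.commute)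
  also have "\<dots> = ennreal ((\<Sum>i<m. \<bar>x i - y i\<bar>) / real m)"
    by (simp add: ennreal_mult[symmetric] sum_divide_distrib dist_real_def)
  finally show ?thesis .
qed

lemma sym_dist_class_le:
  assumes "m \<ge> 1" "x \<in> extensional {..<m}" "y \<in> extensional {..<m}"
  shows "sym_dist m (sym_class m x) (sym_class m y) \<le> (\<Sum>i<m. \<bar>x i - y i\<bar>) / real m"
  unfolding sym_dist_class[OF assms(2,3)]
  by (intro enn2real_leI gmw_real_empirical_le assms) (simp add: sum_nonneg)

section \<open>The order-1 distance on the line as an L1 distance\<close>

lemma gmw_commute:
  assumes d: "\<And>x y. d x y = d y x"
  shows "gmw d \<mu> \<nu> = gmw d \<nu> \<mu>"
proof -
  have "gmw d \<nu> \<mu> \<le> gmw d \<mu> \<nu>" for \<mu> \<nu>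
    unfolding gmw_def[of d \<mu> \<nu>]
  proof (rule INF_greatest)
    fix \<gamma> assume "\<gamma> \<in> couplings \<mu> \<nu>"
    then have \<gamma>: "prob_space \<gamma>" "sets \<gamma> = sets (\<mu> \<Otimes>\<^sub>M \<nu>)" "distr \<gamma> \<mu> fst = \<mu>" "distr \<gamma> \<nu> snd = \<nu>"
      by (auto simp: couplings_def)
    have "fst \<in> \<gamma> \<rightarrow>\<^sub>M \<mu>" "snd \<in> \<gamma> \<rightarrow>\<^sub>M \<nu>"
      using \<gamma>(2) by (simp_all cong: measurable_cong_sets)
    then show "gmw d \<nu> \<mu> \<le> (\<integral>\<^sup>+ z. d (fst z) (snd z) \<partial>\<gamma>)"
      using \<gamma> d by (intro gmw_le[of \<gamma> snd _ fst]) auto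
  qed
  then show ?thesis by (intro antisym)
qed

text \<open>For any coupling, the distribution functions differ at \<open>x\<close> by at most the
  probability that \<open>x\<close> separates the two coordinates. Integrated over \<open>x\<close>,
  this probability becomes the mean distance of the coordinates.\<close>

lemma cdf_dist_le_gmw_real:
  assumes p: "p \<in> space borel_prob" and e: "e \<in> space borel_prob"
  shows "cdf_dist p e \<le> gmw_real p e"
  unfolding gmw_real_def gmw_def
proof (rule INF_greatest)
  fix \<gamma> assume "\<gamma> \<in> couplings p e"
  then have \<gamma>: "prob_space \<gamma>" "sets \<gamma> = sets (p \<Otimes>\<^sub>M e)" "distr \<gamma> p fst = p" "distr \<gamma> e snd = e"
    by (auto simp: couplings_def)
  interpret G: prob_space \<gamma> by (rule \<gamma>)
  interpret pair_sigma_finite \<gamma> lborel ..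
  have pe: "sets p = sets borel" "sets e = sets borel"
    using p e by (auto simp: space_borel_prob)
  have sets_\<gamma>: "sets \<gamma> = sets (borel \<Otimes>\<^sub>M borel)"
    unfolding \<gamma>(2) using pe by (rule sets_pair_measure_cong)
  have [measurable]: "fst \<in> borel_measurable \<gamma>" "snd \<in> borel_measurable \<gamma>"
    using sets_\<gamma> by (simp_all cong: measurable_cong_sets)
  have marg: "cdf p x = G.expectation (\<lambda>z. indicator {..x} (fst z))" "cdf e x = G.expectation (\<lambda>z. indicator {..x} (snd z))" for x
  proof -
    have "cdf p x = measure (distr \<gamma> p fst) {..x}" unfolding \<gamma>(3) cdf_def ..
    also have "\<dots> = measure \<gamma> (fst -` {..x} \<inter> space \<gamma>)"
      using pe by (intro measure_distr) (auto cong: measurable_cong_sets)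
    also have "\<dots> = G.expectation (indicator (fst -` {..x} \<inter> space \<gamma>))" by simp
    also have "\<dots> = G.expectation (\<lambda>z. indicator {..x} (fst z))"
      by (intro Bochner_Integration.integral_cong) (auto simp: indicator_def)
    finally show "cdf p x = G.expectation (\<lambda>z. indicator {..x} (fst z))" .
    have "cdf e x = measure (distr \<gamma> e snd) {..x}" unfolding \<gamma>(4) cdf_def ..
    also have "\<dots> = measure \<gamma> (snd -` {..x} \<inter> space \<gamma>)"
      using pe by (intro measure_distr) (auto cong: measurable_cong_sets)
    also have "\<dots> = G.expectation (indicator (snd -` {..x} \<inter> space \<gamma>))" by simp
    also have "\<dots> = G.expectation (\<lambda>z. indicator {..x} (snd z))"
      by (intro Bochner_Integration.integral_cong) (auto simp: indicator_def)
    finally show "cdf e x = G.expectation (\<lambda>z. indicator {..x} (snd z))" .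
  qed
  let ?I = "\<lambda>z x. if min (fst z) (snd z) \<le> x \<and> x < max (fst z) (snd z) then 1 else 0 :: real"
  have I: "\<bar>indicator {..x} (fst z) - indicator {..x} (snd z)\<bar> = ?I z x" for x and z :: "real \<times> real"
    by (auto simp: indicator_def)
  have "ennreal \<bar>cdf p x - cdf e x\<bar> \<le> (\<integral>\<^sup>+ z. ennreal (?I z x) \<partial>\<gamma>)" for x
  proof -
    have int: "integrable \<gamma> (\<lambda>z. indicator {..x} (fst z) :: real)" "integrable \<gamma> (\<lambda>z. indicator {..x} (snd z) :: real)"
      by (auto intro!: G.integrable_const_bound[of _ 1])
    have "\<bar>cdf p x - cdf e x\<bar> = \<bar>G.expectation (\<lambda>z. indicator {..x} (fst z) - indicator {..x} (snd z))\<bar>"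
      unfolding marg using int by simp
    also have "\<dots> \<le> G.expectation (\<lambda>z. \<bar>indicator {..x} (fst z) - indicator {..x} (snd z)\<bar>)"
      by (rule integral_abs_bound)
    finally have "ennreal \<bar>cdf p x - cdf e x\<bar> \<le> ennreal (G.expectation (\<lambda>z. \<bar>indicator {..x} (fst z) - indicator {..x} (snd z)\<bar>))"
      by (rule ennreal_leI)
    also have "\<dots> = (\<integral>\<^sup>+ z. ennreal \<bar>indicator {..x} (fst z) - indicator {..x} (snd z)\<bar> \<partial>\<gamma>)"
      using int by (intro nn_integral_eq_integral[symmetric]) auto
    finally show ?thesis unfolding I .
  qed
  then have "cdf_dist p e \<le> (\<integral>\<^sup>+ x. (\<integral>\<^sup>+ z. ennreal (?I z x) \<partial>\<gamma>) \<partial>lborel)"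
    unfolding cdf_dist_def by (intro nn_integral_mono)
  also have "\<dots> = (\<integral>\<^sup>+ z. (\<integral>\<^sup>+ x. ennreal (?I z x) \<partial>lborel) \<partial>\<gamma>)"
    by (rule Fubini') measurable
  also have "\<dots> = (\<integral>\<^sup>+ z. ennreal (dist (fst z) (snd z)) \<partial>\<gamma>)"
  proof (intro nn_integral_cong)
    fix z :: "real \<times> real"
    have "(\<integral>\<^sup>+ x. ennreal (?I z x) \<partial>lborel) = (\<integral>\<^sup>+ x. indicator {min (fst z) (snd z)..<max (fst z) (snd z)} x \<partial>lborel)"
      by (intro nn_integral_cong) (simp add: indicator_def)
    also have "\<dots> = ennreal (max (fst z) (snd z) - min (fst z) (snd z))" by simp
    also have "max (fst z) (snd z) - min (fst z) (snd z) = dist (fst z) (snd z)"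
      by (auto simp: dist_real_def)
    finally show "(\<integral>\<^sup>+ x. ennreal (?I z x) \<partial>lborel) = ennreal (dist (fst z) (snd z))" .
  qed
  finally show "cdf_dist p e \<le> (\<integral>\<^sup>+ z. ennreal (dist (fst z) (snd z)) \<partial>\<gamma>)" .
qed

lemma gmw_real_eq_cdf_dist:
  "p \<in> space borel_prob \<Longrightarrow> e \<in> space borel_prob \<Longrightarrow> gmw_real p e = cdf_dist p e"
  by (intro antisym gmw_real_le_cdf_dist cdf_dist_le_gmw_real)

lemma cdf_dist_triangle:
  assumes "p \<in> space borel_prob" "r \<in> space borel_prob" "e \<in> space borel_prob"
  shows "cdf_dist p e \<le> cdf_dist p r + cdf_dist r e"
proof -
  have [measurable]: "cdf p \<in> borel_measurable borel" "cdf r \<in> borel_measurable borel" "cdf e \<in> borel_measurable borel"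
    using assms by (simp_all add: measurable_cdf_const)
  have "cdf_dist p e \<le> (\<integral>\<^sup>+ x. ennreal \<bar>cdf p x - cdf r x\<bar> + ennreal \<bar>cdf r x - cdf e x\<bar> \<partial>lborel)"
    unfolding cdf_dist_def by (intro nn_integral_mono) (simp flip: ennreal_plus)
  also have "\<dots> = cdf_dist p r + cdf_dist r e"
    unfolding cdf_dist_def by (intro nn_integral_add) measurable
  finally show ?thesis .
qed

text \<open>Distance zero makes the quantile functions agree almost everywhere on the unit interval,
  hence gives their images of the uniform law, which are the two measures, the same
  distribution.\<close>

lemma cdf_dist_eq_0_imp_eq:
  assumes p: "p \<in> space borel_prob" and e: "e \<in> space borel_prob" and 0: "cdf_dist p e = 0"
  shows "p = e"
proof -
  have Q [measurable]: "quantile p \<in> borel_measurable unif" "quantile e \<in> borel_measurable unif"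
    using measurable_quantile_compose[of "\<lambda>_. p" unif "\<lambda>u. u"] measurable_quantile_compose[of "\<lambda>_. e" unif "\<lambda>u. u"] p e
    by simp_all
  have "(\<integral>\<^sup>+ u. ennreal \<bar>quantile p u - quantile e u\<bar> \<partial>unif) = 0"
    using 0 by (simp add: nn_integral_quantile_diff[OF p e])
  then have "AE u in unif. ennreal \<bar>quantile p u - quantile e u\<bar> = 0"
    by (subst (asm) nn_integral_0_iff_AE) auto
  then have "AE u in unif. quantile p u = quantile e u"
    by eventually_elim simp
  then have "distr unif borel (quantile p) = distr unif borel (quantile e)"
    by (intro distr_cong_AE) auto
  then show ?thesis by (simp add: distr_quantile p e)
qed

lemma empirical_in_space: "n \<ge> 1 \<Longrightarrow> empirical n x \<in> space borel_prob"
  unfolding space_borel_prob empirical_def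
  by (auto simp: measurable_def sets_uniform_count_measure space_uniform_count_measure lessThan_empty_iff
      intro!: prob_space.prob_space_distr prob_space_uniform_count_measure)

section \<open>The quotient by permutations as a metric space\<close>

lemma equiv_perm_rel: "equiv (extensional {..<m}) (perm_rel m)"
proof (rule equivI)
  show "perm_rel m \<subseteq> extensional {..<m} \<times> extensional {..<m}"
    by (auto simp: perm_rel_def)
  show "refl_on (extensional {..<m}) (perm_rel m)"
    by (auto simp: refl_on_def perm_rel_def intro!: exI[of _ id] permutes_id)
  show "sym (perm_rel m)"
  proof (rule symI)
    fix x y assume "(x, y) \<in> perm_rel m"
    then obtain \<tau> where "x \<in> extensional {..<m}" "y \<in> extensional {..<m}" "\<tau> permutes {..<m}" "y = x \<circ> \<tau>"
      by (auto simp: perm_rel_def)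
    then show "(y, x) \<in> perm_rel m"
      by (auto simp: perm_rel_def comp_assoc permutes_inv_o permutes_inv intro!: exI[of _ "inv \<tau>"])
  qed
  show "trans (perm_rel m)"
  proof (rule transI)
    fix x y z assume "(x, y) \<in> perm_rel m" "(y, z) \<in> perm_rel m"
    then obtain \<sigma> \<tau> where "x \<in> extensional {..<m}" "z \<in> extensional {..<m}"
      "\<sigma> permutes {..<m}" "y = x \<circ> \<sigma>" "\<tau> permutes {..<m}" "z = y \<circ> \<tau>"
      by (auto simp: perm_rel_def)
    then show "(x, z) \<in> perm_rel m"
      by (auto simp: perm_rel_def comp_assoc intro!: exI[of _ "\<sigma> \<circ> \<tau>"] permutes_compose)
  qed
qed

text \<open>The mass at a point times \<open>m\<close> counts the indices with that value, so the
  measure determines the multiset of coordinates; tuples with equal multisets differ by a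
  permutation.\<close>

lemma empirical_eq_imp_class_eq:
  assumes m: "m \<ge> 1" and x: "x \<in> extensional {..<m}" and y: "y \<in> extensional {..<m}"
    and eq: "empirical m x = empirical m y"
  shows "sym_class m x = sym_class m y"
proof -
  have card_eq: "card {i\<in>{..<m}. z i = v} = real m * measure (empirical m z) {v}" for z :: "nat \<Rightarrow> real" and v
  proof -
    have "measure (empirical m z) {v} = measure (uniform_count_measure {..<m}) (z -` {v} \<inter> {..<m})"
      unfolding empirical_def
      by (subst measure_distr) (auto simp: measurable_def sets_uniform_count_measure space_uniform_count_measure)
    also have "\<dots> = card (z -` {v} \<inter> {..<m}) / m"
      by (subst measure_uniform_count_measure) auto
    also have "z -` {v} \<inter> {..<m} = {i\<in>{..<m}. z i = v}" by auto
    finally show ?thesis using m by simp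
  qed
  have "count (image_mset z (mset_set {..<m})) v = card {i\<in>{..<m}. z i = v}" for z :: "nat \<Rightarrow> real" and v
    by (auto simp: count_image_mset' intro!: arg_cong[where f=card])
  then have "image_mset x (mset_set {..<m}) = image_mset y (mset_set {..<m})"
    using card_eq[of x] card_eq[of y] eq by (intro multiset_eqI) (metis of_nat_eq_iff)
  from image_mset_eq_implies_permutes[OF finite_lessThan this]
  obtain \<tau> where \<tau>: "\<tau> permutes {..<m}" "\<forall>i\<in>{..<m}. x i = y (\<tau> i)" .
  have "x i = (y \<circ> \<tau>) i" for i
  proof (cases "i < m")
    case False
    then have "\<tau> i = i" using \<tau>(1) by (simp add: permutes_def)
    then show ?thesis using False x y by (simp add: extensional_def)
  qed (simp add: \<tau>)
  then have "x = y \<circ> \<tau>" by auto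
  then have "(y, x) \<in> perm_rel m"
    using x y \<tau>(1) by (auto simp: perm_rel_def)
  then show ?thesis
    unfolding sym_class_def using equiv_class_eq[OF equiv_perm_rel] by metis
qed

lemma sym_spaceE:
  assumes "a \<in> sym_space m"
  obtains x where "x \<in> extensional {..<m}" "a = sym_class m x"
  using assms unfolding sym_space_def sym_class_def by (auto elim: quotientE)

lemma gmw_real_empirical_finite: "m \<ge> 1 \<Longrightarrow> gmw_real (empirical m x) (empirical m y) < \<infinity>"
  using le_less_trans[OF gmw_real_empirical_le] by simp

text \<open>\<open>borel_sym\<close> is built from a metric topology, whose open sets can be
  described by balls once \<open>sym_dist\<close> is known to be a metric. Definiteness and the
  triangle inequality are inherited from \<open>cdf_dist\<close>; finiteness of the distance between
  empirical measures keeps \<open>enn2real\<close> faithful.\<close>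

lemma Metric_space_sym:
  assumes m: "m \<ge> 1"
  shows "Metric_space (sym_space m) (sym_dist m)"
proof
  fix a b
  show "0 \<le> sym_dist m a b" by (simp add: sym_dist_def)
  show "sym_dist m a b = sym_dist m b a"
    unfolding sym_dist_def gmw_real_def by (subst gmw_commute) (simp_all add: dist_commute)
next
  fix a b assume "a \<in> sym_space m" "b \<in> sym_space m"
  then obtain x y where x: "x \<in> extensional {..<m}" "a = sym_class m x"
    and y: "y \<in> extensional {..<m}" "b = sym_class m y"
    by (metis sym_spaceE)
  have eq: "sym_dist m a b = enn2real (cdf_dist (empirical m x) (empirical m y))"
    using x y sym_dist_class[of x m y] gmw_real_eq_cdf_dist[of "empirical m x" "empirical m y"] m
    by (simp add: empirical_in_space)
  have fin: "cdf_dist (empirical m x) (empirical m y) < \<infinity>"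
    using gmw_real_empirical_finite[OF m, of x y] gmw_real_eq_cdf_dist[of "empirical m x" "empirical m y"] m
    by (simp add: empirical_in_space)
  show "sym_dist m a b = 0 \<longleftrightarrow> a = b"
  proof
    assume "sym_dist m a b = 0"
    then have "cdf_dist (empirical m x) (empirical m y) = 0"
      using fin by (auto simp: eq enn2real_eq_0_iff)
    then have "empirical m x = empirical m y"
      using m by (intro cdf_dist_eq_0_imp_eq empirical_in_space)
    then show "a = b"
      unfolding x(2) y(2) by (rule empirical_eq_imp_class_eq[OF m x(1) y(1)])
  next
    assume "a = b"
    then have "sym_dist m a b \<le> 0"
      using sym_dist_class_le[OF m x(1) x(1)] x by simp
    then show "sym_dist m a b = 0"
      by (rule antisym) (simp add: sym_dist_def)
  qed
next
  fix a b c assume "a \<in> sym_space m" "b \<in> sym_space m" "c \<in> sym_space m"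
  then obtain x y z where x: "x \<in> extensional {..<m}" "a = sym_class m x"
    and y: "y \<in> extensional {..<m}" "b = sym_class m y" and z: "z \<in> extensional {..<m}" "c = sym_class m z"
    by (metis sym_spaceE)
  let ?e = "empirical m"
  have "gmw_real (?e x) (?e z) \<le> gmw_real (?e x) (?e y) + gmw_real (?e y) (?e z)"
    using m by (simp add: gmw_real_eq_cdf_dist empirical_in_space cdf_dist_triangle)
  then have "enn2real (gmw_real (?e x) (?e z)) \<le> enn2real (gmw_real (?e x) (?e y) + gmw_real (?e y) (?e z))"
    using gmw_real_empirical_finite[OF m] by (intro enn2real_mono) auto
  also have "\<dots> = enn2real (gmw_real (?e x) (?e y)) + enn2real (gmw_real (?e y) (?e z))"
    using gmw_real_empirical_finite[OF m] by (intro enn2real_plus) auto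
  finally show "sym_dist m a c \<le> sym_dist m a b + sym_dist m b c"
    using x y z by (simp add: sym_dist_class)
qed

text \<open>The quotient map is continuous, because \<open>sym_dist\<close> is at most the mean
  distance of the coordinates.\<close>

lemma measurable_sym_class [measurable]:
  assumes m: "m \<ge> 1"
  shows "sym_class m \<in> borel_pow {..<m} \<rightarrow>\<^sub>M borel_sym m"
proof -
  interpret Metric_space "sym_space m" "sym_dist m" by (rule Metric_space_sym[OF m])
  show ?thesis
    unfolding borel_sym_def borel_of_def topspace_mtopology
  proof (rule measurable_measure_of)
    show "sym_class m \<in> space (borel_pow {..<m}) \<rightarrow> sym_space m"
      by (auto simp: space_PiM PiE_def sym_class_def sym_space_def intro: quotientI)
  next
    fix U assume "U \<in> {U. openin mtopology U}"
    then have "openin mtopology U" by simp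
    have U: "\<exists>r>0. \<forall>b\<in>sym_space m. sym_dist m a b < r \<longrightarrow> b \<in> U" if aU: "a \<in> U" for a
    proof -
      have a: "a \<in> sym_space m"
        using openin_subset[OF \<open>openin mtopology U\<close>] aU by auto
      obtain r where "r > 0" "mball a r \<subseteq> U"
        using \<open>openin mtopology U\<close> aU by (auto simp: openin_mtopology)
      then show ?thesis using a by (intro exI[of _ r]) (auto simp: subset_iff)
    qed
    let ?R = "\<lambda>\<omega> :: nat \<Rightarrow> real. restrict \<omega> {..<m}"
    \<comment> \<open>The product sigma-algebra is identified with a Borel sigma-algebra on full
      sequences, so openness is shown there; tuples reach that space by padding with zeros.\<close>
    define V where "V = {\<omega>. sym_class m (?R \<omega>) \<in> U}"
    have "open V"
    proof (subst open_subopen, intro ballI)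
      fix \<omega> assume "\<omega> \<in> V"
      then obtain r where r: "r > 0" "\<And>b. b \<in> sym_space m \<Longrightarrow> sym_dist m (sym_class m (?R \<omega>)) b < r \<Longrightarrow> b \<in> U"
        using U unfolding V_def by blast
      define W where "W = (\<Inter>i<m. (\<lambda>\<omega>'. \<omega>' i) -` ball (\<omega> i) r)"
      have "open W"
        unfolding W_def
        by (intro open_INT finite_lessThan ballI open_vimage open_ball) (rule continuous_on_product_coordinates)
      moreover have "\<omega> \<in> W" using r by (simp add: W_def)
      moreover have "W \<subseteq> V"
      proof
        fix \<omega>' assume "\<omega>' \<in> W"
        then have less: "\<bar>\<omega> i - \<omega>' i\<bar> < r" if "i < m" for i
          using that by (auto simp: W_def dist_real_def)
        have "sym_dist m (sym_class m (?R \<omega>)) (sym_class m (?R \<omega>')) \<le> (\<Sum>i<m. \<bar>?R \<omega> i - ?R \<omega>' i\<bar>) / real m"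
          using m by (intro sym_dist_class_le) auto
        also have "(\<Sum>i<m. \<bar>?R \<omega> i - ?R \<omega>' i\<bar>) < (\<Sum>i<m. r)"
          using less m by (intro sum_strict_mono) (auto simp: lessThan_empty_iff)
        then have "(\<Sum>i<m. \<bar>?R \<omega> i - ?R \<omega>' i\<bar>) / real m < r"
          using m by (simp add: field_simps)
        finally have "sym_dist m (sym_class m (?R \<omega>)) (sym_class m (?R \<omega>')) < r" .
        then show "\<omega>' \<in> V"
          unfolding V_def by (auto simp: sym_class_def sym_space_def intro!: r(2) quotientI)
      qed
      ultimately show "\<exists>T. open T \<and> \<omega> \<in> T \<and> T \<subseteq> V" by blast
    qed
    then have "V \<in> sets (borel_pow UNIV)"
      unfolding sets_PiM_equal_borel by simp
    moreover have "(\<lambda>x i. if i < m then x i else 0) \<in> borel_pow {..<m} \<rightarrow>\<^sub>M borel_pow UNIV"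
    proof (rule measurable_abs_UNIV)
      fix i show "(\<lambda>x. if i < m then x i else 0) \<in> borel_measurable (borel_pow {..<m})"
        by (cases "i < m") auto
    qed
    ultimately have "(\<lambda>x i. if i < m then x i else 0) -` V \<inter> space (borel_pow {..<m}) \<in> sets (borel_pow {..<m})"
      by (rule measurable_sets[rotated])
    also have "(\<lambda>x i. if i < m then x i else 0) -` V \<inter> space (borel_pow {..<m}) = sym_class m -` U \<inter> space (borel_pow {..<m})"
    proof -
      have "?R (\<lambda>i. if i < m then x i else 0) = x" if "x \<in> space (borel_pow {..<m})" for x
        using that by (auto simp: space_PiM PiE_def extensional_def fun_eq_iff restrict_def)
      then show ?thesis by (auto simp: V_def)
    qed
    finally show "sym_class m -` U \<inter> space (borel_pow {..<m}) \<in> sets (borel_pow {..<m})" .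
  qed (auto simp: openin_mtopology)
qed

text \<open>Draw \<open>p\<close> from \<kappa> and, independently, \<open>m\<close> uniform
  variables, and insert the same variables into the quantile functions of \<open>p\<close> and of
  \<open>e\<close>. Given \<open>p\<close>, each pair of coordinates has mean distance
  \<open>cdf_dist p e\<close>, and so has the average over the coordinates.\<close>

lemma gmw_sym_le:
  assumes m: "m \<ge> 1" and \<kappa>: "prob_space \<kappa>" "sets \<kappa> = sets borel_prob" and e: "e \<in> space borel_prob"
  shows "gmw_sym m (product_mixture {..<m} \<kappa>) (Pi\<^sub>M {..<m} (\<lambda>_. e)) \<le> (\<integral>\<^sup>+ p. cdf_dist p e \<partial>\<kappa>)"
proof -
  let ?I = "{..<m}"
  let ?U = "Pi\<^sub>M ?I (\<lambda>_. unif)"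
  let ?N = "\<kappa> \<Otimes>\<^sub>M ?U"
  define \<Phi> where "\<Phi> p u = (\<lambda>i\<in>?I. quantile p (u i))" for p and u :: "nat \<Rightarrow> real"
  interpret K: prob_space \<kappa> by (rule \<kappa>)
  interpret U: prob_space ?U by (intro prob_space_PiM prob_space_unif)
  interpret KU: pair_prob_space \<kappa> ?U ..
  have space_\<kappa>: "space \<kappa> = space borel_prob" by (rule sets_eq_imp_space_eq[OF \<kappa>(2)])
  have fst_meas [measurable]: "fst \<in> ?N \<rightarrow>\<^sub>M borel_prob"
    using measurable_fst[of \<kappa> ?U] by (simp add: \<kappa>(2) cong: measurable_cong_sets)
  have snd_meas [measurable]: "(\<lambda>w. snd w i) \<in> ?N \<rightarrow>\<^sub>M unif" if "i \<in> ?I" for i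
    using measurable_compose[OF measurable_snd[of \<kappa> ?U] measurable_component_singleton[OF that, of "\<lambda>_. unif"]] by simp
  let ?\<Phi> = "\<lambda>w. \<Phi> (fst w) (snd w)"
  let ?T1 = "\<lambda>w. sym_class m (\<Phi> (fst w) (snd w))" and ?T2 = "\<lambda>w. sym_class m (\<Phi> e (snd w))"
  let ?mix = "product_mixture ?I \<kappa>"
  have \<Phi>1 [measurable]: "?\<Phi> \<in> ?N \<rightarrow>\<^sub>M borel_pow ?I"
    unfolding \<Phi>_def by (intro measurable_restrict measurable_quantile_compose fst_meas snd_meas)
  have \<Phi>2 [measurable]: "(\<lambda>w. \<Phi> e (snd w)) \<in> ?N \<rightarrow>\<^sub>M borel_pow ?I"
    unfolding \<Phi>_def using e by (intro measurable_restrict measurable_quantile_compose snd_meas) auto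
  have \<Phi>p [measurable]: "\<Phi> p \<in> ?U \<rightarrow>\<^sub>M borel_pow ?I" if "p \<in> space borel_prob" for p
    unfolding \<Phi>_def using that
    by (intro measurable_restrict measurable_quantile_compose measurable_component_singleton) auto
  have distr_\<Phi>: "distr ?U (borel_pow ?I) (\<Phi> p) = Pi\<^sub>M ?I (\<lambda>_. p)" if p: "p \<in> space borel_prob" for p
  proof -
    have "distr ?U (borel_pow ?I) (\<Phi> p) = distr ?U (Pi\<^sub>M ?I (\<lambda>_. p)) (compose ?I (quantile p))"
      using sets_PiM_const[OF p] by (intro distr_cong) (auto simp: \<Phi>_def compose_def)
    also have "\<dots> = Pi\<^sub>M ?I (\<lambda>_. distr unif p (quantile p))"
      using p by (intro distr_PiM_finite_prob_space' prob_space_unif measurable_quantile1) (auto simp: space_borel_prob)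
    finally show ?thesis by (simp add: distr_quantile'[OF p])
  qed
  \<comment> \<open>Given \<open>p\<close>, the transformed uniform variables are i.i.d. with law
    \<open>p\<close>; averaging over \<kappa> gives the mixture.\<close>
  have mix1: "distr ?N (borel_pow ?I) ?\<Phi> = ?mix"
  proof (rule measure_eqI)
    note sets_mix = sets_bind'[OF in_space_prob_algebra_borel_prob[OF \<kappa>] measurable_PiM_borel_prob[of ?I]]
    show "sets (distr ?N (borel_pow ?I) ?\<Phi>) = sets (?mix)"
      using sets_mix by (simp add: product_mixture_eq_bind[OF \<kappa>])
    fix C assume "C \<in> sets (distr ?N (borel_pow ?I) ?\<Phi>)"
    then have C [measurable]: "C \<in> sets (borel_pow ?I)" by simp
    have "emeasure (distr ?N (borel_pow ?I) ?\<Phi>) C =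
      emeasure ?N (?\<Phi> -` C \<inter> space ?N)"
      by (intro emeasure_distr) measurable
    also have "\<dots> = (\<integral>\<^sup>+ p. emeasure ?U (Pair p -` (?\<Phi> -` C \<inter> space ?N)) \<partial>\<kappa>)"
      by (intro U.emeasure_pair_measure_alt measurable_sets[OF \<Phi>1]) measurable
    also have "\<dots> = (\<integral>\<^sup>+ p. emeasure (Pi\<^sub>M ?I (\<lambda>_. p)) C \<partial>\<kappa>)"
    proof (intro nn_integral_cong)
      fix p assume p: "p \<in> space \<kappa>"
      then have p': "p \<in> space borel_prob" by (simp add: space_\<kappa>)
      have "Pair p -` (?\<Phi> -` C \<inter> space ?N) = \<Phi> p -` C \<inter> space ?U"
        using p by (auto simp: space_pair_measure)
      then show "emeasure ?U (Pair p -` (?\<Phi> -` C \<inter> space ?N)) = emeasure (Pi\<^sub>M ?I (\<lambda>_. p)) C"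
        unfolding distr_\<Phi>[OF p', symmetric] by (simp add: emeasure_distr[OF \<Phi>p[OF p'] C])
    qed
    also have "\<dots> = emeasure (?mix) C"
      unfolding product_mixture_eq_bind[OF \<kappa>]
      by (rule emeasure_bind_prob_algebra[OF in_space_prob_algebra_borel_prob[OF \<kappa>] measurable_PiM_borel_prob C, symmetric])
    finally show "emeasure (distr ?N (borel_pow ?I) ?\<Phi>) C = emeasure (?mix) C" .
  qed
  have mix2: "distr ?N (borel_pow ?I) (\<lambda>w. \<Phi> e (snd w)) = Pi\<^sub>M ?I (\<lambda>_. e)"
  proof -
    have "distr ?N (borel_pow ?I) (\<lambda>w. \<Phi> e (snd w)) = distr (distr ?N ?U snd) (borel_pow ?I) (\<Phi> e)"
      using \<Phi>p[OF e] by (subst distr_distr) (auto simp: o_def)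
    also have "distr ?N ?U snd = ?U"
    proof (rule measure_eqI)
      fix A assume "A \<in> sets (distr ?N ?U snd)"
      then have A: "A \<in> sets ?U" by simp
      then have "emeasure (distr ?N ?U snd) A = emeasure ?N (space \<kappa> \<times> A)"
        using sets.sets_into_space[OF A]
        by (subst emeasure_distr) (auto simp: space_pair_measure intro!: arg_cong[where f="emeasure ?N"])
      also have "\<dots> = emeasure ?U A"
        using A by (simp add: U.emeasure_pair_measure_Times K.emeasure_space_1)
      finally show "emeasure (distr ?N ?U snd) A = emeasure ?U A" .
    qed simp
    finally show ?thesis by (simp add: distr_\<Phi>[OF e])
  qed
  let ?d = "\<lambda>p e u :: real. ennreal \<bar>quantile p u - quantile e u\<bar>"
  let ?h = "\<lambda>w. \<Sum>i<m. ?d (fst w) e (snd w i) * ennreal (1 / real m)"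
  have [measurable]: "?h \<in> borel_measurable ?N"
    using e by (intro borel_measurable_sum borel_measurable_times_ennreal measurable_compose[OF _ measurable_ennreal]
        borel_measurable_abs borel_measurable_diff measurable_quantile_compose fst_meas snd_meas measurable_const) auto
  have "gmw_sym m (?mix) (Pi\<^sub>M ?I (\<lambda>_. e)) \<le> (\<integral>\<^sup>+ w. ?h w \<partial>?N)"
    unfolding gmw_sym_def
  proof (rule gmw_le)
    show "prob_space ?N" by unfold_locales
    note sc = measurable_sym_class[OF m]
    have T1: "?T1 \<in> ?N \<rightarrow>\<^sub>M borel_sym m"
      by (rule measurable_compose[OF \<Phi>1 sc])
    then show "?T1 \<in> ?N \<rightarrow>\<^sub>M distr (?mix) (borel_sym m) (sym_class m)"
      by simp
    have T2: "?T2 \<in> ?N \<rightarrow>\<^sub>M borel_sym m"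
      by (rule measurable_compose[OF \<Phi>2 sc])
    then show "?T2 \<in> ?N \<rightarrow>\<^sub>M distr (Pi\<^sub>M ?I (\<lambda>_. e)) (borel_sym m) (sym_class m)"
      by simp
    have "distr ?N (borel_sym m) ?T1 = distr (?mix) (borel_sym m) (sym_class m)"
      unfolding mix1[symmetric] by (subst distr_distr[OF sc \<Phi>1]) (simp add: o_def)
    then show "distr ?N (distr (?mix) (borel_sym m) (sym_class m)) ?T1 =
      distr (?mix) (borel_sym m) (sym_class m)"
      by (subst distr_sets_cong[of _ "borel_sym m"]) simp_all
    have "distr ?N (borel_sym m) ?T2 = distr (Pi\<^sub>M ?I (\<lambda>_. e)) (borel_sym m) (sym_class m)"
      unfolding mix2[symmetric] by (subst distr_distr[OF sc \<Phi>2]) (simp add: o_def)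
    then show "distr ?N (distr (Pi\<^sub>M ?I (\<lambda>_. e)) (borel_sym m) (sym_class m)) ?T2 =
      distr (Pi\<^sub>M ?I (\<lambda>_. e)) (borel_sym m) (sym_class m)"
      by (subst distr_sets_cong[of _ "borel_sym m"]) simp_all
  next
    fix w
    have "sym_dist m (sym_class m (\<Phi> (fst w) (snd w))) (sym_class m (\<Phi> e (snd w))) \<le>
      (\<Sum>i<m. \<bar>\<Phi> (fst w) (snd w) i - \<Phi> e (snd w) i\<bar>) / real m"
      using m by (intro sym_dist_class_le) (auto simp: \<Phi>_def)
    also have "\<dots> = (\<Sum>i<m. \<bar>quantile (fst w) (snd w i) - quantile e (snd w i)\<bar> * (1 / real m))"
      by (simp add: \<Phi>_def sum_divide_distrib)
    finally show "ennreal (sym_dist m (sym_class m (\<Phi> (fst w) (snd w))) (sym_class m (\<Phi> e (snd w)))) \<le> ?h w"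
      by (simp add: ennreal_mult[symmetric] ennreal_leI)
  qed
  also have "\<dots> = (\<integral>\<^sup>+ p. \<integral>\<^sup>+ u. ?h (p, u) \<partial>?U \<partial>\<kappa>)"
    by (rule U.nn_integral_fst[symmetric]) measurable
  also have "\<dots> = (\<integral>\<^sup>+ p. cdf_dist p e \<partial>\<kappa>)"
  proof (intro nn_integral_cong)
    fix p assume "p \<in> space \<kappa>"
    then have p: "p \<in> space borel_prob" by (simp add: space_\<kappa>)
    have [measurable]: "(\<lambda>v. \<bar>quantile p v - quantile e v\<bar>) \<in> borel_measurable unif"
      using measurable_quantile_compose[of "\<lambda>_. p" unif "\<lambda>u. u"] measurable_quantile_compose[of "\<lambda>_. e" unif "\<lambda>u. u"] p e
      by simp
    have comp: "(\<integral>\<^sup>+ u. ?d p e (u i) \<partial>?U) = cdf_dist p e" if "i \<in> ?I" for i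
    proof -
      have "(\<integral>\<^sup>+ u. ?d p e (u i) \<partial>?U) = (\<integral>\<^sup>+ v. ?d p e v \<partial>distr ?U unif (\<lambda>u. u i))"
        using that by (subst nn_integral_distr) auto
      also have "distr ?U unif (\<lambda>u. u i) = unif"
        using that prob_space_unif by (intro distr_PiM_component) auto
      finally show ?thesis by (simp add: nn_integral_quantile_diff[OF p e])
    qed
    have "(\<integral>\<^sup>+ u. ?h (p, u) \<partial>?U) = (\<Sum>i<m. (\<integral>\<^sup>+ u. ?d p e (u i) \<partial>?U) * ennreal (1 / real m))"
      by (subst nn_integral_sum) (auto intro!: sum.cong nn_integral_multc measurable_compose[OF measurable_component_singleton])
    also have "\<dots> = (\<Sum>i<m. cdf_dist p e * ennreal (1 / real m))"
      using comp by (intro sum.cong) auto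
    also have "\<dots> = cdf_dist p e * (ennreal (real m) * ennreal (1 / real m))"
      by (simp add: ennreal_of_nat_eq_real_of_nat mult_ac)
    also have "ennreal (real m) * ennreal (1 / real m) = 1"
      using m by (simp flip: ennreal_mult)
    finally show "(\<integral>\<^sup>+ u. ?h (p, u) \<partial>?U) = cdf_dist p e" by simp
  qed
  finally show ?thesis .
qed

section \<open>Maximal inequality for centered bounded summands\<close>

lemma exp_le_quadratic: "exp y \<le> 1 + y + y\<^sup>2 / 2 * exp \<bar>y\<bar>" for y :: real
proof -
  obtain t where t: "\<bar>t\<bar> \<le> \<bar>y\<bar>" "exp y = (\<Sum>m<2. y ^ m / fact m) + exp t / fact 2 * y ^ 2"
    using Maclaurin_exp_le[of y 2] by blast
  have "exp y = 1 + y + y\<^sup>2 / 2 * exp t"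
    using t(2) by (simp add: numeral_2_eq_2)
  moreover have "y\<^sup>2 / 2 * exp t \<le> y\<^sup>2 / 2 * exp \<bar>y\<bar>"
    using t(1) by (intro mult_left_mono) auto
  ultimately show ?thesis by linarith
qed

text \<open>The exponent contains the variance bound \<open>s\<close> rather than the range of
  \<open>X\<close>; this is one source of the factor \<open>sqrt s\<close> in the maximal bound. The
  compensated exponential has mean at most 1, so its products along an i.i.d. sequence form a
  nonnegative supermartingale.\<close>

lemma (in prob_space) mgf_centered_bounded:
  fixes X :: "'a \<Rightarrow> real"
  assumes [measurable]: "X \<in> borel_measurable M"
    and bound: "\<And>x. x \<in> space M \<Longrightarrow> \<bar>X x\<bar> \<le> 1"
    and mean: "expectation X = 0" and var: "expectation (\<lambda>x. (X x)\<^sup>2) \<le> s"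
  shows "(\<integral>\<^sup>+x. ennreal (exp (l * X x - s * l\<^sup>2 * exp \<bar>l\<bar> / 2)) \<partial>M) \<le> 1"
proof -
  define c where "c = l\<^sup>2 * exp \<bar>l\<bar> / 2"
  have c: "c \<ge> 0" by (simp add: c_def)
  have intX: "integrable M X"
    using bound by (intro integrable_const_bound[of _ 1]) auto
  have intX2: "integrable M (\<lambda>x. (X x)\<^sup>2)"
    using bound by (intro integrable_const_bound[of _ 1]) (auto simp: abs_square_le_1)
  have le: "exp (l * X x) \<le> 1 + l * X x + c * (X x)\<^sup>2" if "x \<in> space M" for x
  proof -
    have "\<bar>l * X x\<bar> \<le> \<bar>l\<bar>"
      using bound[OF that] by (simp add: abs_mult mult_left_le)
    then have "(l * X x)\<^sup>2 / 2 * exp \<bar>l * X x\<bar> \<le> (l * X x)\<^sup>2 / 2 * exp \<bar>l\<bar>"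
      by (intro mult_left_mono) auto
    with exp_le_quadratic[of "l * X x"] show ?thesis
      by (simp add: c_def power_mult_distrib mult_ac)
  qed
  have "(\<integral>\<^sup>+x. ennreal (exp (l * X x)) \<partial>M) \<le> (\<integral>\<^sup>+x. ennreal (1 + l * X x + c * (X x)\<^sup>2) \<partial>M)"
    using le by (intro nn_integral_mono ennreal_leI) auto
  also have "\<dots> = ennreal (expectation (\<lambda>x. 1 + l * X x + c * (X x)\<^sup>2))"
    using intX intX2 by (intro nn_integral_eq_integral AE_I2)
      (auto intro: order_trans[OF exp_ge_zero le])
  also have "expectation (\<lambda>x. 1 + l * X x + c * (X x)\<^sup>2) = 1 + c * expectation (\<lambda>x. (X x)\<^sup>2)"
    using intX intX2 mean prob_space by simp
  also have "ennreal \<dots> \<le> ennreal (exp (c * s))"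
    using mult_left_mono[OF var c] exp_ge_add_one_self[of "c * s"] by (intro ennreal_leI) linarith
  finally have *: "(\<integral>\<^sup>+x. ennreal (exp (l * X x)) \<partial>M) \<le> ennreal (exp (c * s))" .
  have "(\<integral>\<^sup>+x. ennreal (exp (l * X x - c * s)) \<partial>M) = (\<integral>\<^sup>+x. ennreal (exp (- (c * s))) * ennreal (exp (l * X x)) \<partial>M)"
    by (simp add: ennreal_mult'[symmetric] exp_add[symmetric] algebra_simps)
  also have "\<dots> = ennreal (exp (- (c * s))) * (\<integral>\<^sup>+x. ennreal (exp (l * X x)) \<partial>M)"
    by (rule nn_integral_cmult) measurable
  also have "\<dots> \<le> ennreal (exp (- (c * s))) * ennreal (exp (c * s))"
    using * by (intro mult_left_mono) auto
  also have "\<dots> = 1"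
    by (simp add: ennreal_mult'[symmetric] exp_add[symmetric])
  finally show ?thesis by (simp add: c_def mult_ac)
qed

context sequence_space
begin

text \<open>The induction conditions on the first coordinate instead of stopping at the first passage.\<close>

lemma ville_finite:
  fixes Y :: "'a \<Rightarrow> ennreal" and a x :: ennreal
  assumes [measurable]: "Y \<in> borel_measurable M" and Y: "(\<integral>\<^sup>+ s. Y s \<partial>M) \<le> 1"
  shows "a * emeasure S {\<omega>\<in>space S. \<exists>n\<le>N. a \<le> x * (\<Prod>i<n. Y (\<omega> i))} \<le> x"
proof (induction N arbitrary: x)
  case 0
  show ?case
    by (cases "a \<le> x") (simp_all add: P.emeasure_space_1)
next
  case (Suc N)
  let ?E = "\<lambda>N x. {\<omega>\<in>space S. \<exists>n\<le>N. a \<le> x * (\<Prod>i<n. Y (\<omega> i))}"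
  show ?case
  proof (cases "a \<le> x")
    case True
    have "a * emeasure S (?E (Suc N) x) \<le> a * 1"
      by (intro mult_left_mono P.emeasure_le_1) auto
    with True show ?thesis by simp
  next
    case False
    have [measurable]: "?E N x \<in> sets S" for N x by measurable
    have "emeasure S (?E (Suc N) x) = emeasure (distr (M \<Otimes>\<^sub>M S) S (\<lambda>(s, \<omega>). case_nat s \<omega>)) (?E (Suc N) x)"
      by (simp only: PiM_iter)
    also have "\<dots> = emeasure (M \<Otimes>\<^sub>M S) ((\<lambda>(s, \<omega>). case_nat s \<omega>) -` ?E (Suc N) x \<inter> space (M \<Otimes>\<^sub>M S))"
      by (intro emeasure_distr) measurable
    also have "\<dots> = (\<integral>\<^sup>+ s. emeasure S (Pair s -` ((\<lambda>(s, \<omega>). case_nat s \<omega>) -` ?E (Suc N) x \<inter> space (M \<Otimes>\<^sub>M S))) \<partial>M)"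
      by (intro P.emeasure_pair_measure_alt measurable_sets[of _ _ S]) measurable
    also have "\<dots> = (\<integral>\<^sup>+ s. emeasure S (?E N (x * Y s)) \<partial>M)"
    proof (intro nn_integral_cong arg_cong[where f="emeasure S"])
      fix s assume s: "s \<in> space M"
      \<comment> \<open>Since \<open>x\<close> is below \<open>a\<close>, the empty product does not
        reach \<open>a\<close>, and a passage happens at a successor index. Its first factor is
        absorbed into the initial value, which is why the induction keeps \<open>x\<close>
        arbitrary.\<close>
      have "(\<exists>n\<le>Suc N. a \<le> x * (\<Prod>i<n. Y (case_nat s \<omega> i))) \<longleftrightarrow> (\<exists>n\<le>N. a \<le> x * Y s * (\<Prod>i<n. Y (\<omega> i)))" for \<omega>
      proof -
        have "(\<exists>n\<le>Suc N. a \<le> x * (\<Prod>i<n. Y (case_nat s \<omega> i))) \<longleftrightarrow>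
          (\<exists>n\<le>N. a \<le> x * (\<Prod>i<Suc n. Y (case_nat s \<omega> i)))"
          using False by (metis Suc_le_mono lessThan_0 mult.right_neutral not0_implies_Suc prod.empty)
        then show ?thesis
          by (simp only: prod.lessThan_Suc_shift) (simp add: mult.assoc)
      qed
      moreover have "case_nat s \<omega> \<in> space S" if "\<omega> \<in> space S" for \<omega>
        using s that by (auto simp: space_PiM PiE_iff split: nat.split)
      ultimately show "Pair s -` ((\<lambda>(s, \<omega>). case_nat s \<omega>) -` ?E (Suc N) x \<inter> space (M \<Otimes>\<^sub>M S)) = ?E N (x * Y s)"
        using s by (auto simp: space_pair_measure)
    qed
    finally have "a * emeasure S (?E (Suc N) x) = (\<integral>\<^sup>+ s. a * emeasure S (?E N (x * Y s)) \<partial>M)"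
    proof (subst nn_integral_cmult)
      have "{z \<in> space (M \<Otimes>\<^sub>M S). \<exists>n\<le>N. a \<le> x * Y (fst z) * (\<Prod>i<n. Y (snd z i))} \<in> sets (M \<Otimes>\<^sub>M S)"
        by measurable
      from P.measurable_emeasure_Pair[OF this]
      show "(\<lambda>s. emeasure S (?E N (x * Y s))) \<in> borel_measurable M"
        by (rule measurable_cong[THEN iffD1, rotated])
          (auto simp: space_pair_measure intro!: arg_cong[where f="emeasure S"])
    qed simp
    also have "\<dots> \<le> (\<integral>\<^sup>+ s. x * Y s \<partial>M)"
      by (intro nn_integral_mono Suc.IH)
    also have "\<dots> = x * (\<integral>\<^sup>+ s. Y s \<partial>M)"
      by (rule nn_integral_cmult) measurable
    also have "\<dots> \<le> x * 1"
      by (intro mult_left_mono Y) auto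
    finally show ?thesis by simp
  qed
qed

lemma ville:
  fixes Y :: "'a \<Rightarrow> ennreal" and a :: ennreal
  assumes [measurable]: "Y \<in> borel_measurable M" and Y: "(\<integral>\<^sup>+ s. Y s \<partial>M) \<le> 1"
  shows "a * emeasure S {\<omega>\<in>space S. \<exists>n. a \<le> (\<Prod>i<n. Y (\<omega> i))} \<le> 1"
proof -
  let ?E = "\<lambda>N. {\<omega>\<in>space S. \<exists>n\<le>N. a \<le> (\<Prod>i<n. Y (\<omega> i))}"
  have "{\<omega>\<in>space S. \<exists>n. a \<le> (\<Prod>i<n. Y (\<omega> i))} = (\<Union>N. ?E N)"
    by blast
  moreover have "(SUP N. emeasure S (?E N)) = emeasure S (\<Union>N. ?E N)"
    by (intro SUP_emeasure_incseq) (auto simp: incseq_def intro: order_trans)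
  ultimately have "a * emeasure S {\<omega>\<in>space S. \<exists>n. a \<le> (\<Prod>i<n. Y (\<omega> i))} = (SUP N. a * emeasure S (?E N))"
    by (simp flip: SUP_mult_left_ennreal)
  also have "\<dots> \<le> 1"
    using ville_finite[OF assms, of a _ 1] by (intro SUP_least) simp
  finally show ?thesis .
qed

end

text \<open>\<open>s\<close> only bounds the variance, so it can be chosen positive for degenerate
  laws too; the passage to the true variance comes later.\<close>

locale centered_bounded_sequence = sequence_space M for M :: "'a measure" +
  fixes X :: "'a \<Rightarrow> real" and s :: real
  assumes measurable_X [measurable]: "X \<in> borel_measurable M"
    and abs_X_le: "\<And>x. x \<in> space M \<Longrightarrow> \<bar>X x\<bar> \<le> 1"
    and mean_X: "(\<integral>x. X x \<partial>M) = 0"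
    and var_X: "(\<integral>x. (X x)\<^sup>2 \<partial>M) \<le> s"
begin

lemma prob_space_M: "prob_space M" by (rule prob_space)

text \<open>For fixed \<open>l\<close> one linear boundary controls all n at once. It is efficient
  for n of one order of magnitude, so \<open>l\<close> is tuned to each geometric block
  below.\<close>

lemma ville_exp:
  "emeasure S {\<omega>\<in>space S. \<exists>n. b \<le> l * (\<Sum>i<n. X (\<omega> i)) - real n * (s * l\<^sup>2 * exp \<bar>l\<bar> / 2)} \<le> ennreal (exp (- b))"
proof -
  let ?c = "s * l\<^sup>2 * exp \<bar>l\<bar> / 2"
  let ?Y = "\<lambda>x. ennreal (exp (l * X x - ?c))"
  have "(\<Prod>i<n. ?Y (\<omega> i)) = ennreal (exp (l * (\<Sum>i<n. X (\<omega> i)) - real n * ?c))" for \<omega> :: "nat \<Rightarrow> 'a" and n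
    by (simp add: prod_ennreal exp_sum[symmetric] sum_subtractf sum_distrib_left)
  moreover have "ennreal (exp b) * emeasure S {\<omega>\<in>space S. \<exists>n. ennreal (exp b) \<le> (\<Prod>i<n. ?Y (\<omega> i))} \<le> 1"
    using prob_space.mgf_centered_bounded[OF prob_space_M measurable_X abs_X_le mean_X var_X]
    by (intro ville) (auto simp: measurable_X)
  ultimately have "ennreal (exp b) * emeasure S {\<omega>\<in>space S. \<exists>n. b \<le> l * (\<Sum>i<n. X (\<omega> i)) - real n * ?c} \<le> 1"
    by simp
  then have "ennreal (exp (- b)) * (ennreal (exp b) * emeasure S {\<omega>\<in>space S. \<exists>n. b \<le> l * (\<Sum>i<n. X (\<omega> i)) - real n * ?c}) \<le> ennreal (exp (- b)) * 1"
    by (intro mult_left_mono) auto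
  then show ?thesis
    by (simp add: mult.assoc[symmetric] ennreal_mult'[symmetric] exp_add[symmetric])
qed

end

section \<open>The upper half of the law of the iterated logarithm\<close>

abbreviation lil_scale :: "nat \<Rightarrow> real" where
  "lil_scale n \<equiv> sqrt (real n * ln (ln (real n)))"

text \<open>The deterministic half of the block argument; \<open>G\<close> is a lower bound for the
  iterated logarithm on the block. \<open>l\<close> is chosen so that \<open>l * A = 2 * L\<close>
  and \<open>E * s * l = A\<close> with \<open>A = sqrt (2 * s) * sqrt (E * L)\<close>. Level and
  compensator then contribute equally up to \<open>exp l\<close>, which explains the average of
  \<eta> and \<open>\<eta> * exp l\<close>.\<close>

lemma lil_block:
  fixes s E L G n \<eta> r S l :: real
  assumes "s > 0" "E > 0" "L > 0" "G > 0" "E \<le> n" "n \<le> \<eta> * E" "G \<le> LL" "\<eta> \<ge> 0" "r \<ge> 0"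
    and l: "l = sqrt (2 * L / (s * E))"
    and r: "(\<eta> + \<eta> * exp l) / 2 * sqrt (L / G) \<le> r"
    and S: "l * S - n * (s * l\<^sup>2 * exp l / 2) \<le> \<eta> * L"
  shows "S \<le> r * sqrt (2 * s) * sqrt (n * LL)"
proof -
  define A where "A = sqrt (2 * s) * sqrt (E * L)"
  have A: "A \<ge> 0" using assms by (simp add: A_def)
  have l0: "l > 0" using assms by simp
  have "l * A = sqrt ((2 * L / (s * E)) * (2 * s * (E * L)))"
    unfolding A_def l by (simp only: real_sqrt_mult[symmetric] mult.assoc)
  also have "(2 * L / (s * E)) * (2 * s * (E * L)) = (2 * L)\<^sup>2"
    using assms by (simp add: field_simps power2_eq_square)
  finally have lA: "l * A = 2 * L" unfolding real_sqrt_abs using \<open>L > 0\<close> by simp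
  have "E * s * l = sqrt ((E * s)\<^sup>2 * (2 * L / (s * E)))"
    unfolding l real_sqrt_mult[of "(E * s)\<^sup>2"] using assms by simp
  also have "(E * s)\<^sup>2 * (2 * L / (s * E)) = 2 * s * (E * L)"
    using assms by (simp add: field_simps power2_eq_square)
  finally have EA: "E * s * l = A" by (simp add: A_def real_sqrt_mult)
  have "l * S \<le> \<eta> * L + n * (s * l\<^sup>2 * exp l / 2)" using S by simp
  also have "\<dots> \<le> \<eta> * L + (\<eta> * E) * (s * l\<^sup>2 * exp l / 2)"
    using assms by (intro add_left_mono mult_right_mono) auto
  also have "\<dots> = \<eta> * (l * A) / 2 + \<eta> * exp l / 2 * (E * s * l) * l"
    unfolding lA by (simp add: power2_eq_square)
  also have "\<dots> = l * ((\<eta> + \<eta> * exp l) / 2 * A)"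
    unfolding EA by (simp add: field_simps)
  finally have "S \<le> (\<eta> + \<eta> * exp l) / 2 * A"
    using l0 by simp
  also have "\<dots> = sqrt (2 * s) * sqrt E * ((\<eta> + \<eta> * exp l) / 2 * sqrt L)"
    by (simp add: A_def real_sqrt_mult)
  also have "(\<eta> + \<eta> * exp l) / 2 * sqrt L = (\<eta> + \<eta> * exp l) / 2 * sqrt (L / G) * sqrt G"
    using assms by (simp add: real_sqrt_divide)
  also have "sqrt (2 * s) * sqrt E * \<dots> \<le> sqrt (2 * s) * sqrt E * (r * sqrt G)"
    using assms r by (intro mult_left_mono mult_right_mono) auto
  also have "\<dots> = r * sqrt (2 * s) * sqrt (E * G)"
    by (simp add: real_sqrt_mult)
  also have "\<dots> \<le> r * sqrt (2 * s) * sqrt (n * LL)"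
    using assms by (intro mult_left_mono real_sqrt_le_mono mult_mono) auto
  finally show ?thesis .
qed

context centered_bounded_sequence
begin

lemma iterated_log_upper:
  assumes s: "s > 0" and c: "c > sqrt (2 * s)"
  shows "AE \<omega> in S. \<forall>\<^sub>F n in sequentially. (\<Sum>i<n. X (\<omega> i)) \<le> c * lil_scale n"
proof -
  define r where "r = c / sqrt (2 * s)"
  have r: "r > 1" "c = r * sqrt (2 * s)" using s c by (simp_all add: r_def)
  \<comment> \<open>\<eta> is both the ratio of the blocks and the exponent in the Borel-Cantelli
    series: above 1 to make \<open>k powr - \<eta>\<close> summable, below \<open>r\<close> to leave
    room for factors that tend to 1.\<close>
  define \<eta> where "\<eta> = (1 + r) / 2"
  have \<eta>: "1 < \<eta>" "\<eta> < r" using r by (simp_all add: \<eta>_def)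
  define h where "h = ln \<eta>"
  have h: "h > 0" "exp h = \<eta>" using \<eta> by (simp_all add: h_def)
  define l where "l k = sqrt (2 * ln (real k) / (s * exp (h * real k)))" for k :: nat
  define B where "B k = {\<omega>\<in>space S. \<exists>n. \<eta> * ln (real k) \<le> l k * (\<Sum>i<n. X (\<omega> i)) - real n * (s * (l k)\<^sup>2 * exp \<bar>l k\<bar> / 2)}" for k :: nat
  have [measurable]: "B k \<in> sets S" for k
    unfolding B_def by measurable
  have B: "measure S (B k) \<le> real k powr - \<eta>" if "k \<ge> 1" for k
  proof -
    have "emeasure S (B k) \<le> ennreal (exp (- (\<eta> * ln (real k))))"
      unfolding B_def by (rule ville_exp)
    moreover have "exp (- (\<eta> * ln (real k))) = real k powr - \<eta>"
      using that by (simp add: powr_def)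
    ultimately show ?thesis
      by (simp add: P.emeasure_eq_measure)
  qed
  have "AE \<omega> in S. \<forall>\<^sub>F k in sequentially. \<omega> \<in> space S - B k"
  proof (rule borel_cantelli_AE1)
    show "summable (\<lambda>k. measure S (B k))"
    proof (rule summable_comparison_test_ev)
      show "\<forall>\<^sub>F k in sequentially. norm (measure S (B k)) \<le> real k powr - \<eta>"
        using eventually_ge_at_top[of 1] by eventually_elim (simp add: B)
      show "summable (\<lambda>k. real k powr - \<eta>)"
        using \<eta> by (simp add: summable_real_powr_iff)
    qed
  qed (auto simp: P.emeasure_eq_measure)
  then show ?thesis
  proof eventually_elim
    case (elim \<omega>)
    have "(\<lambda>k. l k) \<longlonglongrightarrow> 0"
      unfolding l_def using h s by real_asymp
    moreover have "(\<lambda>k. sqrt (ln (real k) / ln (h * real k))) \<longlonglongrightarrow> 1"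
      using h by real_asymp
    ultimately have "(\<lambda>k. (\<eta> + \<eta> * exp (l k)) / 2 * sqrt (ln (real k) / ln (h * real k))) \<longlonglongrightarrow> (\<eta> + \<eta> * exp 0) / 2 * 1"
      by (intro tendsto_intros) auto
    then have ev1: "\<forall>\<^sub>F k in sequentially. (\<eta> + \<eta> * exp (l k)) / 2 * sqrt (ln (real k) / ln (h * real k)) < r"
      using \<eta> by (intro order_tendstoD(2)) auto
    have ev2: "\<forall>\<^sub>F k in sequentially. ln (h * real k) > 0"
      using h by real_asymp
    have "\<forall>\<^sub>F k in sequentially. \<forall>n. exp (h * real k) \<le> real n \<and> real n < exp (h * (real k + 1)) \<longrightarrow>
      (\<Sum>i<n. X (\<omega> i)) \<le> c * lil_scale n"
      using elim ev1 ev2 eventually_ge_at_top[of 2]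
    proof eventually_elim
      case (elim k)
      show ?case
      proof (intro allI impI)
        fix n :: nat assume n: "exp (h * real k) \<le> real n \<and> real n < exp (h * (real k + 1))"
        have "0 < real n" using n exp_gt_zero less_le_trans by blast
        have lk: "ln (real k) > 0" using elim by simp
        have l0: "l k \<ge> 0" using s lk by (simp add: l_def)
        have hk: "h * real k > 0" using h elim by simp
        have "h * real k \<le> ln (real n)"
          using n \<open>0 < real n\<close> by (simp add: ln_ge_iff)
        then have "ln (h * real k) \<le> ln (ln (real n))"
          using hk by (intro ln_mono) auto
        moreover have "real n \<le> \<eta> * exp (h * real k)"
          using n h by (simp add: distrib_left exp_add mult_ac)
        moreover have "l k * (\<Sum>i<n. X (\<omega> i)) - real n * (s * (l k)\<^sup>2 * exp (l k) / 2) \<le> \<eta> * ln (real k)"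
        proof -
          have "\<not> \<eta> * ln (real k) \<le> l k * (\<Sum>i<n. X (\<omega> i)) - real n * (s * (l k)\<^sup>2 * exp \<bar>l k\<bar> / 2)"
            using elim(1) unfolding B_def by blast
          then show ?thesis using l0 by simp
        qed
        ultimately show "(\<Sum>i<n. X (\<omega> i)) \<le> c * lil_scale n"
          unfolding r(2) using s lk elim n \<eta> r
          by (intro lil_block[where E="exp (h * real k)" and L="ln (real k)" and G="ln (h * real k)" and \<eta>=\<eta> and l="l k"])
            (auto simp: l_def)
      qed
    qed
    \<comment> \<open>This is the index of the block containing n; as it tends to infinity, what
      holds in all late blocks holds for all large n.\<close>
    moreover have "filterlim (\<lambda>n. nat \<lfloor>ln (real n) / h\<rfloor>) at_top sequentially"
      using h by real_asymp
    ultimately have "\<forall>\<^sub>F n in sequentially. \<forall>m. exp (h * real (nat \<lfloor>ln (real n) / h\<rfloor>)) \<le> real m \<and>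
      real m < exp (h * (real (nat \<lfloor>ln (real n) / h\<rfloor>) + 1)) \<longrightarrow>
      (\<Sum>i<m. X (\<omega> i)) \<le> c * sqrt (real m * ln (ln (real m)))"
      by (rule eventually_compose_filterlim)
    then show ?case
      using eventually_ge_at_top[of 1]
    proof eventually_elim
      case (elim n)
      let ?k = "nat \<lfloor>ln (real n) / h\<rfloor>"
      have pos: "ln (real n) / h \<ge> 0" "real n > 0" using elim h by auto
      then have "real ?k \<le> ln (real n) / h" "ln (real n) / h < real ?k + 1"
        by linarith+
      then have "h * real ?k \<le> ln (real n)" "ln (real n) < h * (real ?k + 1)"
        using h by (simp_all add: field_simps)
      then have "exp (h * real ?k) \<le> real n" "real n < exp (h * (real ?k + 1))"
        using pos by (metis exp_le_cancel_iff exp_ln, metis exp_less_cancel_iff exp_ln)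
      then show ?case using elim by blast
    qed
  qed
qed

lemma uminus: "centered_bounded_sequence M (\<lambda>x. - X x) s"
  using abs_X_le mean_X var_X by unfold_locales auto

lemma iterated_log:
  assumes s: "s > 0" and c: "c > sqrt (2 * s)"
  shows "AE \<omega> in S. \<forall>\<^sub>F n in sequentially. \<bar>\<Sum>i<n. X (\<omega> i)\<bar> \<le> c * lil_scale n"
proof -
  interpret U: centered_bounded_sequence M "\<lambda>x. - X x" s by (rule uminus)
  show ?thesis
    using iterated_log_upper[OF assms] U.iterated_log_upper[OF assms]
  proof eventually_elim
    case (elim \<omega>)
    then show ?case
      by eventually_elim (simp add: sum_negf abs_le_iff)
  qed
qed

end

section \<open>An integrable bound in the law of the iterated logarithm\<close>

text \<open>The induction carries the sharper bound \<open>3 * x K\<close> as long as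
  \<open>x K < 1\<close>, where 3 is the sum of the powers of 3/4 from the first on; one last term
  below 1 gives 4. Once a term has reached 1, all later ones are cut off.\<close>

lemma sum_geometric_below_one:
  fixes x :: "nat \<Rightarrow> real"
  assumes pos: "\<And>k. x k \<ge> 0" and growth: "\<And>k. x (Suc k) \<ge> 4 / 3 * x k"
  shows "(\<Sum>k<K. if x k < 1 then x k else 0) \<le> 4"
proof -
  have "(x K < 1 \<longrightarrow> (\<Sum>k<K. if x k < 1 then x k else 0) \<le> 3 * x K) \<and> (\<Sum>k<K. if x k < 1 then x k else 0) \<le> 4" for K
  proof (induction K)
    case (Suc K)
    then show ?case
      using growth[of K] pos[of K] by (cases "x K < 1") auto
  qed (simp add: pos)
  then show ?thesis by blast
qed

text \<open>A discrete layer-cake bound: there are at least \<open>u\<close> integers from 0 up to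
  \<open>u\<close>. It turns the mean of an excess into a sum of tail probabilities.\<close>

lemma ennreal_le_suminf_indicator:
  fixes P :: "nat \<Rightarrow> bool" and u :: real
  assumes "\<And>j. real j \<le> u \<Longrightarrow> P j"
  shows "ennreal u \<le> (\<Sum>j. if P j then 1 else 0)"
proof -
  define N where "N = nat \<lceil>u\<rceil>"
  have P: "P j" if "j < N" for j
    using that by (intro assms) (simp add: N_def, linarith)
  have "u \<le> real N" unfolding N_def by linarith
  then have "ennreal u \<le> of_nat N"
    by (simp add: ennreal_of_nat_eq_real_of_nat ennreal_leI)
  also have "\<dots> = (\<Sum>j<N. if P j then 1 else 0)"
    using P by simp
  also have "\<dots> \<le> (\<Sum>j. if P j then 1 else 0)"
    by (intro sum_le_suminf) auto
  finally show ?thesis .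
qed

lemma ln_ge_one: "real k \<ge> 3 \<Longrightarrow> ln (real k) \<ge> 1"
  using exp_le by (subst ln_ge_iff) auto

text \<open>The argument of \<open>lil_block\<close> with explicit constants. The condition
  \<open>s * E \<ge> L\<close> forces \<open>l \<le> 1\<close>, so \<open>exp l\<close> is at most
  3; with \<open>n \<le> 3 * E\<close> the compensator costs \<open>9 / 2 * A\<close>. Adding 2 for
  the level \<open>2 * L\<close> gives 13/2, rounded up to 7.\<close>

lemma lil_sup_block:
  fixes s E L n S l u :: real
  assumes "s > 0" "E > 0" "L \<ge> 1" "s * E \<ge> L" "E \<le> n" "n \<le> 3 * E" "L \<le> LL" "u \<ge> 0"
    and l: "l = sqrt (L / (s * E))"
    and S: "l * S - n * (s * l\<^sup>2 * exp \<bar>l\<bar> / 2) - 2 * L \<le> u"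
  shows "S \<le> sqrt s * (u + 7) * sqrt (n * LL)"
proof -
  define A where "A = sqrt s * sqrt (E * L)"
  have A: "A \<ge> 0" using assms by (simp add: A_def)
  have l0: "l > 0" using assms by simp
  have l1: "l \<le> 1" unfolding l using assms by simp
  have "l * A = sqrt ((L / (s * E)) * (s * (E * L)))"
    unfolding A_def l by (simp only: real_sqrt_mult[symmetric] mult.assoc)
  also have "(L / (s * E)) * (s * (E * L)) = L\<^sup>2"
    using assms by (simp add: field_simps power2_eq_square)
  finally have lA: "l * A = L" unfolding real_sqrt_abs using \<open>L \<ge> 1\<close> by simp
  have "E * s * l = sqrt ((E * s)\<^sup>2 * (L / (s * E)))"
    unfolding l real_sqrt_mult[of "(E * s)\<^sup>2"] using assms by simp
  also have "(E * s)\<^sup>2 * (L / (s * E)) = s * (E * L)"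
    using assms by (simp add: field_simps power2_eq_square)
  finally have EA: "E * s * l = A" by (simp add: A_def real_sqrt_mult)
  have "exp \<bar>l\<bar> \<le> 3" using l0 l1 exp_le order_trans[of "exp \<bar>l\<bar>" "exp 1" 3] by simp
  then have "n * (s * l\<^sup>2 * exp \<bar>l\<bar> / 2) \<le> (3 * E) * (s * l\<^sup>2 * 3 / 2)"
    using assms by (intro mult_mono divide_right_mono mult_left_mono) auto
  also have "\<dots> = 9 / 2 * (E * s * l) * l"
    by (simp add: power2_eq_square)
  finally have "l * S \<le> u + 2 * L + 9 / 2 * A * l"
    using S EA by simp
  also have "\<dots> \<le> u * L + 2 * L + 9 / 2 * A * l"
    using mult_left_mono[OF \<open>L \<ge> 1\<close> \<open>u \<ge> 0\<close>] by simp
  also have "\<dots> = l * ((u + 2 + 9 / 2) * A)"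
    by (simp add: lA[symmetric] algebra_simps)
  finally have "S \<le> (u + 2 + 9 / 2) * A"
    using l0 by simp
  also have "\<dots> \<le> (u + 7) * A"
    using A by (intro mult_right_mono) auto
  also have "\<dots> = sqrt s * (u + 7) * sqrt (E * L)"
    by (simp add: A_def)
  also have "\<dots> \<le> sqrt s * (u + 7) * sqrt (n * LL)"
    using assms by (intro mult_left_mono real_sqrt_le_mono mult_mono) auto
  finally show ?thesis .
qed

lemma suminf_inverse_squares_le: "(\<Sum>k. ennreal (1 / (real (k + 3))\<^sup>2)) \<le> ennreal (1 / 2)"
proof (rule suminf_le_const)
  fix K
  have "(\<Sum>k<K. 1 / (real (k + 3))\<^sup>2) \<le> 1 / 2 - 1 / real (K + 2)"
  proof (induction K)
    case (Suc K)
    have "1 / (real (K + 3))\<^sup>2 \<le> 1 / (real (K + 2) * real (K + 3))"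
      unfolding power2_eq_square by (intro divide_left_mono mult_right_mono) auto
    also have "\<dots> = 1 / real (K + 2) - 1 / real (K + 3)"
      by (simp add: field_simps)
    finally have "1 / (real (K + 3))\<^sup>2 \<le> 1 / real (K + 2) - 1 / real (K + 3)" .
    with Suc show ?case by (simp add: algebra_simps)
  qed simp
  also have "\<dots> \<le> 1 / 2" by simp
  finally have "ennreal (\<Sum>k<K. 1 / (real (k + 3))\<^sup>2) \<le> ennreal (1 / 2)"
    by (rule ennreal_leI)
  then show "(\<Sum>k<K. ennreal (1 / (real (k + 3))\<^sup>2)) \<le> ennreal (1 / 2)"
    by (subst sum_ennreal) simp_all
qed simp

lemma suminf_exp_minus_le: "(\<Sum>j. ennreal (exp (- real j))) \<le> 2"
proof -
  have "(\<lambda>j. exp (-1) ^ j) sums (1 / (1 - exp (-1 :: real)))"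
    by (intro geometric_sums) auto
  moreover have "exp (-1) ^ j = exp (- real j)" for j
    by (simp flip: exp_of_nat_mult)
  ultimately have "(\<lambda>j. exp (- real j)) sums (1 / (1 - exp (-1)))" by simp
  then have "(\<Sum>j. ennreal (exp (- real j))) = ennreal (1 / (1 - exp (-1)))"
    by (intro suminf_ennreal_eq) auto
  also have "exp 1 \<ge> (2 :: real)"
    using exp_ge_add_one_self[of 1] by simp
  then have "1 / (1 - exp (-1)) \<le> (2 :: real)"
    by (simp add: exp_minus field_simps)
  then have "ennreal (1 / (1 - exp (-1))) \<le> ennreal 2"
    by (rule ennreal_leI)
  finally show ?thesis by simp
qed

text \<open>The mean absolute value is bounded by a multiple of the variance bound and not of its
  root, as for centred indicators. This makes the first-moment estimate strong enough for those n
  that are small compared with \<open>1 / s\<close>.\<close>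

locale centered_bounded_abs_sequence = centered_bounded_sequence M X s
  for M :: "'a measure" and X :: "'a \<Rightarrow> real" and s :: real +
  assumes abs_X: "(\<integral>\<^sup>+x. ennreal \<bar>X x\<bar> \<partial>M) \<le> ennreal (2 * s)"
begin

text \<open>With \<open>E = exp k\<close>, the blocks \<open>exp k \<le> n < exp (k + 1)\<close> with \<open>s E \<ge> ln k\<close> are controlled by the maximal
  inequality with parameter \<open>sqrt (ln k / (s E))\<close>, and the others by the first moment; in the
  latter range the bounds grow geometrically with \<open>k\<close>, so that they sum up to a multiple of \<open>sqrt s\<close>.\<close>

lemma nn_integral_sup_le:
  assumes s: "s > 0"
  shows "(\<integral>\<^sup>+\<omega>. (SUP n\<in>{21..}. ennreal (\<bar>\<Sum>i<n. X (\<omega> i)\<bar> / lil_scale n)) \<partial>S) \<le> ennreal (41 * sqrt s)"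
proof -
  \<comment> \<open>The shift by 3 makes \<open>L k\<close> at least 1 and lets the first block
    start at \<open>exp 3\<close>, just below 21; hence the range of the supremum.\<close>
  define E where "E k = exp (real k + 3)" for k :: nat
  define L where "L k = ln (real k + 3)" for k :: nat
  define l where "l k = sqrt (L k / (s * E k))" for k
  \<comment> \<open>The level \<open>2 * L k + j\<close> has tail probability at most
    \<open>exp (- j) / (k + 3)^2\<close>, summable in both indices. The values 1 and -1 of \<sigma>
    treat the two signs of the sum, and the number of events that occur as \<open>j\<close> varies
    bounds the excess over \<open>2 * L k\<close>.\<close>
  define B where "B k \<sigma> j = {\<omega>\<in>space S. \<exists>n. 2 * L k + real j \<le> (\<sigma> * l k) * (\<Sum>i<n. X (\<omega> i)) - real n * (s * (\<sigma> * l k)\<^sup>2 * exp \<bar>\<sigma> * l k\<bar> / 2)}"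
    for k :: nat and \<sigma> :: real and j :: nat
  define R where "R \<omega> = (\<Sum>k. (\<Sum>j. indicator (B k 1 j) \<omega>) + (\<Sum>j. indicator (B k (-1) j) \<omega>) :: ennreal)" for \<omega> :: "nat \<Rightarrow> 'a"
  define N where "N k = nat \<lceil>3 * E k\<rceil>" for k
  \<comment> \<open>The blocks whose variance is too small for the exponential bound: absolute
    values summed up to \<open>N k\<close> control every n of the block at once.\<close>
  define W where "W \<omega> = (\<Sum>k. if s * E k < L k then ennreal (1 / sqrt (E k * L k)) * (\<Sum>i<N k. ennreal \<bar>X (\<omega> i)\<bar>) else 0)"
    for \<omega> :: "nat \<Rightarrow> 'a"
  have E: "E k \<ge> 1" for k by (simp add: E_def)
  have L: "L k \<ge> 1" for k unfolding L_def using ln_ge_one[of "k + 3"] by (simp add: add_ac)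
  have l0: "l k \<ge> 0" for k unfolding l_def using s E[of k] L[of k] by simp
  have [measurable]: "B k \<sigma> j \<in> sets S" for k \<sigma> j unfolding B_def by measurable
  have [measurable]: "R \<in> borel_measurable S" unfolding R_def[abs_def] by measurable
  have [measurable]: "W \<in> borel_measurable S" unfolding W_def[abs_def] by measurable

  have bound: "ennreal (\<bar>\<Sum>i<n. X (\<omega> i)\<bar> / lil_scale n) \<le> ennreal (sqrt s) * (R \<omega> + 7) + W \<omega>"
    if \<omega>: "\<omega> \<in> space S" and n: "n \<ge> 21" for \<omega> n
  proof -
    let ?S = "\<Sum>i<n. X (\<omega> i)"
    have "exp (3::real) = exp 1 ^ 3" by (simp flip: exp_of_nat_mult)
    also have "\<dots> \<le> (272 / 100) ^ 3"
      using e_less_272 by (intro power_mono) auto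
    finally have "exp (3::real) \<le> 21" by (simp add: power3_eq_cube)
    with n have "exp 3 \<le> real n" by linarith
    then have ln3: "3 \<le> ln (real n)"
      using n by (subst ln_ge_iff) auto
    define k where "k = nat \<lfloor>ln (real n)\<rfloor> - 3"
    have k: "real k + 3 \<le> ln (real n)" "ln (real n) < real k + 4"
      using ln3 unfolding k_def by linarith+
    have nE: "E k \<le> real n"
      using k(1) n unfolding E_def by (simp flip: ln_ge_iff)
    have "real n < exp (real k + 4)"
      using k(2) n by (metis exp_less_cancel_iff exp_ln less_le_trans of_nat_0_less_iff zero_less_numeral)
    also have "\<dots> = exp 1 * E k" by (simp add: E_def flip: exp_add)
    also have "\<dots> \<le> 3 * E k" using exp_le E[of k] by (intro mult_right_mono) auto
    finally have nE3: "real n \<le> 3 * E k" by simp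
    have LL: "L k \<le> ln (ln (real n))"
      unfolding L_def using k by (intro ln_mono) auto
    have den: "lil_scale n \<ge> sqrt (E k * L k)"
      using nE LL E[of k] L[of k] by (intro real_sqrt_le_mono mult_mono) auto
    have den0: "sqrt (E k * L k) > 0"
      using E[of k] L[of k] by (simp add: mult_pos_pos)
    show ?thesis
    proof (cases "s * E k < L k")
      case True
      have "n \<le> N k"
        using nE3 unfolding N_def by linarith
      have "\<bar>?S\<bar> \<le> (\<Sum>i<n. \<bar>X (\<omega> i)\<bar>)" by (rule sum_abs)
      also have "\<dots> \<le> (\<Sum>i<N k. \<bar>X (\<omega> i)\<bar>)"
        using \<open>n \<le> N k\<close> by (intro sum_mono2) auto
      finally have "\<bar>?S\<bar> / lil_scale n \<le> (\<Sum>i<N k. \<bar>X (\<omega> i)\<bar>) / sqrt (E k * L k)"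
        using den den0 by (intro frac_le) auto
      then have "ennreal (\<bar>?S\<bar> / lil_scale n) \<le> ennreal (1 / sqrt (E k * L k) * (\<Sum>i<N k. \<bar>X (\<omega> i)\<bar>))"
        by (intro ennreal_leI) simp
      also have "\<dots> = ennreal (1 / sqrt (E k * L k)) * (\<Sum>i<N k. ennreal \<bar>X (\<omega> i)\<bar>)"
        using den0 by (subst ennreal_mult) (auto simp: sum_nonneg sum_ennreal)
      also have "\<dots> = (\<Sum>k\<in>{k}. if s * E k < L k then ennreal (1 / sqrt (E k * L k)) * (\<Sum>i<N k. ennreal \<bar>X (\<omega> i)\<bar>) else 0)"
        using True by simp
      also have "\<dots> \<le> W \<omega>"
        unfolding W_def by (intro sum_le_suminf) auto
      also have "\<dots> \<le> ennreal (sqrt s) * (R \<omega> + 7) + W \<omega>"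
        by simp
      finally show ?thesis .
    next
      case False
      define \<sigma> :: real where "\<sigma> = (if ?S \<ge> 0 then 1 else -1)"
      have \<sigma>: "\<sigma> * ?S = \<bar>?S\<bar>" "\<sigma> = 1 \<or> \<sigma> = -1" by (auto simp: \<sigma>_def)
      define u where "u = l k * \<bar>?S\<bar> - real n * (s * (l k)\<^sup>2 * exp \<bar>l k\<bar> / 2) - 2 * L k"
      have "\<bar>?S\<bar> \<le> sqrt s * (max 0 u + 7) * lil_scale n"
        using s E[of k] L[of k] False nE nE3 LL
        by (intro lil_sup_block[where E="E k" and L="L k" and l="l k"]) (auto simp: l_def u_def)
      then have "\<bar>?S\<bar> / lil_scale n \<le> sqrt s * (max 0 u + 7)"
        using den den0 by (subst pos_divide_le_eq) auto
      then have "ennreal (\<bar>?S\<bar> / lil_scale n) \<le> ennreal (sqrt s * (max 0 u + 7))"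
        by (rule ennreal_leI)
      also have "\<dots> = ennreal (sqrt s) * (ennreal u + 7)"
        using s by (subst ennreal_mult) (auto simp: ennreal_plus max_def ennreal_neg)
      also have "ennreal u \<le> R \<omega>"
      proof -
        have "ennreal u \<le> (\<Sum>j. if \<omega> \<in> B k \<sigma> j then 1 else 0)"
        proof (rule ennreal_le_suminf_indicator)
          fix j assume "real j \<le> u"
          then have "2 * L k + real j \<le> (\<sigma> * l k) * ?S - real n * (s * (\<sigma> * l k)\<^sup>2 * exp \<bar>\<sigma> * l k\<bar> / 2)"
            using \<sigma> by (auto simp: u_def abs_mult)
          then show "\<omega> \<in> B k \<sigma> j"
            using \<omega> unfolding B_def by blast
        qed
        also have "\<dots> = (\<Sum>j. indicator (B k \<sigma> j) \<omega>)"
          by (simp add: indicator_def of_bool_def)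
        also have "\<dots> \<le> (\<Sum>k\<in>{k}. (\<Sum>j. indicator (B k 1 j) \<omega>) + (\<Sum>j. indicator (B k (-1) j) \<omega>))"
          using \<sigma>(2) by auto
        also have "\<dots> \<le> R \<omega>"
          unfolding R_def by (intro sum_le_suminf) auto
        finally show ?thesis .
      qed
      then have "ennreal (sqrt s) * (ennreal u + 7) \<le> ennreal (sqrt s) * (R \<omega> + 7) + W \<omega>"
        by (intro add_increasing2 mult_left_mono add_mono) auto
      finally show ?thesis .
    qed
  qed

  have intR: "(\<integral>\<^sup>+\<omega>. R \<omega> \<partial>S) \<le> 2"
  proof -
    have B_le: "emeasure S (B k \<sigma> j) \<le> ennreal (1 / (real (k + 3))\<^sup>2) * ennreal (exp (- real j))" for k \<sigma> j
    proof -
      have "emeasure S (B k \<sigma> j) \<le> ennreal (exp (- (2 * L k + real j)))"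
        unfolding B_def by (rule ville_exp)
      also have "exp (- (2 * L k + real j)) = (exp (- L k))\<^sup>2 * exp (- real j)"
        by (simp add: power2_eq_square flip: exp_add)
      also have "exp (- L k) = 1 / real (k + 3)"
        unfolding L_def by (simp add: exp_minus inverse_eq_divide add_ac)
      finally show ?thesis by (subst ennreal_mult[symmetric]) (simp_all add: power_divide)
    qed
    have B_sum: "(\<Sum>j. emeasure S (B k \<sigma> j)) \<le> ennreal (1 / (real (k + 3))\<^sup>2) * 2" for k \<sigma>
    proof -
      have "(\<Sum>j. emeasure S (B k \<sigma> j)) \<le> (\<Sum>j. ennreal (1 / (real (k + 3))\<^sup>2) * ennreal (exp (- real j)))"
        by (intro suminf_le B_le) auto
      also have "\<dots> \<le> ennreal (1 / (real (k + 3))\<^sup>2) * 2"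
        unfolding ennreal_suminf_cmult by (intro mult_left_mono suminf_exp_minus_le) auto
      finally show ?thesis .
    qed
    have "(\<integral>\<^sup>+\<omega>. R \<omega> \<partial>S) = (\<Sum>k. (\<Sum>j. emeasure S (B k 1 j)) + (\<Sum>j. emeasure S (B k (-1) j)))"
      unfolding R_def by (simp add: nn_integral_suminf nn_integral_add)
    \<comment> \<open>The sum over \<open>j\<close> contributes a factor of at most 2 for each of
      the two signs.\<close>
    also have "\<dots> \<le> (\<Sum>k. ennreal (1 / (real (k + 3))\<^sup>2) * 4)"
    proof (intro suminf_le)
      fix k
      show "(\<Sum>j. emeasure S (B k 1 j)) + (\<Sum>j. emeasure S (B k (-1) j)) \<le> ennreal (1 / (real (k + 3))\<^sup>2) * 4"
        using add_mono[OF B_sum[of k 1] B_sum[of k "-1"]] by (simp flip: distrib_left)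
    qed auto
    also have "\<dots> = (\<Sum>k. ennreal (1 / (real (k + 3))\<^sup>2)) * 4"
      by (rule ennreal_suminf_multc)
    also have "\<dots> \<le> ennreal (1 / 2) * 4"
      by (intro mult_right_mono suminf_inverse_squares_le) auto
    also have "\<dots> = ennreal (1 / 2) * ennreal 4" by simp
    also have "\<dots> = 2" by (subst ennreal_mult[symmetric]) auto
    finally show ?thesis .
  qed

  have intW: "(\<integral>\<^sup>+\<omega>. W \<omega> \<partial>S) \<le> ennreal (32 * sqrt s)"
  proof -
    define x where "x k = sqrt (s * E k / L k)" for k
    have x0: "x k \<ge> 0" for k unfolding x_def using s E[of k] L[of k] by simp
    \<comment> \<open>\<open>exp 1\<close> is at least 8/3 and \<open>L\<close> grows by a factor of
      at most 4/3, so the square of \<open>x\<close> at least doubles, and 2 exceeds the square of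
      4/3.\<close>
    have growth: "x (Suc k) \<ge> 4 / 3 * x k" for k
    proof -
      have "L (Suc k) \<le> L k + 1 / 3"
      proof -
        have "L (Suc k) - L k = ln ((real k + 4) / (real k + 3))"
          unfolding L_def by (simp add: ln_div add_ac)
        also have "(real k + 4) / (real k + 3) = 1 + 1 / (real k + 3)"
          by (simp add: field_simps)
        also have "ln \<dots> \<le> 1 / (real k + 3)" by (intro ln_add_one_self_le_self) auto
        also have "\<dots> \<le> 1 / 3" by (simp add: field_simps)
        finally show ?thesis by simp
      qed
      also have "\<dots> \<le> 4 / 3 * L k" using L[of k] by simp
      finally have L': "L (Suc k) \<le> 4 / 3 * L k" .
      have "(8 / 3 :: real) \<le> exp 1"
        using e_approx_32 by (simp add: abs_if split: if_splits)
      then have "8 / 3 * E k \<le> exp 1 * E k"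
        using E[of k] by (intro mult_right_mono) auto
      also have "\<dots> = E (Suc k)" by (simp add: E_def flip: exp_add)
      finally have E': "E (Suc k) \<ge> 8 / 3 * E k" .
      have "(4 / 3)\<^sup>2 * (s * E k / L k) \<le> s * (8 / 3 * E k) / (4 / 3 * L k)"
        using s E[of k] L[of k] by (simp add: field_simps power2_eq_square)
      also have "\<dots> \<le> s * E (Suc k) / L (Suc k)"
        using s E' L' E[of k] L[of "Suc k"] L[of k] by (intro frac_le mult_left_mono) auto
      finally have "sqrt ((4 / 3)\<^sup>2 * (s * E k / L k)) \<le> x (Suc k)"
        unfolding x_def by (rule real_sqrt_le_mono)
      then show ?thesis
        unfolding real_sqrt_mult x_def by simp
    qed
    have EX: "(\<integral>\<^sup>+\<omega>. ennreal \<bar>X (\<omega> i)\<bar> \<partial>S) \<le> ennreal (2 * s)" for i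
    proof -
      have "(\<integral>\<^sup>+\<omega>. ennreal \<bar>X (\<omega> i)\<bar> \<partial>S) = (\<integral>\<^sup>+y. ennreal \<bar>X y\<bar> \<partial>distr S M (\<lambda>\<omega>. \<omega> i))"
        by (subst nn_integral_distr) auto
      then show ?thesis using abs_X by (simp add: PiM_component)
    qed
    have "(\<integral>\<^sup>+\<omega>. W \<omega> \<partial>S) = (\<Sum>k. if s * E k < L k then ennreal (1 / sqrt (E k * L k)) * (\<Sum>i<N k. \<integral>\<^sup>+\<omega>. ennreal \<bar>X (\<omega> i)\<bar> \<partial>S) else 0)"
      unfolding W_def
      by (subst nn_integral_suminf) (auto intro!: suminf_cong simp: nn_integral_cmult nn_integral_sum simp del: sum_ennreal)
    \<comment> \<open>8 is the product of 4, from \<open>N k \<le> 4 * E k\<close>, and 2, from the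
      first moment \<open>2 * s\<close>; the geometric sum contributes another 4, hence 32.\<close>
    also have "\<dots> \<le> (\<Sum>k. ennreal (8 * sqrt s * (if x k < 1 then x k else 0)))"
    proof (intro suminf_le)
      fix k
      show "(if s * E k < L k then ennreal (1 / sqrt (E k * L k)) * (\<Sum>i<N k. \<integral>\<^sup>+\<omega>. ennreal \<bar>X (\<omega> i)\<bar> \<partial>S) else 0)
        \<le> ennreal (8 * sqrt s * (if x k < 1 then x k else 0))"
      proof (cases "s * E k < L k")
        case True
        then have x1: "x k < 1" unfolding x_def using L[of k] by simp
        have "(\<Sum>i<N k. \<integral>\<^sup>+\<omega>. ennreal \<bar>X (\<omega> i)\<bar> \<partial>S) \<le> (\<Sum>i<N k. ennreal (2 * s))"
          by (intro sum_mono EX)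
        also have "\<dots> = ennreal (real (N k) * (2 * s))"
          using s by (simp add: ennreal_of_nat_eq_real_of_nat ennreal_mult)
        also have "\<dots> \<le> ennreal (4 * E k * (2 * s))"
        proof (intro ennreal_leI mult_right_mono)
          show "real (N k) \<le> 4 * E k" unfolding N_def using E[of k] by linarith
        qed (use s in auto)
        finally have "ennreal (1 / sqrt (E k * L k)) * (\<Sum>i<N k. \<integral>\<^sup>+\<omega>. ennreal \<bar>X (\<omega> i)\<bar> \<partial>S)
          \<le> ennreal (1 / sqrt (E k * L k)) * ennreal (4 * E k * (2 * s))"
          by (intro mult_left_mono) auto
        also have "\<dots> = ennreal (1 / sqrt (E k * L k) * (4 * E k * (2 * s)))"
          using s E[of k] L[of k] by (intro ennreal_mult[symmetric]) auto
        also have "1 / sqrt (E k * L k) * (4 * E k * (2 * s)) = 8 * sqrt s * x k"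
        proof -
          have "E k * s = sqrt (E k) * sqrt (E k) * (sqrt s * sqrt s)"
            using s E[of k] by simp
          then have "1 / sqrt (E k * L k) * (4 * E k * (2 * s)) = 8 * (sqrt (E k) * sqrt (E k) * (sqrt s * sqrt s)) / (sqrt (E k) * sqrt (L k))"
            by (simp add: real_sqrt_mult mult_ac)
          moreover have "8 * (a * a * (b * b)) / (a * c) = 8 * b * (b * a / c)" if "a > 0" for a b c :: real
            using that by (simp add: field_simps)
          from this[of "sqrt (E k)" "sqrt s" "sqrt (L k)"]
          have "8 * (sqrt (E k) * sqrt (E k) * (sqrt s * sqrt s)) / (sqrt (E k) * sqrt (L k)) = 8 * sqrt s * (sqrt s * sqrt (E k) / sqrt (L k))"
            using E[of k] by simp
          moreover have "x k = sqrt s * sqrt (E k) / sqrt (L k)"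
            unfolding x_def by (simp add: real_sqrt_mult real_sqrt_divide)
          ultimately show ?thesis by simp
        qed
        finally show ?thesis using True x1 by simp
      qed (use x0[of k] s in simp)
    qed auto
    also have "\<dots> \<le> ennreal (32 * sqrt s)"
    proof (rule suminf_le_const)
      fix K
      have "(\<Sum>k<K. 8 * sqrt s * (if x k < 1 then x k else 0)) \<le> 8 * sqrt s * 4"
        unfolding sum_distrib_left[symmetric] using s
        by (intro mult_left_mono sum_geometric_below_one x0 growth) auto
      then show "(\<Sum>k<K. ennreal (8 * sqrt s * (if x k < 1 then x k else 0))) \<le> ennreal (32 * sqrt s)"
        using s x0 by (subst sum_ennreal) (auto intro!: ennreal_leI)
    qed simp
    finally show ?thesis .
  qed

  have "(\<integral>\<^sup>+\<omega>. (SUP n\<in>{21..}. ennreal (\<bar>\<Sum>i<n. X (\<omega> i)\<bar> / lil_scale n)) \<partial>S)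
    \<le> (\<integral>\<^sup>+\<omega>. ennreal (sqrt s) * (R \<omega> + 7) + W \<omega> \<partial>S)"
    by (intro nn_integral_mono SUP_least bound) auto
  also have "\<dots> = ennreal (sqrt s) * ((\<integral>\<^sup>+\<omega>. R \<omega> \<partial>S) + 7) + (\<integral>\<^sup>+\<omega>. W \<omega> \<partial>S)"
    by (simp add: nn_integral_add nn_integral_cmult P.emeasure_space_1)
  \<comment> \<open>The constant 41 arises here: 2 from the mean of \<open>R\<close>, 7 from
    \<open>lil_sup_block\<close>, and 32 from the mean of \<open>W\<close>.\<close>
  also have "\<dots> \<le> ennreal (sqrt s) * (2 + 7) + ennreal (32 * sqrt s)"
    by (intro add_mono mult_left_mono intR intW) auto
  also have "\<dots> = ennreal (sqrt s) * ennreal 9 + ennreal (32 * sqrt s)" by simp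
  also have "\<dots> = ennreal (41 * sqrt s)"
    using s by (simp flip: ennreal_mult ennreal_plus del: ennreal_numeral)
  finally show ?thesis .
qed

end

section \<open>Conditional expectations along a filtration\<close>

locale filtered_prob_space = prob_space M for M :: "'a measure" +
  fixes F :: "nat \<Rightarrow> 'a measure"
  assumes subalgebra_F: "\<And>n. subalgebra M (F n)"
    and sets_F_mono: "\<And>m n. m \<le> n \<Longrightarrow> sets (F m) \<subseteq> sets (F n)"
begin

lemma sigma_finite_subalgebra_F: "sigma_finite_subalgebra M (F n)"
  by (intro finite_measure_subalgebra_is_sigma_finite)
    (simp add: finite_measure_subalgebra_def finite_measure_subalgebra_axioms_def subalgebra_F finite_measure_axioms)

lemma space_F: "space (F n) = space M"
  using subalgebra_F by (simp add: subalgebra_def)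

lemma sets_F_subset: "sets (F n) \<subseteq> sets M"
  using subalgebra_F by (simp add: subalgebra_def)

abbreviation "cond n \<equiv> nn_cond_exp M (F n)"

text \<open>\<open>disjointed A\<close> splits the event by the first index at which
  \<open>a\<close> is exceeded. The n-th piece lies in \<open>F n\<close>, so on it
  \<open>cond n D\<close> integrates like \<open>D\<close>; as the pieces are disjoint, the sum
  stays below the integral of \<open>D\<close>.\<close>

lemma doob_maximal:
  fixes D :: "'a \<Rightarrow> ennreal"
  assumes D [measurable]: "D \<in> borel_measurable M"
  shows "a * emeasure M {x \<in> space M. \<exists>n. a < cond n D x} \<le> (\<integral>\<^sup>+x. D x \<partial>M)"
proof -
  define A where "A n = {x \<in> space M. a < cond n D x}" for n
  have AF: "A n \<in> sets (F n)" for n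
  proof -
    have "{x \<in> space (F n). a < cond n D x} \<in> sets (F n)" by measurable
    then show ?thesis by (simp add: A_def space_F)
  qed
  have AM: "A n \<in> sets M" for n using AF sets_F_subset by blast
  let ?B = "disjointed A"
  have BF: "?B n \<in> sets (F n)" for n
    unfolding disjointed_def
    by (intro sets.Diff sets.finite_UN AF) (auto intro: set_mp[OF sets_F_mono AF])
  have BM [measurable]: "?B n \<in> sets M" for n using BF sets_F_subset by blast
  have step: "a * emeasure M (?B n) \<le> (\<integral>\<^sup>+x. indicator (?B n) x * D x \<partial>M)" for n
  proof -
    interpret sigma_finite_subalgebra M "F n" by (rule sigma_finite_subalgebra_F)
    have "a * emeasure M (?B n) = (\<integral>\<^sup>+x. a * indicator (?B n) x \<partial>M)"
      by (simp add: nn_integral_cmult_indicator BM)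
    also have "\<dots> \<le> (\<integral>\<^sup>+x. indicator (?B n) x * cond n D x \<partial>M)"
      using disjointed_subset[of A n] by (intro nn_integral_mono) (auto simp: A_def indicator_def)
    also have "\<dots> = (\<integral>\<^sup>+x. indicator (?B n) x * D x \<partial>M)"
      using BF by (intro nn_cond_exp_intg) auto
    finally show ?thesis .
  qed
  have "{x \<in> space M. \<exists>n. a < cond n D x} = (\<Union>n. ?B n)"
    by (auto simp: UN_disjointed_eq A_def)
  then have "a * emeasure M {x \<in> space M. \<exists>n. a < cond n D x} = a * (\<Sum>n. emeasure M (?B n))"
    using suminf_emeasure[OF _ disjoint_family_disjointed, of A M] BM by (simp add: image_subset_iff)
  also have "\<dots> = (\<Sum>n. a * emeasure M (?B n))"
    by (simp add: ennreal_suminf_cmult)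
  also have "\<dots> \<le> (\<Sum>n. \<integral>\<^sup>+x. indicator (?B n) x * D x \<partial>M)"
    by (intro suminf_le step) auto
  also have "\<dots> = (\<integral>\<^sup>+x. (\<Sum>n. indicator (?B n) x) * D x \<partial>M)"
    by (subst nn_integral_suminf[symmetric]) (auto simp: ennreal_suminf_multc)
  also have "\<dots> = (\<integral>\<^sup>+x. indicator (\<Union>n. ?B n) x * D x \<partial>M)"
    by (intro nn_integral_cong) (simp add: suminf_indicator disjoint_family_disjointed)
  also have "\<dots> \<le> (\<integral>\<^sup>+x. D x \<partial>M)"
    by (intro nn_integral_mono) (auto simp: indicator_def)
  finally show ?thesis .
qed

end

section \<open>The upper half of Levy's upward theorem\<close>

locale generating_filtration = filtered_prob_space +
  assumes sets_M_eq: "sets M = sigma_sets (space M) (\<Union>n. sets (F n))"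
begin

text \<open>The sets that can be approximated from finite stages form a sigma-algebra. For a
  countable union, finitely many members suffice by continuity of the measure, and their
  approximations are all measurable at one common later stage.\<close>

lemma approximate_set:
  assumes "A \<in> sets M"
  shows "e > 0 \<Longrightarrow> \<exists>n. \<exists>B\<in>sets (F n). measure M (sym_diff A B) \<le> e"
  using assms[unfolded sets_M_eq]
proof (induction arbitrary: e rule: sigma_sets.induct)
  case (Basic A)
  then obtain n where "A \<in> sets (F n)" by blast
  then show ?case using Basic by (intro exI[of _ n] bexI[of _ A]) auto
next
  case Empty
  then show ?case by (intro exI[of _ 0] bexI[of _ "{}"]) auto
next
  case (Compl A)
  then obtain n B where B: "B \<in> sets (F n)" "measure M (sym_diff A B) \<le> e" by blast
  have "A \<subseteq> space M" "B \<subseteq> space M"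
    using Compl.hyps B(1) sets_F_subset[of n] sets.sets_into_space[of _ M] by (auto simp: sets_M_eq[symmetric])
  then have "sym_diff (space M - A) (space M - B) = sym_diff A B" by blast
  moreover have "space M - B \<in> sets (F n)"
    using B(1) space_F[of n] by (metis sets.compl_sets)
  ultimately show ?case using B(2) by (metis)
next
  case (Union A)
  have A [measurable]: "A i \<in> sets M" for i using Union.hyps by (simp add: sets_M_eq)
  have "(\<lambda>k. measure M (\<Union>i<k. A i)) \<longlonglongrightarrow> measure M (\<Union>k. \<Union>i<k. A i)"
    by (intro finite_Lim_measure_incseq) (auto simp: incseq_def intro!: bexI)
  moreover have "(\<Union>k. \<Union>i<k. A i) = (\<Union>i. A i)" by blast
  ultimately have "(\<lambda>k. measure M (\<Union>i<k. A i)) \<longlonglongrightarrow> measure M (\<Union>i. A i)" by simp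
  then have "\<forall>\<^sub>F k in sequentially. measure M (\<Union>i. A i) - e / 2 < measure M (\<Union>i<k. A i)"
    using Union.prems by (intro order_tendstoD(1)) auto
  then obtain k where k: "measure M (\<Union>i. A i) - e / 2 < measure M (\<Union>i<k. A i)"
    by (meson eventually_sequentially order_refl)
  \<comment> \<open>Half of \<open>e\<close> went to the discarded tail of the union; the other half
    is shared by the \<open>k\<close> approximations, and the \<open>+ 1\<close> keeps the quotient
    positive for \<open>k = 0\<close>.\<close>
  have "\<exists>n. \<exists>B\<in>sets (F n). measure M (sym_diff (A i) B) \<le> e / (2 * (real k + 1))" for i
    using Union.prems by (intro Union.IH) auto
  then obtain n B where B: "B i \<in> sets (F (n i))" "measure M (sym_diff (A i) (B i)) \<le> e / (2 * (real k + 1))" for i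
    by metis
  have BM [measurable]: "B i \<in> sets M" for i using B(1) sets_F_subset by blast
  define N where "N = (\<Sum>i<k. n i)"
  have "n i \<le> N" if "i < k" for i unfolding N_def using that by (intro member_le_sum) auto
  then have "B i \<in> sets (F N)" if "i < k" for i
    using B(1)[of i] sets_F_mono[of "n i" N] that by blast
  then have BN: "(\<Union>i<k. B i) \<in> sets (F N)"
    by (intro sets.finite_UN) auto
  have "sym_diff (\<Union>i. A i) (\<Union>i<k. B i) \<subseteq> ((\<Union>i. A i) - (\<Union>i<k. A i)) \<union> (\<Union>i<k. sym_diff (A i) (B i))"
    by blast
  then have "measure M (sym_diff (\<Union>i. A i) (\<Union>i<k. B i)) \<le>
    measure M (((\<Union>i. A i) - (\<Union>i<k. A i)) \<union> (\<Union>i<k. sym_diff (A i) (B i)))"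
    by (intro finite_measure_mono) auto
  also have "\<dots> \<le> measure M ((\<Union>i. A i) - (\<Union>i<k. A i)) + measure M (\<Union>i<k. sym_diff (A i) (B i))"
    by (intro measure_Un_le) auto
  also have "measure M ((\<Union>i. A i) - (\<Union>i<k. A i)) = measure M (\<Union>i. A i) - measure M (\<Union>i<k. A i)"
    by (intro finite_measure_Diff) auto
  also have "measure M (\<Union>i<k. sym_diff (A i) (B i)) \<le> (\<Sum>i<k. measure M (sym_diff (A i) (B i)))"
    by (intro finite_measure_subadditive_finite) auto
  also have "\<dots> \<le> (\<Sum>i<k. e / (2 * (real k + 1)))"
    by (intro sum_mono B)
  also have "\<dots> \<le> e / 2"
    using Union.prems by (simp add: field_simps)
  finally have "measure M (sym_diff (\<Union>i. A i) (\<Union>i<k. B i)) \<le> e"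
    using k by simp
  then show ?case using BN by blast
qed

text \<open>L1-density of the functions measurable at a finite stage. Two inequalities with a common
  error \<open>D\<close> take the place of an absolute difference, which extended nonnegative values
  do not offer.\<close>

lemma approximate_function:
  fixes f :: "'a \<Rightarrow> ennreal"
  assumes "f \<in> borel_measurable M"
  shows "(\<integral>\<^sup>+x. f x \<partial>M) < \<infinity> \<Longrightarrow> e > 0 \<Longrightarrow> \<exists>n. \<exists>W\<in>borel_measurable (F n). \<exists>D\<in>borel_measurable M.
    (\<forall>x\<in>space M. f x \<le> W x + D x \<and> W x \<le> f x + D x) \<and> (\<integral>\<^sup>+x. D x \<partial>M) \<le> ennreal e"
  using assms
proof (induction arbitrary: e rule: borel_measurable_induct)
  case (cong f g)
  have "(\<integral>\<^sup>+x. f x \<partial>M) = (\<integral>\<^sup>+x. g x \<partial>M)"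
    using cong.hyps by (intro nn_integral_cong) auto
  then show ?case using cong by auto
next
  case (set A)
  then obtain n B where B: "B \<in> sets (F n)" "measure M (sym_diff A B) \<le> e"
    using approximate_set by blast
  have "B \<in> sets M" using B(1) sets_F_subset by blast
  then have "(\<integral>\<^sup>+x. indicator (sym_diff A B) x \<partial>M) = emeasure M (sym_diff A B)"
    using set by (intro nn_integral_indicator) auto
  also have "\<dots> \<le> ennreal e"
    using B(2) by (simp add: emeasure_eq_measure ennreal_leI)
  finally have "(\<integral>\<^sup>+x. indicator (sym_diff A B) x \<partial>M) \<le> ennreal e" .
  then show ?case
    using B(1) set \<open>B \<in> sets M\<close>
    by - (rule exI[of _ n], rule bexI[of _ "indicator B"], rule bexI[of _ "indicator (sym_diff A B)"],
      auto simp: indicator_def)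
next
  case (mult u c)
  then obtain b where b: "c = ennreal b" "b \<ge> 0" by (cases c) auto
  show ?case
  proof (cases "b = 0")
    case True
    then show ?thesis
      using b by (intro exI[of _ 0] bexI[of _ "\<lambda>_. 0"]) auto
  next
    case False
    with b have "b > 0" by simp
    have "c * (\<integral>\<^sup>+x. u x \<partial>M) < \<infinity>"
      using mult by (simp add: nn_integral_cmult)
    then have "(\<integral>\<^sup>+x. u x \<partial>M) < \<infinity>"
      using \<open>b > 0\<close> b by (auto simp: ennreal_mult_less_top)
    from mult.IH[OF this, of "e / b"] mult.prems \<open>b > 0\<close> obtain n W D
      where W: "W \<in> borel_measurable (F n)" "D \<in> borel_measurable M"
        "\<forall>x\<in>space M. u x \<le> W x + D x \<and> W x \<le> u x + D x" "(\<integral>\<^sup>+x. D x \<partial>M) \<le> ennreal (e / b)"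
      by auto
    show ?thesis
    proof (rule exI[of _ n], rule bexI[of _ "\<lambda>x. c * W x"], rule bexI[of _ "\<lambda>x. c * D x"], intro conjI ballI)
      fix x assume "x \<in> space M"
      then show "c * u x \<le> c * W x + c * D x" "c * W x \<le> c * u x + c * D x"
        using W(3) by (auto simp flip: distrib_left intro: mult_left_mono)
    next
      have "(\<integral>\<^sup>+x. c * D x \<partial>M) = c * (\<integral>\<^sup>+x. D x \<partial>M)"
        using W(2) by (rule nn_integral_cmult)
      also have "\<dots> \<le> c * ennreal (e / b)"
        using W(4) by (intro mult_left_mono) auto
      also have "\<dots> = ennreal e"
        using \<open>b > 0\<close> mult.prems unfolding b by (simp flip: ennreal_mult')
      finally show "(\<integral>\<^sup>+x. c * D x \<partial>M) \<le> ennreal e" .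
    qed (use W in auto)
  qed
next
  case (add u v)
  have "(\<integral>\<^sup>+x. u x \<partial>M) + (\<integral>\<^sup>+x. v x \<partial>M) < \<infinity>"
    using add by (simp add: nn_integral_add)
  then have fin: "(\<integral>\<^sup>+x. u x \<partial>M) < \<infinity>" "(\<integral>\<^sup>+x. v x \<partial>M) < \<infinity>" by auto
  obtain n1 W1 D1 where 1: "W1 \<in> borel_measurable (F n1)" "D1 \<in> borel_measurable M"
    "\<forall>x\<in>space M. u x \<le> W1 x + D1 x \<and> W1 x \<le> u x + D1 x" "(\<integral>\<^sup>+x. D1 x \<partial>M) \<le> ennreal (e / 2)"
    using add.IH(1)[OF fin(1), of "e / 2"] add.prems by auto
  obtain n2 W2 D2 where 2: "W2 \<in> borel_measurable (F n2)" "D2 \<in> borel_measurable M"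
    "\<forall>x\<in>space M. v x \<le> W2 x + D2 x \<and> W2 x \<le> v x + D2 x" "(\<integral>\<^sup>+x. D2 x \<partial>M) \<le> ennreal (e / 2)"
    using add.IH(2)[OF fin(2), of "e / 2"] add.prems by auto
  have sub: "f \<in> borel_measurable (F (max n1 n2))" if "f \<in> borel_measurable (F i)" "i \<le> max n1 n2"
    for f :: "'a \<Rightarrow> ennreal" and i
    using that sets_F_mono[OF that(2)] by - (rule borel_measurable_subalgebra[of "F i", rotated 2], auto simp: space_F)
  show ?case
  proof (rule exI[of _ "max n1 n2"], rule bexI[of _ "\<lambda>x. W1 x + W2 x"], rule bexI[of _ "\<lambda>x. D1 x + D2 x"], intro conjI ballI)
    fix x assume x: "x \<in> space M"
    have "u x + v x \<le> (W1 x + D1 x) + (W2 x + D2 x)"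
      using 1(3) 2(3) x by (intro add_mono) auto
    then show "v x + u x \<le> W1 x + W2 x + (D1 x + D2 x)" by (simp add: add_ac)
    have "W1 x + W2 x \<le> (u x + D1 x) + (v x + D2 x)"
      using 1(3) 2(3) x by (intro add_mono) auto
    then show "W1 x + W2 x \<le> v x + u x + (D1 x + D2 x)" by (simp add: add_ac)
  next
    have "(\<integral>\<^sup>+x. D1 x + D2 x \<partial>M) \<le> ennreal (e / 2) + ennreal (e / 2)"
      using 1 2 by (subst nn_integral_add) (auto intro: add_mono)
    also have "\<dots> = ennreal e"
      using add.prems by (simp flip: ennreal_plus)
    finally show "(\<integral>\<^sup>+x. D1 x + D2 x \<partial>M) \<le> ennreal e" .
  next
    have [measurable]: "W1 \<in> borel_measurable (F (max n1 n2))" "W2 \<in> borel_measurable (F (max n1 n2))"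
      using sub[OF 1(1)] sub[OF 2(1)] by auto
    show "(\<lambda>x. W1 x + W2 x) \<in> borel_measurable (F (max n1 n2))" by measurable
    show "(\<lambda>x. D1 x + D2 x) \<in> borel_measurable M" using 1(2) 2(2) by measurable
  qed
next
  case (seq U)
  have [measurable]: "U i \<in> borel_measurable M" for i by (rule seq.hyps)
  let ?f = "\<lambda>x. SUP i. U i x"
  have f: "(SUP i. U i) = ?f" by (simp add: fun_eq_iff image_comp)
  have Uf: "U i x \<le> ?f x" for i x by (intro SUP_upper) auto
  have If: "(\<integral>\<^sup>+x. ?f x \<partial>M) < \<infinity>" using seq.prems(1) unfolding f .
  have IU: "(\<integral>\<^sup>+x. U i x \<partial>M) < \<infinity>" for i
    using nn_integral_mono[of M "U i" ?f] Uf If by (meson le_less_trans)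
  have "(\<integral>\<^sup>+x. ?f x \<partial>M) = (SUP i. \<integral>\<^sup>+x. U i x \<partial>M)"
    using \<open>incseq U\<close> by (intro nn_integral_monotone_convergence_SUP) auto
  \<comment> \<open>If every integral stayed \<open>e / 2\<close> below that of the limit, adding
    this gap under the supremum of monotone convergence would contradict finiteness.\<close>
  have "\<exists>i. (\<integral>\<^sup>+x. ?f x \<partial>M) \<le> (\<integral>\<^sup>+x. U i x \<partial>M) + ennreal (e / 2)"
  proof (rule ccontr)
    assume "\<nexists>i. (\<integral>\<^sup>+x. ?f x \<partial>M) \<le> (\<integral>\<^sup>+x. U i x \<partial>M) + ennreal (e / 2)"
    then have *: "(\<integral>\<^sup>+x. U i x \<partial>M) + ennreal (e / 2) \<le> (\<integral>\<^sup>+x. ?f x \<partial>M)" for i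
      by (meson linear)
    have "(\<integral>\<^sup>+x. ?f x \<partial>M) + ennreal (e / 2) = (SUP i. (\<integral>\<^sup>+x. U i x \<partial>M) + ennreal (e / 2))"
      unfolding \<open>(\<integral>\<^sup>+x. ?f x \<partial>M) = _\<close> by (simp add: ennreal_SUP_add_left)
    also have "\<dots> \<le> (\<integral>\<^sup>+x. ?f x \<partial>M)"
      by (intro SUP_least *)
    finally show False
      using If seq.prems(2) by (cases "\<integral>\<^sup>+x. ?f x \<partial>M") (auto simp flip: ennreal_plus)
  qed
  then obtain i where i: "(\<integral>\<^sup>+x. ?f x \<partial>M) \<le> (\<integral>\<^sup>+x. U i x \<partial>M) + ennreal (e / 2)" by blast
  obtain n W D where W: "W \<in> borel_measurable (F n)" and [measurable]: "D \<in> borel_measurable M" and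
    WD: "\<forall>x\<in>space M. U i x \<le> W x + D x \<and> W x \<le> U i x + D x" "(\<integral>\<^sup>+x. D x \<partial>M) \<le> ennreal (e / 2)"
    using seq.IH[OF IU, of "e / 2" i] seq.prems by auto
  show ?case
    unfolding f
  proof (rule exI[of _ n], rule bexI[of _ W], rule bexI[of _ "\<lambda>x. D x + (?f x - U i x)"], intro conjI ballI)
    fix x assume x: "x \<in> space M"
    have "?f x = U i x + (?f x - U i x)"
      using Uf[of i x] by (rule ennreal_ineq_diff_add)
    also have "\<dots> \<le> (W x + D x) + (?f x - U i x)"
      using WD x by (intro add_right_mono) auto
    finally show "?f x \<le> W x + (D x + (?f x - U i x))" by (simp add: add_ac)
    have "W x \<le> U i x + D x" using WD x by auto
    also have "\<dots> \<le> ?f x + (D x + (?f x - U i x))"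
      by (intro add_mono Uf) auto
    finally show "W x \<le> ?f x + (D x + (?f x - U i x))" .
  next
    have "(\<integral>\<^sup>+x. ?f x - U i x \<partial>M) = (\<integral>\<^sup>+x. ?f x \<partial>M) - (\<integral>\<^sup>+x. U i x \<partial>M)"
      using IU[of i] Uf by (intro nn_integral_diff) auto
    also have "\<dots> \<le> ennreal (e / 2)"
      using i IU[of i] by (auto simp: ennreal_minus_le_iff)
    finally have "(\<integral>\<^sup>+x. D x \<partial>M) + (\<integral>\<^sup>+x. ?f x - U i x \<partial>M) \<le> ennreal (e / 2) + ennreal (e / 2)"
      using WD(2) by (intro add_mono)
    also have "\<dots> = ennreal e"
      using seq.prems by (simp flip: ennreal_plus)
    finally show "(\<integral>\<^sup>+x. D x + (?f x - U i x) \<partial>M) \<le> ennreal e"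
      by (simp add: nn_integral_add)
  qed (use W in auto)
qed

text \<open>From stage \<open>n0\<close> on, \<open>cond n f\<close> is at most
  \<open>f + D + cond n D\<close> with \<open>D\<close> small in mean. By Markov and
  \<open>doob_maximal\<close>, \<open>D\<close> reaches \<open>a\<close> or some
  \<open>cond n D\<close> exceeds \<open>a\<close> with probability at most \<open>e / a\<close> in
  total. For fixed \<open>a\<close> the number \<open>e\<close> is free, so the set where the upper
  limit exceeds \<open>f + 2 * a\<close> is null.\<close>

lemma limsup_nn_cond_exp_le:
  fixes f :: "'a \<Rightarrow> ennreal"
  assumes f [measurable]: "f \<in> borel_measurable M" and fin: "(\<integral>\<^sup>+x. f x \<partial>M) < \<infinity>"
  shows "AE x in M. limsup (\<lambda>n. cond n f x) \<le> f x"
proof -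
  let ?L = "\<lambda>x. limsup (\<lambda>n. cond n f x)"
  have ae: "AE x in M. ?L x \<le> f x + ennreal (2 * a)" if a: "a > 0" for a :: real
  proof -
    let ?Bad = "{x \<in> space M. \<not> ?L x \<le> f x + ennreal (2 * a)}"
    have [measurable]: "?Bad \<in> sets M" by measurable
    have small: "ennreal a * emeasure M ?Bad \<le> ennreal e" if e: "e > 0" for e
    proof -
      obtain n0 W D where W: "W \<in> borel_measurable (F n0)" and D [measurable]: "D \<in> borel_measurable M" and
        WD: "\<forall>x\<in>space M. f x \<le> W x + D x \<and> W x \<le> f x + D x" "(\<integral>\<^sup>+x. D x \<partial>M) \<le> ennreal (e / 2)"
        using approximate_function[OF f fin, of "e / 2"] e by auto
      let ?D1 = "{x \<in> space M. ennreal a \<le> D x}"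
      let ?D2 = "{x \<in> space M. \<exists>n. ennreal a < cond n D x}"
      have "AE x in M. cond n f x \<le> f x + D x + cond n D x" if n: "n \<ge> n0" for n
      proof -
        interpret sigma_finite_subalgebra M "F n" by (rule sigma_finite_subalgebra_F)
        have Wn: "W \<in> borel_measurable (F n)"
          using W sets_F_mono[OF n] by - (rule borel_measurable_subalgebra[of "F n0", rotated 2], auto simp: space_F)
        then have WM [measurable]: "W \<in> borel_measurable M"
          by (rule measurable_from_subalg[OF subalgebra_F])
        have "AE x in M. cond n f x \<le> cond n (\<lambda>x. W x + D x) x"
          using WD by (intro nn_cond_exp_mono) auto
        moreover have "AE x in M. cond n W x + cond n D x = cond n (\<lambda>x. W x + D x) x"
          by (intro nn_cond_exp_sum) auto
        moreover have "AE x in M. W x = cond n W x"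
          by (rule nn_cond_exp_F_meas[OF Wn])
        ultimately show ?thesis
          using AE_space
        proof eventually_elim
          case (elim x)
          then have "cond n f x \<le> W x + cond n D x" by simp
          also have "\<dots> \<le> f x + D x + cond n D x"
            using WD elim by (intro add_right_mono) auto
          finally show ?case .
        qed
      qed
      then have "AE x in M. \<forall>n\<ge>n0. cond n f x \<le> f x + D x + cond n D x"
        by (simp add: AE_all_countable)
      then have "AE x in M. x \<in> ?Bad \<longrightarrow> x \<in> ?D1 \<union> ?D2"
      proof eventually_elim
        case (elim x)
        show ?case
        proof (rule impI, rule ccontr)
          assume bad: "x \<in> ?Bad" and "x \<notin> ?D1 \<union> ?D2"
          then have "D x \<le> ennreal a" "\<And>n. cond n D x \<le> ennreal a"
            by (auto simp: not_le not_less)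
          then have "f x + D x + cond n D x \<le> f x + ennreal a + ennreal a" for n
            by (intro add_mono) auto
          then have "cond n f x \<le> f x + ennreal (2 * a)" if "n \<ge> n0" for n
            using elim that a by (auto simp: add.assoc simp flip: ennreal_plus intro: order_trans)
          then have "?L x \<le> f x + ennreal (2 * a)"
            by (intro Limsup_bounded) (auto simp: eventually_sequentially)
          with bad show False by simp
        qed
      qed
      then have "emeasure M ?Bad \<le> emeasure M (?D1 \<union> ?D2)"
        by (intro emeasure_mono_AE) auto
      also have "\<dots> \<le> emeasure M ?D1 + emeasure M ?D2"
        by (intro emeasure_subadditive) auto
      finally have "ennreal a * emeasure M ?Bad \<le> ennreal a * emeasure M ?D1 + ennreal a * emeasure M ?D2"
        unfolding distrib_left[symmetric] by (intro mult_left_mono) auto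
      also have "\<dots> \<le> (\<integral>\<^sup>+x. D x \<partial>M) + (\<integral>\<^sup>+x. D x \<partial>M)"
      proof (intro add_mono doob_maximal D)
        have "ennreal a * emeasure M ?D1 = (\<integral>\<^sup>+x. ennreal a * indicator ?D1 x \<partial>M)"
          by (simp add: nn_integral_cmult_indicator)
        also have "\<dots> \<le> (\<integral>\<^sup>+x. D x \<partial>M)"
          by (intro nn_integral_mono) (auto simp: indicator_def)
        finally show "ennreal a * emeasure M ?D1 \<le> (\<integral>\<^sup>+x. D x \<partial>M)" .
      qed
      also have "\<dots> \<le> ennreal (e / 2) + ennreal (e / 2)"
        by (intro add_mono WD)
      also have "\<dots> = ennreal e"
        using e by (simp flip: ennreal_plus)
      finally show ?thesis .
    qed
    have "ennreal a * emeasure M ?Bad \<le> 0"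
      by (rule ennreal_le_epsilon) (use small in simp)
    then have "emeasure M ?Bad = 0" using a by simp
    then show ?thesis by (intro AE_iff_measurable[THEN iffD2, of ?Bad]) auto
  qed
  have "AE x in M. \<forall>k::nat. ?L x \<le> f x + ennreal (2 * inverse (real (Suc k)))"
    unfolding AE_all_countable by (intro allI ae) auto
  then show ?thesis
  proof eventually_elim
    case (elim x)
    show ?case
    proof (rule ennreal_le_epsilon)
      fix e :: real assume "0 < e"
      then obtain k where "inverse (real (Suc k)) < e / 2"
        using reals_Archimedean[of "e / 2"] by auto
      then have "ennreal (2 * inverse (real (Suc k))) \<le> ennreal e"
        by (intro ennreal_leI) simp
      then show "?L x \<le> f x + ennreal e"
        using elim[rule_format, of k] by (meson add_left_mono order_trans)
    qed
  qed
qed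

end

section \<open>Disintegration through a regular conditional distribution\<close>

lemma space_kernel: "K \<in> L \<rightarrow>\<^sub>M prob_algebra N \<Longrightarrow> x \<in> space L \<Longrightarrow> space (K x) = space N"
  by (metis (mono_tags, lifting) measurable_space mem_Collect_eq sets_eq_imp_space_eq space_prob_algebra)

lemma sets_kernel_prob: "K \<in> L \<rightarrow>\<^sub>M prob_algebra N \<Longrightarrow> x \<in> space L \<Longrightarrow> sets (K x) = sets N"
  by (metis (mono_tags, lifting) measurable_space mem_Collect_eq space_prob_algebra)

lemma prob_space_kernel: "K \<in> L \<rightarrow>\<^sub>M prob_algebra N \<Longrightarrow> x \<in> space L \<Longrightarrow> prob_space (K x)"
  by (metis (mono_tags, lifting) measurable_space mem_Collect_eq space_prob_algebra)

lemma measurable_nn_integral_kernel: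
  assumes "K \<in> L \<rightarrow>\<^sub>M prob_algebra N" "g \<in> borel_measurable (L \<Otimes>\<^sub>M N)"
  shows "(\<lambda>x. \<integral>\<^sup>+ y. g (x, y) \<partial>K x) \<in> borel_measurable L"
  using assms by (intro nn_integral_measurable_subprob_algebra2 measurable_prob_algebraD) simp_all

locale regular_conditional_distribution = prob_space M
  for M :: "'w measure" and L :: "'a measure" and X :: "'w \<Rightarrow> 'a" and N :: "'b measure"
    and Y :: "'w \<Rightarrow> 'b" and K :: "'a \<Rightarrow> 'b measure" +
  assumes X [measurable]: "X \<in> M \<rightarrow>\<^sub>M L" and Y [measurable]: "Y \<in> M \<rightarrow>\<^sub>M N"
    and regular_cond_distr: "regular_cond_distr M L X N Y K"
begin

lemma K [measurable]: "K \<in> L \<rightarrow>\<^sub>M prob_algebra N"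
  using regular_cond_distr by (simp add: regular_cond_distr_def)

abbreviation "F \<equiv> vimage_algebra (space M) X L"

lemma X_space: "X \<in> space M \<rightarrow> space L"
  using measurable_space[OF X] by auto

lemma sets_F: "sets F = {X -` A \<inter> space M | A. A \<in> sets L}"
  by (rule sets_vimage_algebra2[OF X_space])

lemma subalgebra_F: "subalgebra M F"
  using X by (auto simp: subalgebra_def sets_F intro: measurable_sets)

sublocale F: sigma_finite_subalgebra M F
  by (intro finite_measure_subalgebra_is_sigma_finite)
    (simp add: finite_measure_subalgebra_def finite_measure_subalgebra_axioms_def subalgebra_F finite_measure_axioms)

text \<open>The defining property treats one event of \<open>Y\<close> at a time, through real
  conditional expectations; integrated over an event of \<open>X\<close>, it becomes the joint law
  on a rectangle.\<close>

lemma rectangle: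
  assumes A [measurable]: "A \<in> sets L" and B [measurable]: "B \<in> sets N"
  shows "(\<integral>\<^sup>+ w. indicator A (X w) * emeasure (K (X w)) B \<partial>M) = emeasure M ((\<lambda>w. (X w, Y w)) -` (A \<times> B) \<inter> space M)"
proof -
  let ?A = "X -` A \<inter> space M"
  have AF: "?A \<in> sets F" using A by (auto simp: sets_F)
  have [measurable]: "?A \<in> sets M" by measurable
  have m [measurable]: "(\<lambda>w. measure (K (X w)) B) \<in> borel_measurable M"
    using measurable_compose[OF measurable_compose[OF X K] measurable_measure_prob_algebra[OF B]] by simp
  have le1: "measure (K (X w)) B \<le> 1" if "w \<in> space M" for w
    using prob_space_kernel[OF K, of "X w"] X_space that by (auto intro: prob_space.prob_le_1)
  have intB: "integrable M (\<lambda>w. indicator B (Y w) :: real)"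
    by (intro integrable_const_bound[of _ 1]) auto
  have "(\<integral>\<^sup>+ w. indicator A (X w) * emeasure (K (X w)) B \<partial>M) = (\<integral>\<^sup>+ w. ennreal (indicator ?A w * measure (K (X w)) B) \<partial>M)"
  proof (intro nn_integral_cong)
    fix w assume w: "w \<in> space M"
    then interpret k: prob_space "K (X w)" using X_space by (auto intro: prob_space_kernel[OF K])
    show "indicator A (X w) * emeasure (K (X w)) B = ennreal (indicator ?A w * measure (K (X w)) B)"
      using w by (simp add: k.emeasure_eq_measure indicator_def)
  qed
  also have "\<dots> = ennreal (\<integral>w. indicator ?A w * measure (K (X w)) B \<partial>M)"
    using le1 by (intro nn_integral_eq_integral integrable_const_bound[of _ 1])
      (auto simp: indicator_def)
  also have "(\<integral>w. indicator ?A w * measure (K (X w)) B \<partial>M) =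
    (\<integral>w. indicator ?A w * real_cond_exp M F (\<lambda>v. indicator B (Y v)) w \<partial>M)"
    using regular_cond_distr B unfolding regular_cond_distr_def
    by (intro integral_cong_AE) (auto elim!: ballE[of _ _ B])
  also have "\<dots> = (\<integral>w. indicator ?A w * indicator B (Y w) \<partial>M)"
    using F.real_cond_exp_intA[OF intB AF] by (simp add: set_lebesgue_integral_def)
  also have "\<dots> = (\<integral>w. indicator ((\<lambda>w. (X w, Y w)) -` (A \<times> B) \<inter> space M) w \<partial>M)"
    by (intro Bochner_Integration.integral_cong) (auto simp: indicator_def)
  also have "\<dots> = measure M ((\<lambda>w. (X w, Y w)) -` (A \<times> B) \<inter> space M)"
    by simp
  finally show ?thesis by (simp add: emeasure_eq_measure)
qed

abbreviation "joint_kernel x \<equiv> distr (K x) (L \<Otimes>\<^sub>M N) (Pair x)"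

lemma measurable_joint_kernel: "(\<lambda>x. joint_kernel x) \<in> L \<rightarrow>\<^sub>M prob_algebra (L \<Otimes>\<^sub>M N)"
  by (intro measurable_distr_prob_space2[where M=N] K) simp

lemma joint_law: "distr M (L \<Otimes>\<^sub>M N) (\<lambda>w. (X w, Y w)) = distr M L X \<bind> joint_kernel"
proof -
  let ?J = "distr M (L \<Otimes>\<^sub>M N) (\<lambda>w. (X w, Y w))"
  let ?B = "distr M L X \<bind> joint_kernel"
  let ?E = "{a \<times> b | a b. a \<in> sets L \<and> b \<in> sets N}"
  have law: "distr M L X \<in> space (prob_algebra L)"
    by (simp add: space_prob_algebra prob_space_distr)
  have eq: "emeasure (?J) C = emeasure (?B) C"
    if "C \<in> ?E" for C
  proof -
    obtain A B where C: "C = A \<times> B" and AB [measurable]: "A \<in> sets L" "B \<in> sets N" using \<open>C \<in> ?E\<close> by blast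
    have "emeasure (?B) C = (\<integral>\<^sup>+ x. emeasure (joint_kernel x) C \<partial>distr M L X)"
      unfolding C by (rule emeasure_bind_prob_algebra[OF law measurable_joint_kernel]) measurable
    also have "\<dots> = (\<integral>\<^sup>+ w. emeasure (joint_kernel (X w)) C \<partial>M)"
    proof (intro nn_integral_distr X)
      have "C \<in> sets (L \<Otimes>\<^sub>M N)" unfolding C by measurable
      then show "(\<lambda>x. emeasure (joint_kernel x) C) \<in> borel_measurable (distr M L X)"
        using measurable_compose[OF measurable_prob_algebraD[OF measurable_joint_kernel] measurable_emeasure_subprob_algebra]
        by simp
    qed
    also have "\<dots> = (\<integral>\<^sup>+ w. indicator A (X w) * emeasure (K (X w)) B \<partial>M)"
    proof (intro nn_integral_cong)
      fix w assume "w \<in> space M"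
      then have x: "X w \<in> space L" using X_space by auto
      have "emeasure (joint_kernel (X w)) C = emeasure (K (X w)) (Pair (X w) -` (A \<times> B) \<inter> space (K (X w)))"
        unfolding C using x sets_kernel_prob[OF K x]
        by (intro emeasure_distr) (auto cong: measurable_cong_sets)
      also have "Pair (X w) -` (A \<times> B) \<inter> space (K (X w)) = (if X w \<in> A then B else {})"
        using sets.sets_into_space[OF AB(2)] by (auto simp: space_kernel[OF K x])
      finally show "emeasure (joint_kernel (X w)) C = indicator A (X w) * emeasure (K (X w)) B"
        by simp
    qed
    also have "\<dots> = emeasure (?J) C"
      unfolding rectangle[OF AB] C by (simp add: emeasure_distr)
    finally show ?thesis ..
  qed
  have "sets (?J) = sigma_sets (space L \<times> space N) ?E"
    by (simp add: sets_pair_measure)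
  moreover have "sets (?B) = sigma_sets (space L \<times> space N) ?E"
    using sets_bind'[OF law measurable_joint_kernel] by (simp add: sets_pair_measure)
  moreover have "emeasure (?J) (space L \<times> space N) \<noteq> \<infinity>"
    by (simp add: emeasure_distr)
  ultimately show ?thesis
    by (intro measure_eqI_generator_eq[OF Int_stable_pair_measure_generator pair_measure_closed eq,
          where A="\<lambda>_ :: nat. space L \<times> space N"]) auto
qed

lemma nn_integral_joint:
  assumes h [measurable]: "h \<in> borel_measurable (L \<Otimes>\<^sub>M N)"
  shows "(\<integral>\<^sup>+ w. h (X w, Y w) \<partial>M) = (\<integral>\<^sup>+ w. (\<integral>\<^sup>+ y. h (X w, y) \<partial>K (X w)) \<partial>M)"
proof -
  have "(\<integral>\<^sup>+ w. h (X w, Y w) \<partial>M) = (\<integral>\<^sup>+ z. h z \<partial>distr M (L \<Otimes>\<^sub>M N) (\<lambda>w. (X w, Y w)))"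
    by (subst nn_integral_distr) auto
  also have "\<dots> = (\<integral>\<^sup>+ x. (\<integral>\<^sup>+ z. h z \<partial>joint_kernel x) \<partial>distr M L X)"
    unfolding joint_law using measurable_prob_algebraD[OF measurable_joint_kernel]
    by (intro nn_integral_bind[where B="L \<Otimes>\<^sub>M N"]) (auto cong: measurable_cong_sets)
  also have "\<dots> = (\<integral>\<^sup>+ x. (\<integral>\<^sup>+ y. h (x, y) \<partial>K x) \<partial>distr M L X)"
  proof (intro nn_integral_cong)
    fix x assume "x \<in> space (distr M L X)"
    then have x: "x \<in> space L" by simp
    show "(\<integral>\<^sup>+ z. h z \<partial>joint_kernel x) = (\<integral>\<^sup>+ y. h (x, y) \<partial>K x)"
      using x sets_kernel_prob[OF K x] by (intro nn_integral_distr) (auto cong: measurable_cong_sets)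
  qed
  also have "\<dots> = (\<integral>\<^sup>+ w. (\<integral>\<^sup>+ y. h (X w, y) \<partial>K (X w)) \<partial>M)"
    using measurable_nn_integral_kernel[OF K h] by (intro nn_integral_distr X) simp
  finally show ?thesis .
qed

text \<open>Given \<open>X\<close>, its value may be frozen inside \<open>g\<close>. This admits the
  empirical measure, a function of the conditioning coordinates, under the posterior
  integral.\<close>

lemma nn_cond_exp_eq:
  assumes g [measurable]: "g \<in> borel_measurable (L \<Otimes>\<^sub>M N)"
  shows "AE w in M. (\<integral>\<^sup>+ y. g (X w, y) \<partial>K (X w)) = nn_cond_exp M F (\<lambda>v. g (X v, Y v)) w"
proof (rule F.nn_cond_exp_charact)
  have "X \<in> F \<rightarrow>\<^sub>M L" by (rule measurable_vimage_algebra1[OF X_space])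
  from measurable_compose[OF this measurable_nn_integral_kernel[OF K g]]
  show "(\<lambda>w. \<integral>\<^sup>+ y. g (X w, y) \<partial>K (X w)) \<in> borel_measurable F" .
next
  fix A assume "A \<in> sets F"
  then obtain B where A: "A = X -` B \<inter> space M" and [measurable]: "B \<in> sets L" by (auto simp: sets_F)
  have "(\<integral>\<^sup>+ w\<in>A. g (X w, Y w) \<partial>M) = (\<integral>\<^sup>+ w. indicator B (fst (X w, Y w)) * g (X w, Y w) \<partial>M)"
    by (intro nn_integral_cong) (simp add: A indicator_def)
  also have "\<dots> = (\<integral>\<^sup>+ w. (\<integral>\<^sup>+ y. indicator B (fst (X w, y)) * g (X w, y) \<partial>K (X w)) \<partial>M)"
    by (rule nn_integral_joint[of "\<lambda>z. indicator B (fst z) * g z"]) measurable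
  also have "\<dots> = (\<integral>\<^sup>+ w\<in>A. (\<integral>\<^sup>+ y. g (X w, y) \<partial>K (X w)) \<partial>M)"
    by (intro nn_integral_cong) (simp add: A indicator_def)
  finally show "(\<integral>\<^sup>+ w\<in>A. g (X w, Y w) \<partial>M) = (\<integral>\<^sup>+ w\<in>A. (\<integral>\<^sup>+ y. g (X w, y) \<partial>K (X w)) \<partial>M)" .
qed measurable

end

section \<open>Empirical distribution functions\<close>

abbreviation iid :: "real measure \<Rightarrow> (nat \<Rightarrow> real) measure" where
  "iid p \<equiv> Pi\<^sub>M UNIV (\<lambda>_. p)"

definition ecdf :: "nat \<Rightarrow> (nat \<Rightarrow> real) \<Rightarrow> real \<Rightarrow> real" where
  "ecdf n \<omega> x = (\<Sum>i<n. if \<omega> i \<le> x then 1 else 0) / real n"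

lemma cdf_empirical:
  assumes "n \<ge> 1"
  shows "cdf (empirical n \<omega>) x = ecdf n \<omega> x"
proof -
  have "cdf (empirical n \<omega>) x = measure (uniform_count_measure {..<n}) (\<omega> -` {..x} \<inter> {..<n})"
    unfolding empirical_def cdf_def
    by (subst measure_distr) (auto simp: measurable_def sets_uniform_count_measure space_uniform_count_measure)
  also have "\<dots> = card (\<omega> -` {..x} \<inter> {..<n}) / n"
    by (subst measure_uniform_count_measure) auto
  also have "real (card (\<omega> -` {..x} \<inter> {..<n})) = (\<Sum>i<n. if \<omega> i \<le> x then 1 else 0)"
    by (simp add: sum.If_cases Int_def vimage_def conj_commute)
  finally show ?thesis by (simp add: ecdf_def)
qed

lemma measurable_ecdf:
  assumes "\<And>i. i < n \<Longrightarrow> (\<lambda>w. f w i) \<in> borel_measurable M" and [measurable]: "g \<in> borel_measurable M"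
  shows "(\<lambda>w. ecdf n (f w) (g w)) \<in> borel_measurable M"
  unfolding ecdf_def
proof (intro borel_measurable_divide borel_measurable_sum borel_measurable_const)
  fix i assume "i \<in> {..<n}"
  then have [measurable]: "(\<lambda>w. f w i) \<in> borel_measurable M" using assms by simp
  show "(\<lambda>w. if f w i \<le> g w then 1 else 0 :: real) \<in> borel_measurable M" by measurable
qed

section \<open>Normalized deviations of the empirical distribution function\<close>

definition rate :: "nat \<Rightarrow> real" where
  "rate n = sqrt (real n / ln (ln (real n)))"

definition dev :: "nat \<Rightarrow> (nat \<Rightarrow> real) \<Rightarrow> real measure \<Rightarrow> real \<Rightarrow> ennreal" where
  "dev n \<omega> p x = ennreal (rate n) * ennreal \<bar>ecdf n \<omega> x - cdf p x\<bar>"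

lemma measurable_dev:
  assumes "\<And>i. i < n \<Longrightarrow> (\<lambda>w. f w i) \<in> borel_measurable M" and "P \<in> M \<rightarrow>\<^sub>M borel_prob" and "g \<in> borel_measurable M"
  shows "(\<lambda>w. dev n (f w) (P w) (g w)) \<in> borel_measurable M"
proof -
  have [measurable]: "(\<lambda>w. ecdf n (f w) (g w)) \<in> borel_measurable M" "(\<lambda>w. cdf (P w) (g w)) \<in> borel_measurable M"
    using assms by (auto intro!: measurable_ecdf measurable_cdf)
  show ?thesis unfolding dev_def by measurable
qed

lemma ln_ln_pos: "n \<ge> 21 \<Longrightarrow> ln (ln (real n)) > 0"
proof -
  assume n: "n \<ge> 21"
  then have "exp 1 < real n" using exp_le by linarith
  then have "ln (exp 1) < ln (real n)" using n by (subst ln_less_cancel_iff) auto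
  then show ?thesis by simp
qed

lemma ecdf_minus:
  "n \<ge> 1 \<Longrightarrow> ecdf n \<omega> x - c = (\<Sum>i<n. indicator {..x} (\<omega> i) - c) / real n"
  by (simp add: ecdf_def sum_subtractf indicator_def of_bool_def diff_divide_distrib)

lemma dev_eq:
  assumes n: "n \<ge> 21"
  shows "dev n \<omega> p x = ennreal (\<bar>\<Sum>i<n. indicator {..x} (\<omega> i) - cdf p x\<bar> / lil_scale n)"
proof -
  have "rate n * \<bar>ecdf n \<omega> x - cdf p x\<bar> = (sqrt (real n) / sqrt (ln (ln (real n)))) * (\<bar>\<Sum>i<n. indicator {..x} (\<omega> i) - cdf p x\<bar> / (sqrt (real n) * sqrt (real n)))"
    using n by (simp add: ecdf_minus rate_def real_sqrt_divide)
  also have "\<dots> = \<bar>\<Sum>i<n. indicator {..x} (\<omega> i) - cdf p x\<bar> / lil_scale n"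
  proof -
    have eq: "a / b * (c / (a * a)) = c / (a * b)" if "a > 0" for a b c :: real
      using that by (simp add: field_simps)
    show ?thesis unfolding real_sqrt_mult using n by (intro eq) simp
  qed
  finally show ?thesis
    unfolding dev_def using ln_ln_pos[OF n] by (subst ennreal_mult[symmetric]) (auto simp: rate_def)
qed

lemma indicator_sequence:
  assumes p: "p \<in> space borel_prob" and s: "cdf p x * (1 - cdf p x) \<le> s"
  shows "centered_bounded_abs_sequence p (\<lambda>y. indicator {..x} y - cdf p x) s"
proof -
  interpret real_distribution p by (rule borel_prob_real_distribution[OF p])
  let ?F = "cdf p x"
  note total = prob_space
  have F: "0 \<le> ?F" "?F \<le> 1" using cdf_in_unit[OF p] by auto
  have int [simp]: "integrable p (indicator {..x} :: real \<Rightarrow> real)"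
    by (auto intro!: integrable_const_bound[of _ 1])
  have E: "expectation (indicator {..x}) = ?F" by (simp add: cdf_def)
  interpret sequence_space p by unfold_locales
  show ?thesis
  proof
    show "(\<lambda>y. indicator {..x} y - ?F) \<in> borel_measurable p" by measurable
    show "\<bar>indicator {..x} y - ?F\<bar> \<le> 1" for y
      using F by (auto simp: indicator_def)
    show "(\<integral>y. indicator {..x} y - ?F \<partial>p) = 0"
      using int E total by simp
    have "(\<integral>y. (indicator {..x} y - ?F)\<^sup>2 \<partial>p) = (\<integral>y. (1 - 2 * ?F) * indicator {..x} y + ?F\<^sup>2 \<partial>p)"
      by (intro Bochner_Integration.integral_cong) (auto simp: indicator_def power2_eq_square algebra_simps)
    also have "\<dots> = (1 - 2 * ?F) * ?F + ?F\<^sup>2"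
      using int E total by simp
    also have "\<dots> = ?F * (1 - ?F)" by (simp add: power2_eq_square algebra_simps)
    finally show "(\<integral>y. (indicator {..x} y - ?F)\<^sup>2 \<partial>p) \<le> s" using s by simp
    \<comment> \<open>On the two values of the indicator the absolute deviation is affine in it, so
      its mean is exactly twice the variance.\<close>
    have "(\<integral>\<^sup>+y. ennreal \<bar>indicator {..x} y - ?F\<bar> \<partial>p) = (\<integral>\<^sup>+y. ennreal ((1 - 2 * ?F) * indicator {..x} y + ?F) \<partial>p)"
      using F by (intro nn_integral_cong) (auto simp: indicator_def)
    also have "\<dots> = ennreal (\<integral>y. (1 - 2 * ?F) * indicator {..x} y + ?F \<partial>p)"
    proof (rule nn_integral_eq_integral)
      show "integrable p (\<lambda>y. (1 - 2 * ?F) * indicator {..x} y + ?F)" using int by simp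
      show "AE y in p. 0 \<le> (1 - 2 * ?F) * indicator {..x} y + ?F" using F by (auto simp: indicator_def)
    qed
    also have "(\<integral>y. (1 - 2 * ?F) * indicator {..x} y + ?F \<partial>p) = 2 * (?F * (1 - ?F))"
      using int E total by (simp add: algebra_simps)
    also have "ennreal (2 * (?F * (1 - ?F))) \<le> ennreal (2 * s)"
      using s by (intro ennreal_leI) simp
    finally show "(\<integral>\<^sup>+y. ennreal \<bar>indicator {..x} y - ?F\<bar> \<partial>p) \<le> ennreal (2 * s)" .
  qed
qed

lemma cdf_var_nonneg: "p \<in> space borel_prob \<Longrightarrow> 0 \<le> cdf p x * (1 - cdf p x)"
  using cdf_in_unit[of p x] by simp

lemma AE_limsup_dev_le:
  assumes p: "p \<in> space borel_prob"
  shows "AE \<omega> in iid p. limsup (\<lambda>n. dev n \<omega> p x) \<le> ennreal (sqrt (2 * cdf p x * (1 - cdf p x)))"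
proof -
  let ?v = "cdf p x * (1 - cdf p x)"
  \<comment> \<open>The variance may vanish, while \<open>iterated_log\<close> asks for a positive
    \<open>s\<close> and for \<open>c\<close> strictly above \<open>sqrt (2 * s)\<close>; both are
    approached from above.\<close>
  define s where "s j = ?v + inverse (real (Suc j))" for j
  define c where "c j = sqrt (2 * s j) + inverse (real (Suc j))" for j
  let ?S = "\<lambda>n \<omega>. \<Sum>i<n. indicator {..x} (\<omega> i) - cdf p x"
  have "AE \<omega> in iid p. \<forall>\<^sub>F n in sequentially. \<bar>?S n \<omega>\<bar> \<le> c j * lil_scale n" for j
  proof -
    interpret centered_bounded_abs_sequence p "\<lambda>y. indicator {..x} y - cdf p x" "s j"
      by (rule indicator_sequence[OF p]) (simp add: s_def)
    show ?thesis
      using cdf_var_nonneg[OF p, of x] by (intro iterated_log) (auto simp: s_def c_def add_nonneg_pos)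
  qed
  then have "AE \<omega> in iid p. \<forall>j. \<forall>\<^sub>F n in sequentially. \<bar>?S n \<omega>\<bar> \<le> c j * lil_scale n"
    by (simp add: AE_all_countable)
  then show ?thesis
  proof eventually_elim
    case (elim \<omega>)
    have "limsup (\<lambda>n. dev n \<omega> p x) \<le> ennreal (c j)" for j
    proof (rule Limsup_bounded)
      show "\<forall>\<^sub>F n in sequentially. dev n \<omega> p x \<le> ennreal (c j)"
        using elim[rule_format, of j] eventually_ge_at_top[of 21]
      proof eventually_elim
        case (elim n)
        then have "\<bar>?S n \<omega>\<bar> / lil_scale n \<le> c j"
          using ln_ln_pos[of n] by (subst pos_divide_le_eq) auto
        then show ?case using elim by (simp add: dev_eq ennreal_leI)
      qed
    qed
    moreover have "c \<longlonglongrightarrow> sqrt (2 * (?v + 0)) + 0"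
      unfolding c_def[abs_def] s_def by (intro tendsto_intros LIMSEQ_inverse_real_of_nat)
    then have "(\<lambda>j. ennreal (c j)) \<longlonglongrightarrow> ennreal (sqrt (2 * cdf p x * (1 - cdf p x)))"
      by (intro tendsto_ennrealI) (simp add: mult_ac)
    ultimately show ?case
      by (intro LIMSEQ_le_const[where X="\<lambda>j. ennreal (c j)"]) auto
  qed
qed

lemma nn_integral_SUP_dev_le:
  assumes p: "p \<in> space borel_prob"
  shows "(\<integral>\<^sup>+\<omega>. (SUP n\<in>{21..}. dev n \<omega> p x) \<partial>iid p) \<le> ennreal (41 * sqrt (cdf p x * (1 - cdf p x)))"
proof -
  let ?v = "cdf p x * (1 - cdf p x)"
  define s where "s j = ?v + inverse (real (Suc j))" for j
  have "(\<integral>\<^sup>+\<omega>. (SUP n\<in>{21..}. dev n \<omega> p x) \<partial>iid p) \<le> ennreal (41 * sqrt (s j))" for j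
  proof -
    interpret centered_bounded_abs_sequence p "\<lambda>y. indicator {..x} y - cdf p x" "s j"
      by (rule indicator_sequence[OF p]) (simp add: s_def)
    have "(\<integral>\<^sup>+\<omega>. (SUP n\<in>{21..}. dev n \<omega> p x) \<partial>iid p) =
      (\<integral>\<^sup>+\<omega>. (SUP n\<in>{21..}. ennreal (\<bar>\<Sum>i<n. indicator {..x} (\<omega> i) - cdf p x\<bar> / lil_scale n)) \<partial>iid p)"
      by (intro nn_integral_cong SUP_cong) (auto simp: dev_eq)
    also have "\<dots> \<le> ennreal (41 * sqrt (s j))"
      using cdf_var_nonneg[OF p, of x] by (intro nn_integral_sup_le) (simp add: s_def add_nonneg_pos)
    finally show ?thesis .
  qed
  moreover have "(\<lambda>j. 41 * sqrt (s j)) \<longlonglongrightarrow> 41 * sqrt (?v + 0)"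
    unfolding s_def by (intro tendsto_intros LIMSEQ_inverse_real_of_nat)
  then have "(\<lambda>j. ennreal (41 * sqrt (s j))) \<longlonglongrightarrow> ennreal (41 * sqrt ?v)"
    by (intro tendsto_ennrealI) simp
  ultimately show ?thesis
    by (intro LIMSEQ_le_const[where X="\<lambda>j. ennreal (41 * sqrt (s j))"]) auto
qed

section \<open>Identification of the random limit\<close>

text \<open>A law of large numbers read off from the law of the iterated logarithm: the variance of
  an indicator is at most 1, 2 exceeds \<open>sqrt (2 * 1)\<close>, and
  \<open>lil_scale n / n\<close> tends to 0.\<close>

lemma AE_ecdf_tendsto:
  assumes p: "p \<in> space borel_prob"
  shows "AE \<omega> in iid p. (\<lambda>n. ecdf n \<omega> x) \<longlonglongrightarrow> cdf p x"
proof -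
  have "cdf p x * (1 - cdf p x) \<le> 1"
    using cdf_in_unit[OF p, of x] by (intro mult_le_one) auto
  then interpret centered_bounded_abs_sequence p "\<lambda>y. indicator {..x} y - cdf p x" 1
    by (rule indicator_sequence[OF p])
  have "sqrt (2 * 1) < (2 :: real)"
    by (simp add: real_sqrt_less_iff[of 2 4, simplified])
  then have "AE \<omega> in iid p. \<forall>\<^sub>F n in sequentially.
    \<bar>\<Sum>i<n. indicator {..x} (\<omega> i) - cdf p x\<bar> \<le> 2 * lil_scale n"
    by (intro iterated_log) auto
  then show ?thesis
  proof eventually_elim
    case (elim \<omega>)
    have "\<forall>\<^sub>F n in sequentially. norm (ecdf n \<omega> x - cdf p x) \<le> 2 * lil_scale n / real n"
      using elim eventually_ge_at_top[of 1]
      by eventually_elim (simp add: ecdf_minus divide_right_mono)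
    moreover have "(\<lambda>n. 2 * lil_scale n / real n) \<longlonglongrightarrow> 0"
      by real_asymp
    ultimately have "(\<lambda>n. ecdf n \<omega> x - cdf p x) \<longlonglongrightarrow> 0"
      by (rule Lim_null_comparison)
    then show ?case by (simp add: LIM_zero_iff)
  qed
qed

text \<open>The hypothesis compares two different points, so two rationals are placed between
  \<open>z\<close> and each larger \<open>y\<close>; right continuity then lets \<open>y\<close>
  tend to \<open>z\<close>.\<close>

lemma cdf_le_of_rational:
  assumes p: "p \<in> space borel_prob" and r: "r \<in> space borel_prob"
    and le: "\<And>x y. x \<in> \<rat> \<Longrightarrow> y \<in> \<rat> \<Longrightarrow> x < y \<Longrightarrow> cdf p x \<le> cdf r y"
  shows "cdf p z \<le> cdf r z"
proof -
  interpret P: real_distribution p by (rule borel_prob_real_distribution[OF p])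
  interpret R: real_distribution r by (rule borel_prob_real_distribution[OF r])
  have "cdf p z \<le> cdf r y" if zy: "z < y" for y
  proof -
    obtain a where a: "a \<in> \<rat>" "z < a" "a < y" using Rats_dense_in_real[OF zy] by blast
    obtain b where b: "b \<in> \<rat>" "a < b" "b < y" using Rats_dense_in_real[OF a(3)] by blast
    have "cdf p z \<le> cdf p a" using a by (intro P.cdf_nondecreasing) auto
    also have "\<dots> \<le> cdf r b" using le a b by auto
    also have "\<dots> \<le> cdf r y" using b by (intro R.cdf_nondecreasing) auto
    finally show ?thesis .
  qed
  then have "\<forall>\<^sub>F y in at_right z. cdf p z \<le> cdf r y"
    by (auto simp: eventually_at_filter)
  moreover have "(cdf r \<longlongrightarrow> cdf r z) (at_right z)"
    using R.cdf_is_right_cont[of z] by (simp add: continuous_within)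
  ultimately show ?thesis
    by (intro tendsto_lowerbound[of "cdf r" "cdf r z" "at_right z"]) auto
qed

text \<open>The integral of \<open>cts_step x y\<close> lies between the distribution functions at
  \<open>x\<close> and at \<open>y\<close>, for the empirical measures as well as for
  \<open>r\<close>. In the limit this compares \<open>p\<close> and \<open>r\<close> at neighbouring
  rationals, so continuity points never enter.\<close>

lemma weak_limit_unique:
  assumes p: "p \<in> space borel_prob"
    and lim: "limitin weak_topology (\<lambda>n. empirical n \<omega>) r sequentially"
    and ecdf: "\<And>x. x \<in> \<rat> \<Longrightarrow> (\<lambda>n. ecdf n \<omega> x) \<longlonglongrightarrow> cdf p x"
  shows "r = p"
proof -
  have r: "r \<in> space borel_prob"
    using lim by (simp add: limitin_def topspace_weak_topology prob_measures_def space_borel_prob)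
  interpret P: real_distribution p by (rule borel_prob_real_distribution[OF p])
  interpret R: real_distribution r by (rule borel_prob_real_distribution[OF r])
  have conv: "(\<lambda>n. \<integral>y. f y \<partial>empirical n \<omega>) \<longlonglongrightarrow> (\<integral>y. f y \<partial>r)"
    if f: "continuous_on UNIV f" "bounded (range f)" for f :: "real \<Rightarrow> real"
  proof (rule topological_tendstoI)
    fix U :: "real set" assume U: "open U" "(\<integral>y. f y \<partial>r) \<in> U"
    have "openin weak_topology {\<mu> \<in> prob_measures. (\<integral>y. f y \<partial>\<mu>) \<in> U}"
      using f U by (intro openin_weak_topology_integral)
    moreover have "r \<in> {\<mu> \<in> prob_measures. (\<integral>y. f y \<partial>\<mu>) \<in> U}"
      using r U by (simp add: prob_measures_def space_borel_prob)
    ultimately have "\<forall>\<^sub>F n in sequentially. empirical n \<omega> \<in> {\<mu> \<in> prob_measures. (\<integral>y. f y \<partial>\<mu>) \<in> U}"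
      using lim unfolding limitin_def by blast
    then show "\<forall>\<^sub>F n in sequentially. (\<integral>y. f y \<partial>empirical n \<omega>) \<in> U"
      by eventually_elim simp
  qed
  have between: "cdf p x \<le> (\<integral>z. cts_step x y z \<partial>r) \<and> (\<integral>z. cts_step x y z \<partial>r) \<le> cdf p y"
    if xy: "x \<in> \<rat>" "y \<in> \<rat>" "x < y" for x y
  proof -
    have lim': "(\<lambda>n. \<integral>z. cts_step x y z \<partial>empirical n \<omega>) \<longlonglongrightarrow> (\<integral>z. cts_step x y z \<partial>r)"
      using xy by (intro conv cts_step_continuous_bounded)
    have ev: "\<forall>\<^sub>F n in sequentially. ecdf n \<omega> x \<le> (\<integral>z. cts_step x y z \<partial>empirical n \<omega>) \<and> (\<integral>z. cts_step x y z \<partial>empirical n \<omega>) \<le> ecdf n \<omega> y"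
      using eventually_ge_at_top[of 1]
    proof eventually_elim
      case (elim n)
      interpret E: real_distribution "empirical n \<omega>"
        by (rule borel_prob_real_distribution[OF empirical_in_space[OF elim]])
      show ?case using E.cdf_cts_step[OF xy(3)] by (simp add: cdf_empirical[OF elim])
    qed
    show ?thesis
      using tendsto_le[OF sequentially_bot lim' ecdf[OF xy(1)]] tendsto_le[OF sequentially_bot ecdf[OF xy(2)] lim'] ev
      by (simp add: eventually_conj_iff)
  qed
  have "cdf p x \<le> cdf r y" "cdf r x \<le> cdf p y" if "x \<in> \<rat>" "y \<in> \<rat>" "x < y" for x y
    using between[OF that] R.cdf_cts_step[OF that(3)] by linarith+
  then have "cdf r = cdf p"
    using cdf_le_of_rational[OF p r] cdf_le_of_rational[OF r p] by (intro ext antisym) auto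
  then show ?thesis
    by (intro cdf_unique P.real_distribution_axioms R.real_distribution_axioms)
qed

section \<open>The moment condition\<close>

lemma nn_integral_powr_tail_finite:
  assumes "\<delta> > 0"
  shows "(\<integral>\<^sup>+x. ennreal ((1 + \<bar>x\<bar>) powr - (1 + \<delta>)) \<partial>lborel) < \<infinity>"
proof -
  let ?f = "\<lambda>x :: real. (1 + x) powr - (1 + \<delta>)"
  let ?F = "\<lambda>x :: real. - (1 / \<delta>) * (1 + x) powr - \<delta>"
  have half: "(\<integral>\<^sup>+x\<in>{0..}. ennreal (?f x) \<partial>lborel) = ennreal (0 - ?F 0)"
  proof (rule nn_integral_FTC_atLeast)
    fix x :: real assume x: "0 \<le> x"
    show "(?F has_real_derivative ?f x) (at x)"
    proof -
      have "((\<lambda>x. (1 + x) powr - \<delta>) has_real_derivative - \<delta> * (1 + x) powr (- \<delta> - of_nat 1) * 1) (at x)"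
        using x by (intro DERIV_fun_powr) (auto intro!: derivative_eq_intros)
      from DERIV_cmult[OF this, of "- (1 / \<delta>)"]
      have "(?F has_real_derivative - (1 / \<delta>) * (- \<delta> * (1 + x) powr (- \<delta> - of_nat 1) * 1)) (at x)" .
      also have "- (1 / \<delta>) * (- \<delta> * (1 + x) powr (- \<delta> - of_nat 1) * 1) = (1 + x) powr (- \<delta> - of_nat 1)"
        using assms by simp
      also have "- \<delta> - of_nat 1 = - (1 + \<delta>)" by simp
      finally show ?thesis .
    qed
  next
    show "(?F \<longlongrightarrow> 0) at_top"
      using assms by real_asymp
  qed auto
  have "(\<integral>\<^sup>+x. ennreal ((1 + \<bar>x\<bar>) powr - (1 + \<delta>)) \<partial>lborel) \<le>
    (\<integral>\<^sup>+x. ennreal (?f x) * indicator {0..} x + ennreal (?f (- x)) * indicator {0..} (- x) \<partial>lborel)"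
    by (intro nn_integral_mono) (auto simp: indicator_def abs_if)
  also have "\<dots> = (\<integral>\<^sup>+x\<in>{0..}. ennreal (?f x) \<partial>lborel) + (\<integral>\<^sup>+x. ennreal (?f (- x)) * indicator {0..} (- x) \<partial>lborel)"
    by (intro nn_integral_add) measurable
  also have "(\<integral>\<^sup>+x. ennreal (?f (- x)) * indicator {0..} (- x) \<partial>lborel) = (\<integral>\<^sup>+x\<in>{0..}. ennreal (?f x) \<partial>lborel)"
    by (subst nn_integral_real_affine[of "\<lambda>x. ennreal (?f x) * indicator {0..} x" "-1" 0]) auto
  also have "(\<integral>\<^sup>+x\<in>{0..}. ennreal (?f x) \<partial>lborel) + (\<integral>\<^sup>+x\<in>{0..}. ennreal (?f x) \<partial>lborel) < \<infinity>"
    unfolding half by simp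
  finally show ?thesis .
qed

text \<open>The root is not linear in \<open>p\<close>, so its mean over \<open>q\<close> is not a
  functional of the mean measure. The inequality \<open>sqrt t \<le> t * w + 1 / w\<close> bounds it
  by one that is, with a weight \<open>w\<close> that remains free.\<close>

lemma sqrt_cdf_var_le:
  assumes p: "p \<in> space borel_prob" and w: "w > 0"
  shows "sqrt (cdf p x * (1 - cdf p x)) \<le> measure p {y. \<bar>x\<bar> \<le> \<bar>y\<bar>} * w + 1 / w"
proof -
  interpret real_distribution p by (rule borel_prob_real_distribution[OF p])
  let ?t = "measure p {y. \<bar>x\<bar> \<le> \<bar>y\<bar>}"
  have F: "0 \<le> cdf p x" "cdf p x \<le> 1" using cdf_in_unit[OF p] by auto
  have "cdf p x * (1 - cdf p x) \<le> ?t"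
  proof (cases "x \<ge> 0")
    case True
    have "1 - cdf p x = measure p (space p - {..x})"
      unfolding cdf_def by (subst prob_compl) auto
    also have "\<dots> \<le> ?t"
      using True by (intro finite_measure_mono) auto
    finally show ?thesis
      using F mult_left_le_one_le[of "1 - cdf p x" "cdf p x"] by linarith
  next
    case False
    have "cdf p x \<le> ?t"
      unfolding cdf_def using False by (intro finite_measure_mono) auto
    then show ?thesis
      using F mult_left_le[of "1 - cdf p x" "cdf p x"] by linarith
  qed
  then have "sqrt (cdf p x * (1 - cdf p x)) \<le> sqrt ?t"
    by (rule real_sqrt_le_mono)
  also have "sqrt ?t \<le> ?t * w + 1 / w"
  proof -
    define a where "a = sqrt ?t"
    have a: "a \<ge> 0" "?t = a\<^sup>2" by (simp_all add: a_def)
    have "0 \<le> (a * w - 1)\<^sup>2 + a * w" using a w by simp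
    also have "\<dots> = (a\<^sup>2 * w + 1 / w - a) * w"
      using w by (simp add: power2_eq_square field_simps)
    finally have "0 \<le> a\<^sup>2 * w + 1 / w - a"
      using w by (simp add: zero_le_mult_iff)
    then have "a \<le> ?t * w + 1 / w" unfolding a(2)[symmetric] by simp
    then show ?thesis unfolding a_def .
  qed
  finally show ?thesis .
qed

lemma nn_integral_sqrt_cdf_var_finite:
  assumes q: "prob_space q" "sets q = sets borel_prob"
    and \<delta>: "\<delta> > 0" and moment: "(\<integral>\<^sup>+ x. ennreal (\<bar>x\<bar> powr (2 + \<delta>)) \<partial>mean_measure q) < \<infinity>"
  shows "(\<integral>\<^sup>+x. (\<integral>\<^sup>+p. ennreal (sqrt (cdf p x * (1 - cdf p x))) \<partial>q) \<partial>lborel) < \<infinity>"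
proof -
  let ?s = "\<lambda>p x. ennreal (sqrt (cdf p x * (1 - cdf p x)))"
  let ?m = "mean_measure q"
  note q' = in_space_prob_algebra_borel_prob[OF q]
  interpret Q: prob_space q by (rule q)
  have space_q: "space q = space borel_prob" by (rule sets_eq_imp_space_eq[OF q(2)])
  have sets_m: "sets ?m = sets borel"
    unfolding mean_measure_eq_bind[OF q] by (rule sets_bind'[OF q' measurable_id_borel_prob])
  have "prob_space ?m"
    unfolding mean_measure_eq_bind[OF q] by (rule prob_space_bind'[OF q' measurable_id_borel_prob])
  then interpret m: prob_space ?m .
  interpret pair_sigma_finite ?m lborel ..
  \<comment> \<open>The exponent makes \<open>1 / w\<close> integrable over the line, while by
    Tonelli the other term is the mean of the integral of \<open>w\<close> over
    \<open>{- \<bar>y\<bar>..\<bar>y\<bar>}\<close>, which for large \<open>y\<close> is of the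
    order of the assumed moment.\<close>
  define w where "w x = (1 + \<bar>x\<bar>) powr (1 + \<delta>)" for x :: real
  have w: "w x > 0" for x by (simp add: w_def add_pos_nonneg)
  have w_inv: "1 / w x = (1 + \<bar>x\<bar>) powr - (1 + \<delta>)" for x
    unfolding w_def by (rule powr_minus_divide[symmetric])
  have [measurable]: "w \<in> borel_measurable borel" unfolding w_def[abs_def] by measurable
  let ?A = "\<lambda>x. {y :: real. \<bar>x\<bar> \<le> \<bar>y\<bar>}"
  have A [measurable]: "?A x \<in> sets borel" for x by measurable
  have "(\<integral>\<^sup>+p. ?s p x \<partial>q) \<le> emeasure ?m (?A x) * ennreal (w x) + ennreal (1 / w x)" for x
  proof -
    have meas: "(\<lambda>p. emeasure p (?A x)) \<in> borel_measurable q"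
      using measurable_emeasure_borel_prob[OF A] q(2) by (simp cong: measurable_cong_sets)
    have "(\<integral>\<^sup>+p. ?s p x \<partial>q) \<le> (\<integral>\<^sup>+p. emeasure p (?A x) * ennreal (w x) + ennreal (1 / w x) \<partial>q)"
    proof (intro nn_integral_mono)
      fix p assume "p \<in> space q"
      then have p: "p \<in> space borel_prob" by (simp add: space_q)
      then interpret real_distribution p by (rule borel_prob_real_distribution)
      have "?s p x \<le> ennreal (measure p (?A x) * w x + 1 / w x)"
        by (intro ennreal_leI sqrt_cdf_var_le p w)
      also have "\<dots> = emeasure p (?A x) * ennreal (w x) + ennreal (1 / w x)"
        using w[of x] by (simp add: emeasure_eq_measure ennreal_mult less_imp_le)
      finally show "?s p x \<le> emeasure p (?A x) * ennreal (w x) + ennreal (1 / w x)" .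
    qed
    also have "\<dots> = (\<integral>\<^sup>+p. emeasure p (?A x) \<partial>q) * ennreal (w x) + ennreal (1 / w x)"
      using meas by (simp add: nn_integral_add nn_integral_multc Q.emeasure_space_1)
    also have "(\<integral>\<^sup>+p. emeasure p (?A x) \<partial>q) = emeasure ?m (?A x)"
      unfolding mean_measure_eq_bind[OF q]
      by (rule emeasure_bind_prob_algebra[OF q' measurable_id_borel_prob A, symmetric])
    finally show ?thesis .
  qed
  then have "(\<integral>\<^sup>+x. (\<integral>\<^sup>+p. ?s p x \<partial>q) \<partial>lborel) \<le>
    (\<integral>\<^sup>+x. emeasure ?m (?A x) * ennreal (w x) + ennreal (1 / w x) \<partial>lborel)"
    by (intro nn_integral_mono)
  also have "\<dots> = (\<integral>\<^sup>+x. (\<integral>\<^sup>+y. (if \<bar>x\<bar> \<le> \<bar>y\<bar> then ennreal (w x) else 0) \<partial>?m) + ennreal (1 / w x) \<partial>lborel)"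
  proof (intro nn_integral_cong arg_cong2[where f="(+)"] refl)
    fix x
    have "(\<integral>\<^sup>+y. (if \<bar>x\<bar> \<le> \<bar>y\<bar> then ennreal (w x) else 0) \<partial>?m) = (\<integral>\<^sup>+y. indicator (?A x) y * ennreal (w x) \<partial>?m)"
      by (intro nn_integral_cong) (simp add: indicator_def)
    also have "\<dots> = emeasure ?m (?A x) * ennreal (w x)"
      using A sets_m by (subst nn_integral_multc) auto
    finally show "emeasure ?m (?A x) * ennreal (w x) = (\<integral>\<^sup>+y. (if \<bar>x\<bar> \<le> \<bar>y\<bar> then ennreal (w x) else 0) \<partial>?m)" ..
  qed
  also have "\<dots> = (\<integral>\<^sup>+x. (\<integral>\<^sup>+y. (if \<bar>x\<bar> \<le> \<bar>y\<bar> then ennreal (w x) else 0) \<partial>?m) \<partial>lborel) + (\<integral>\<^sup>+x. ennreal (1 / w x) \<partial>lborel)"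
  proof (rule nn_integral_add)
    have [measurable_cong]: "sets ?m = sets borel" by (rule sets_m)
    have "(\<lambda>(x, y). if \<bar>x\<bar> \<le> \<bar>y\<bar> then ennreal (w x) else 0) \<in> borel_measurable (lborel \<Otimes>\<^sub>M ?m)"
      by measurable
    then show "(\<lambda>x. \<integral>\<^sup>+y. (if \<bar>x\<bar> \<le> \<bar>y\<bar> then ennreal (w x) else 0) \<partial>?m) \<in> borel_measurable lborel"
      by (rule m.borel_measurable_nn_integral)
  qed measurable
  also have "(\<integral>\<^sup>+x. (\<integral>\<^sup>+y. (if \<bar>x\<bar> \<le> \<bar>y\<bar> then ennreal (w x) else 0) \<partial>?m) \<partial>lborel) =
    (\<integral>\<^sup>+y. (\<integral>\<^sup>+x. (if \<bar>x\<bar> \<le> \<bar>y\<bar> then ennreal (w x) else 0) \<partial>lborel) \<partial>?m)"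
  proof (rule Fubini')
    have [measurable_cong]: "sets ?m = sets borel" by (rule sets_m)
    show "(\<lambda>(y, x). if \<bar>x\<bar> \<le> \<bar>y\<bar> then ennreal (w x) else 0) \<in> borel_measurable (?m \<Otimes>\<^sub>M lborel)"
      by measurable
  qed
  also have "\<dots> \<le> (\<integral>\<^sup>+y. ennreal (2 * 2 powr (2 + \<delta>)) * (1 + ennreal (\<bar>y\<bar> powr (2 + \<delta>))) \<partial>?m)"
  proof (intro nn_integral_mono)
    fix y
    have "(\<integral>\<^sup>+x. (if \<bar>x\<bar> \<le> \<bar>y\<bar> then ennreal (w x) else 0) \<partial>lborel) \<le> (\<integral>\<^sup>+x. ennreal (w y) * indicator {- \<bar>y\<bar>..\<bar>y\<bar>} x \<partial>lborel)"
      using \<delta> by (intro nn_integral_mono) (auto simp: indicator_def w_def intro!: ennreal_leI powr_mono2)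
    also have "\<dots> = ennreal (w y) * ennreal (2 * \<bar>y\<bar>)"
      by (subst nn_integral_cmult_indicator) auto
    also have "\<dots> = ennreal (w y * (2 * \<bar>y\<bar>))"
      using w[of y] by (intro ennreal_mult[symmetric]) auto
    also have "w y * (2 * \<bar>y\<bar>) \<le> 2 * 2 powr (2 + \<delta>) * (1 + \<bar>y\<bar> powr (2 + \<delta>))"
    proof -
      have "w y * (2 * \<bar>y\<bar>) \<le> 2 * (w y * (1 + \<bar>y\<bar>))"
        using w[of y] by simp
      also have "w y * (1 + \<bar>y\<bar>) = (1 + \<bar>y\<bar>) powr (2 + \<delta>)"
        by (simp add: w_def powr_add powr_one power2_eq_square flip: powr_realpow)
      also have "\<dots> \<le> (2 * max 1 \<bar>y\<bar>) powr (2 + \<delta>)"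
        using \<delta> by (intro powr_mono2) auto
      also have "\<dots> = 2 powr (2 + \<delta>) * max 1 \<bar>y\<bar> powr (2 + \<delta>)"
        by (simp add: powr_mult)
      also have "max 1 \<bar>y\<bar> powr (2 + \<delta>) \<le> 1 + \<bar>y\<bar> powr (2 + \<delta>)"
        by (simp add: max_def)
      finally show ?thesis by simp
    qed
    then have "ennreal (w y * (2 * \<bar>y\<bar>)) \<le> ennreal (2 * 2 powr (2 + \<delta>) * (1 + \<bar>y\<bar> powr (2 + \<delta>)))"
      by (rule ennreal_leI)
    also have "\<dots> = ennreal (2 * 2 powr (2 + \<delta>)) * (1 + ennreal (\<bar>y\<bar> powr (2 + \<delta>)))"
      by (subst ennreal_mult) auto
    finally show "(\<integral>\<^sup>+x. (if \<bar>x\<bar> \<le> \<bar>y\<bar> then ennreal (w x) else 0) \<partial>lborel) \<le>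
      ennreal (2 * 2 powr (2 + \<delta>)) * (1 + ennreal (\<bar>y\<bar> powr (2 + \<delta>)))" .
  qed
  also have "\<dots> = ennreal (2 * 2 powr (2 + \<delta>)) * (1 + (\<integral>\<^sup>+y. ennreal (\<bar>y\<bar> powr (2 + \<delta>)) \<partial>?m))"
  proof -
    have [measurable_cong]: "sets ?m = sets borel" by (rule sets_m)
    show ?thesis
      by (simp add: nn_integral_cmult nn_integral_add m.emeasure_space_1)
  qed
  finally have "(\<integral>\<^sup>+x. (\<integral>\<^sup>+p. ?s p x \<partial>q) \<partial>lborel) \<le>
    ennreal (2 * 2 powr (2 + \<delta>)) * (1 + (\<integral>\<^sup>+y. ennreal (\<bar>y\<bar> powr (2 + \<delta>)) \<partial>?m)) + (\<integral>\<^sup>+x. ennreal (1 / w x) \<partial>lborel)"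
    by (simp add: add_right_mono)
  also have "\<dots> < \<infinity>"
    using moment nn_integral_powr_tail_finite[OF \<delta>] unfolding w_inv
    by (simp add: ennreal_mult_less_top)
  finally show ?thesis .
qed

section \<open>The exchangeable law and its posterior distributions\<close>

locale exchangeable_law =
  fixes q :: "real measure measure" and \<rho> :: "(nat \<Rightarrow> real) measure" and p_lim :: "(nat \<Rightarrow> real) \<Rightarrow> real measure"
  assumes q: "prob_space q" "sets q = sets borel_prob"
    and rho: "\<rho> = product_mixture UNIV q"
    and measurable_p_lim [measurable]: "p_lim \<in> \<rho> \<rightarrow>\<^sub>M borel_prob"
    and p_lim: "AE \<omega> in \<rho>. limitin weak_topology (\<lambda>n. empirical n \<omega>) (p_lim \<omega>) sequentially"
begin

lemma space_q: "space q = space borel_prob"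
  by (rule sets_eq_imp_space_eq[OF q(2)])

lemma rho_eq_bind: "\<rho> = q \<bind> iid"
  unfolding rho by (rule product_mixture_eq_bind[OF q])

lemma sets_rho [measurable_cong]: "sets \<rho> = sets (borel_pow UNIV)"
  unfolding rho_eq_bind
  by (rule sets_bind'[OF in_space_prob_algebra_borel_prob[OF q] measurable_PiM_borel_prob])

lemma space_rho: "space \<rho> = UNIV"
  using sets_eq_imp_space_eq[OF sets_rho] by (simp add: space_PiM)

sublocale prob_space \<rho>
  unfolding rho_eq_bind
  by (rule prob_space_bind'[OF in_space_prob_algebra_borel_prob[OF q] measurable_PiM_borel_prob])

lemma kernel: "iid \<in> q \<rightarrow>\<^sub>M subprob_algebra (borel_pow UNIV)"
  using measurable_prob_algebraD[OF measurable_PiM_borel_prob[of UNIV]] q(2)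
  by (simp cong: measurable_cong_sets)

lemma nn_integral_rho:
  assumes "f \<in> borel_measurable \<rho>"
  shows "(\<integral>\<^sup>+\<omega>. f \<omega> \<partial>\<rho>) = (\<integral>\<^sup>+p. (\<integral>\<^sup>+\<omega>. f \<omega> \<partial>iid p) \<partial>q)"
proof -
  have "f \<in> borel_measurable (borel_pow UNIV)"
    using assms measurable_cong_sets[OF sets_rho refl] by auto
  then show ?thesis
    unfolding rho_eq_bind by (rule nn_integral_bind[OF _ kernel])
qed

lemma AE_rhoI:
  assumes "Measurable.pred \<rho> P" "AE p in q. AE \<omega> in iid p. P \<omega>"
  shows "AE \<omega> in \<rho>. P \<omega>"
proof -
  have "Measurable.pred (borel_pow UNIV) P"
    using assms(1) measurable_cong_sets[OF sets_rho refl] by auto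
  from AE_bind[OF kernel this] assms(2) show ?thesis
    unfolding rho_eq_bind by blast
qed

text \<open>\<open>AE_bind\<close> asks for a measurable predicate, which weak convergence is not
  shown to be; passing to a measurable null set covers every predicate.\<close>

lemma AE_rhoD:
  assumes "AE \<omega> in \<rho>. P \<omega>"
  shows "AE p in q. AE \<omega> in iid p. P \<omega>"
proof -
  obtain N where N: "{\<omega> \<in> space \<rho>. \<not> P \<omega>} \<subseteq> N" "emeasure \<rho> N = 0" "N \<in> sets \<rho>"
    using assms by (rule AE_E)
  then have [measurable]: "N \<in> sets (borel_pow UNIV)" using sets_rho by simp
  have "AE \<omega> in \<rho>. \<omega> \<notin> N"
    using N by (intro AE_not_in) (auto simp: null_sets_def)
  then have "AE \<omega> in q \<bind> iid. \<omega> \<notin> N"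
    unfolding rho_eq_bind[symmetric] .
  then have "AE p in q. AE \<omega> in iid p. \<omega> \<notin> N"
    by (subst (asm) AE_bind[OF kernel]) auto
  then show ?thesis
  proof eventually_elim
    case (elim p)
    then show ?case
      by eventually_elim (use N(1) in \<open>auto simp: space_rho\<close>)
  qed
qed

text \<open>Under \<open>iid p\<close> the empirical distribution functions converge to that of
  \<open>p\<close> at all rationals simultaneously, which pins down the weak limit. Statements about
  the random limit thus become statements about i.i.d. sequences with a fixed law.\<close>

lemma AE_p_lim_eq: "AE p in q. AE \<omega> in iid p. p_lim \<omega> = p"
  using AE_rhoD[OF p_lim] AE_space
proof eventually_elim
  case (elim p)
  then have p: "p \<in> space borel_prob" by (simp add: space_q)
  have "AE \<omega> in iid p. \<forall>x\<in>\<rat>. (\<lambda>n. ecdf n \<omega> x) \<longlonglongrightarrow> cdf p x"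
    using AE_ecdf_tendsto[OF p] by (simp add: AE_ball_countable countable_rat)
  with elim(1) show ?case
    by eventually_elim (auto intro: weak_limit_unique[OF p])
qed

lemma measurable_coordinate: "(\<lambda>\<omega>. \<omega> i) \<in> borel_measurable \<rho>"
  using measurable_component_singleton[of i UNIV "\<lambda>_. borel :: real measure"] measurable_cong_sets[OF sets_rho refl]
  by auto

lemma measurable_dev_p_lim:
  assumes f: "f \<in> M \<rightarrow>\<^sub>M \<rho>" and "g \<in> borel_measurable M"
  shows "(\<lambda>w. dev n (f w) (p_lim (f w)) (g w)) \<in> borel_measurable M"
  using assms measurable_compose[OF f measurable_p_lim] measurable_compose[OF f measurable_coordinate]
  by (intro measurable_dev) auto

text \<open>The normalized \<open>W\<close>, written as an integral of \<open>dev\<close> so that it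
  can be estimated point by point.\<close>

definition dist_lim :: "nat \<Rightarrow> (nat \<Rightarrow> real) \<Rightarrow> ennreal" where
  "dist_lim n \<omega> = (\<integral>\<^sup>+x. dev n \<omega> (p_lim \<omega>) x \<partial>lborel)"

lemma measurable_dist_lim [measurable]: "dist_lim n \<in> borel_measurable \<rho>"
proof -
  have "(\<lambda>(\<omega>, x). dev n \<omega> (p_lim \<omega>) x) \<in> borel_measurable (\<rho> \<Otimes>\<^sub>M lborel)"
    unfolding split_beta by (intro measurable_dev_p_lim) auto
  then show ?thesis
    unfolding dist_lim_def[abs_def] by (rule lborel.borel_measurable_nn_integral)
qed

abbreviation "lil_bound \<omega> x \<equiv> ennreal (sqrt (2 * cdf (p_lim \<omega>) x * (1 - cdf (p_lim \<omega>) x)))"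

text \<open>At each \<open>x\<close> the law of the iterated logarithm has its own exceptional null
  set. Joint measurability permits exchanging the two almost-everywhere quantifiers, which leaves
  one null set of sequences.\<close>

lemma AE_limsup_dev:
  "AE \<omega> in \<rho>. AE x in lborel. limsup (\<lambda>n. dev n \<omega> (p_lim \<omega>) x) \<le>
    lil_bound \<omega> x"
proof -
  interpret pair_sigma_finite \<rho> lborel ..
  have [measurable]: "(\<lambda>z. dev n (fst z) (p_lim (fst z)) (snd z)) \<in> borel_measurable (\<rho> \<Otimes>\<^sub>M lborel)" for n
    by (intro measurable_dev_p_lim) auto
  have [measurable]: "(\<lambda>z. cdf (p_lim (fst z)) (snd z)) \<in> borel_measurable (\<rho> \<Otimes>\<^sub>M lborel)"
    by (intro measurable_cdf measurable_compose[OF measurable_fst measurable_p_lim]) auto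
  have [measurable]: "(\<lambda>\<omega>. dev n \<omega> (p_lim \<omega>) x) \<in> borel_measurable \<rho>" for n x
    by (intro measurable_dev_p_lim) auto
  have [measurable]: "(\<lambda>\<omega>. cdf (p_lim \<omega>) x) \<in> borel_measurable \<rho>" for x
    by (intro measurable_cdf measurable_p_lim) auto
  have "AE x in lborel. AE \<omega> in \<rho>. limsup (\<lambda>n. dev n \<omega> (p_lim \<omega>) x) \<le>
    lil_bound \<omega> x"
  proof (rule AE_I2, rule AE_rhoI)
    fix x :: real
    show "AE p in q. AE \<omega> in iid p. limsup (\<lambda>n. dev n \<omega> (p_lim \<omega>) x) \<le>
      lil_bound \<omega> x"
      using AE_p_lim_eq AE_space
    proof eventually_elim
      case (elim p)
      then have "p \<in> space borel_prob" by (simp add: space_q)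
      from elim(1) AE_limsup_dev_le[OF this, of x] show ?case
        by eventually_elim simp
    qed
    have "(\<lambda>\<omega>. limsup (\<lambda>n. dev n \<omega> (p_lim \<omega>) x)) \<in> borel_measurable \<rho>"
      by measurable
    moreover have "(\<lambda>\<omega>. lil_bound \<omega> x) \<in> borel_measurable \<rho>"
      by measurable
    ultimately show "Measurable.pred \<rho> (\<lambda>\<omega>. limsup (\<lambda>n. dev n \<omega> (p_lim \<omega>) x) \<le>
      lil_bound \<omega> x)"
      unfolding pred_def by (rule borel_measurable_le)
  qed
  then show ?thesis
    by (subst AE_commute) measurable
qed

end

locale posterior_law = exchangeable_law +
  fixes post :: "nat \<Rightarrow> (nat \<Rightarrow> real) \<Rightarrow> real measure measure" and \<delta> :: real
  assumes post: "\<And>n. n \<ge> 1 \<Longrightarrow> regular_cond_distr \<rho>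
      (borel_pow {..<n}) (\<lambda>\<omega>. restrict \<omega> {..<n}) borel_prob p_lim (post n)"
    and \<delta>: "\<delta> > 0" and moment: "(\<integral>\<^sup>+ x. ennreal (\<bar>x\<bar> powr (2 + \<delta>)) \<partial>mean_measure q) < \<infinity>"
begin

text \<open>The supremum stays inside the integral over \<open>x\<close>. The inner integral is then
  finite almost surely, which gives the dominating function for the reverse Fatou lemma, and its
  mean bounds that of the supremum of \<open>dist_lim\<close>.\<close>

lemma nn_integral_SUP_dev_finite:
  "(\<integral>\<^sup>+\<omega>. (\<integral>\<^sup>+x. (SUP n\<in>{21..}. dev n \<omega> (p_lim \<omega>) x) \<partial>lborel) \<partial>\<rho>) < \<infinity>"
proof -
  let ?G = "\<lambda>\<omega> x. SUP n\<in>{21..}. dev n \<omega> (p_lim \<omega>) x"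
  let ?s = "\<lambda>p x. ennreal (sqrt (cdf p x * (1 - cdf p x)))"
  interpret pair_sigma_finite \<rho> lborel ..
  interpret Q: prob_space q by (rule q)
  have [measurable]: "(\<lambda>z. dev n (fst z) (p_lim (fst z)) (snd z)) \<in> borel_measurable (\<rho> \<Otimes>\<^sub>M lborel)" for n
    by (intro measurable_dev_p_lim) auto
  have [measurable]: "(\<lambda>\<omega>. dev n \<omega> (p_lim \<omega>) x) \<in> borel_measurable \<rho>" for n x
    by (intro measurable_dev_p_lim) auto
  have id_q: "(\<lambda>p. p) \<in> q \<rightarrow>\<^sub>M borel_prob"
    using q(2) by (simp cong: measurable_cong_sets)
  have [measurable]: "(\<lambda>p. cdf p x) \<in> borel_measurable q" for x
    using measurable_cdf[OF id_q] by simp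
  have [measurable]: "(\<lambda>z. cdf (snd z) (fst z)) \<in> borel_measurable (lborel \<Otimes>\<^sub>M q)"
    by (intro measurable_cdf measurable_compose[OF measurable_snd id_q]) auto
  have pointwise: "(\<integral>\<^sup>+\<omega>. ?G \<omega> x \<partial>\<rho>) \<le> (\<integral>\<^sup>+p. ennreal 41 * ?s p x \<partial>q)" for x
  proof -
    have "(\<integral>\<^sup>+\<omega>. ?G \<omega> x \<partial>\<rho>) =
      (\<integral>\<^sup>+p. (\<integral>\<^sup>+\<omega>. ?G \<omega> x \<partial>iid p) \<partial>q)"
      by (intro nn_integral_rho) measurable
    also have "\<dots> \<le> (\<integral>\<^sup>+p. ennreal 41 * ?s p x \<partial>q)"
    proof (rule nn_integral_mono_AE)
      show "AE p in q. (\<integral>\<^sup>+\<omega>. ?G \<omega> x \<partial>iid p) \<le> ennreal 41 * ?s p x"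
        using AE_p_lim_eq AE_space
      proof eventually_elim
        case (elim p)
        then have p: "p \<in> space borel_prob" by (simp add: space_q)
        have "(\<integral>\<^sup>+\<omega>. ?G \<omega> x \<partial>iid p) = (\<integral>\<^sup>+\<omega>. (SUP n\<in>{21..}. dev n \<omega> p x) \<partial>iid p)"
          using elim(1) by (intro nn_integral_cong_AE) (auto elim: eventually_mono)
        also have "\<dots> \<le> ennreal (41 * sqrt (cdf p x * (1 - cdf p x)))"
          by (rule nn_integral_SUP_dev_le[OF p])
        also have "\<dots> = ennreal 41 * ?s p x"
          using cdf_var_nonneg[OF p, of x] by (intro ennreal_mult) auto
        finally show ?case .
      qed
    qed
    finally show ?thesis .
  qed
  have "(\<integral>\<^sup>+\<omega>. (\<integral>\<^sup>+x. ?G \<omega> x \<partial>lborel) \<partial>\<rho>) =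
    (\<integral>\<^sup>+x. (\<integral>\<^sup>+\<omega>. ?G \<omega> x \<partial>\<rho>) \<partial>lborel)"
    by (rule Fubini'[symmetric]) (unfold split_beta, measurable)
  also have "\<dots> \<le> (\<integral>\<^sup>+x. (\<integral>\<^sup>+p. ennreal 41 * ?s p x \<partial>q) \<partial>lborel)"
    by (intro nn_integral_mono pointwise)
  also have "\<dots> = (\<integral>\<^sup>+x. ennreal 41 * (\<integral>\<^sup>+p. ?s p x \<partial>q) \<partial>lborel)"
    by (intro nn_integral_cong nn_integral_cmult) measurable
  also have "\<dots> = ennreal 41 * (\<integral>\<^sup>+x. (\<integral>\<^sup>+p. ?s p x \<partial>q) \<partial>lborel)"
  proof (rule nn_integral_cmult)
    show "(\<lambda>x. \<integral>\<^sup>+p. ?s p x \<partial>q) \<in> borel_measurable lborel"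
      by (rule Q.borel_measurable_nn_integral) (unfold split_beta, measurable)
  qed
  also have "\<dots> < \<infinity>"
    using nn_integral_sqrt_cdf_var_finite[OF q \<delta> moment] by (simp add: ennreal_mult_less_top)
  finally show ?thesis .
qed

lemma AE_limsup_dist_lim:
  "AE \<omega> in \<rho>. limsup (\<lambda>n. dist_lim n \<omega>) \<le>
    (\<integral>\<^sup>+x. lil_bound \<omega> x \<partial>lborel)"
proof -
  let ?G = "\<lambda>\<omega> x. SUP n\<in>{21..}. dev n \<omega> (p_lim \<omega>) x"
  have "(\<lambda>(\<omega>, x). SUP n\<in>{21..}. dev n \<omega> (p_lim \<omega>) x) \<in> borel_measurable (\<rho> \<Otimes>\<^sub>M lborel)"
    unfolding split_beta by (intro borel_measurable_SUP measurable_dev_p_lim) auto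
  then have "(\<lambda>\<omega>. \<integral>\<^sup>+x. ?G \<omega> x \<partial>lborel) \<in> borel_measurable \<rho>"
    by (rule lborel.borel_measurable_nn_integral)
  then have "AE \<omega> in \<rho>. (\<integral>\<^sup>+x. ?G \<omega> x \<partial>lborel) \<noteq> \<infinity>"
    using nn_integral_SUP_dev_finite by (intro nn_integral_PInf_AE) auto
  then show ?thesis
    using AE_limsup_dev
  proof eventually_elim
    case (elim \<omega>)
    have \<omega>: "\<omega> \<in> space \<rho>" by (simp add: space_rho)
    have [measurable]: "(\<lambda>x. dev n \<omega> (p_lim \<omega>) x) \<in> borel_measurable lborel" for n
      by (rule measurable_dev_p_lim) (use \<omega> in auto)
    \<comment> \<open>The domination holds from 21 on, hence the shift.\<close>
    have "limsup (\<lambda>n. dist_lim n \<omega>) = limsup (\<lambda>n. dist_lim (n + 21) \<omega>)"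
      by (rule limsup_shift_k[symmetric])
    also have "\<dots> \<le> (\<integral>\<^sup>+x. limsup (\<lambda>n. dev (n + 21) \<omega> (p_lim \<omega>) x) \<partial>lborel)"
      unfolding dist_lim_def
    proof (rule nn_integral_limsup[where w="\<lambda>x. SUP n\<in>{21..}. dev n \<omega> (p_lim \<omega>) x"])
      show "AE x in lborel. dev (i + 21) \<omega> (p_lim \<omega>) x \<le> ?G \<omega> x" for i
        by (intro AE_I2 SUP_upper) auto
      show "(\<integral>\<^sup>+x. ?G \<omega> x \<partial>lborel) < \<infinity>"
        using elim(1) by (simp add: top.not_eq_extremum)
    qed measurable
    also have "\<dots> = (\<integral>\<^sup>+x. limsup (\<lambda>n. dev n \<omega> (p_lim \<omega>) x) \<partial>lborel)"
      by (intro nn_integral_cong limsup_shift_k)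
    also have "\<dots> \<le> (\<integral>\<^sup>+x. lil_bound \<omega> x \<partial>lborel)"
      by (intro nn_integral_mono_AE elim)
    finally show ?case .
  qed
qed

section \<open>Conditioning on the first n coordinates\<close>

abbreviation "initial n \<equiv> vimage_algebra (space \<rho>) (\<lambda>\<omega>. restrict \<omega> {..<n}) (borel_pow {..<n})"

lemma measurable_restrict_rho: "(\<lambda>\<omega>. restrict \<omega> {..<n}) \<in> \<rho> \<rightarrow>\<^sub>M borel_pow {..<n}"
  by (intro measurable_restrict measurable_coordinate)

lemma sets_initial: "sets (initial n) = {(\<lambda>\<omega>. restrict \<omega> {..<n}) -` A \<inter> space \<rho> | A. A \<in> sets (borel_pow {..<n})}"
  using measurable_space[OF measurable_restrict_rho] by (intro sets_vimage_algebra2) auto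

lemma generating_filtration_initial: "generating_filtration \<rho> initial"
proof
  have sub: "sets (initial n) \<subseteq> sets \<rho>" for n
    using measurable_sets[OF measurable_restrict_rho] by (auto simp: sets_initial)
  then show "subalgebra \<rho> (initial n)" for n
    by (simp add: subalgebra_def)
  show "sets (initial m) \<subseteq> sets (initial n)" if mn: "m \<le> n" for m n
  proof
    fix B assume "B \<in> sets (initial m)"
    then obtain A where A: "A \<in> sets (borel_pow {..<m})" "B = (\<lambda>\<omega>. restrict \<omega> {..<m}) -` A \<inter> space \<rho>"
      by (auto simp: sets_initial)
    let ?A = "(\<lambda>x. restrict x {..<m}) -` A \<inter> space (borel_pow {..<n})"
    have "?A \<in> sets (borel_pow {..<n})"
      using mn A(1) by (intro measurable_sets[OF measurable_restrict_subset]) auto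
    moreover have "B = (\<lambda>\<omega>. restrict \<omega> {..<n}) -` ?A \<inter> space \<rho>"
      using mn unfolding A(2) by (auto simp: space_PiM Int_absorb1 restrict_restrict min_def)
    ultimately show "B \<in> sets (initial n)"
      unfolding sets_initial by blast
  qed
  show "sets \<rho> = sigma_sets (space \<rho>) (\<Union>n. sets (initial n))"
  proof
    show "sigma_sets (space \<rho>) (\<Union>n. sets (initial n)) \<subseteq> sets \<rho>"
      using sub by (intro sets.sigma_sets_subset) auto
    have "sets \<rho> = sigma_sets UNIV {{f \<in> \<Pi>\<^sub>E i\<in>UNIV. space (borel :: real measure). f i \<in> A} | (i :: nat) A. i \<in> UNIV \<and> A \<in> sets borel}"
      unfolding sets_rho sets_PiM_single by (simp add: PiE_UNIV_domain)
    also have "\<dots> \<subseteq> sigma_sets UNIV (\<Union>n. sets (initial n))"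
    proof (rule sigma_sets_mono', rule subsetI)
      fix B assume "B \<in> {{f \<in> \<Pi>\<^sub>E i\<in>UNIV. space (borel :: real measure). f i \<in> A} | (i :: nat) A. i \<in> UNIV \<and> A \<in> sets borel}"
      then obtain i A where A: "A \<in> sets borel" "B = {f. f i \<in> A}" by auto
      have "{f \<in> space (borel_pow {..<Suc i}). f i \<in> A} \<in> sets (borel_pow {..<Suc i})"
        using A(1) by measurable
      moreover have "B = (\<lambda>\<omega>. restrict \<omega> {..<Suc i}) -` {f \<in> space (borel_pow {..<Suc i}). f i \<in> A} \<inter> space \<rho>"
        unfolding A(2) by (auto simp: space_PiM space_rho)
      ultimately have "B \<in> sets (initial (Suc i))"
        unfolding sets_initial by blast
      then show "B \<in> (\<Union>n. sets (initial n))" by blast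
    qed
    finally show "sets \<rho> \<subseteq> sigma_sets (space \<rho>) (\<Union>n. sets (initial n))"
      by (simp add: space_rho)
  qed
qed

definition post_dist :: "nat \<Rightarrow> (nat \<Rightarrow> real) \<Rightarrow> ennreal" where
  "post_dist n \<omega> = (\<integral>\<^sup>+p. (\<integral>\<^sup>+x. dev n \<omega> p x \<partial>lborel) \<partial>post n (restrict \<omega> {..<n}))"

text \<open>Lets the posterior integrand be written as a function of the conditioning tuple.\<close>

lemma dev_restrict: "dev n (restrict \<omega> {..<n}) p x = dev n \<omega> p x"
  by (simp add: dev_def ecdf_def)

lemma post_dist_eq_nn_cond_exp:
  assumes n: "n \<ge> 1"
  shows "AE \<omega> in \<rho>. post_dist n \<omega> = nn_cond_exp \<rho> (initial n) (dist_lim n) \<omega>"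
proof -
  interpret regular_conditional_distribution \<rho> "borel_pow {..<n}" "\<lambda>\<omega>. restrict \<omega> {..<n}" borel_prob p_lim "post n"
    by unfold_locales (auto intro: measurable_restrict_rho post n)
  let ?g = "\<lambda>z. \<integral>\<^sup>+x. dev n (fst z) (snd z) x \<partial>lborel"
  have "(\<lambda>(z, x). dev n (fst z) (snd z) x) \<in> borel_measurable ((borel_pow {..<n} \<Otimes>\<^sub>M borel_prob) \<Otimes>\<^sub>M lborel)"
    unfolding split_beta
  proof (rule measurable_dev)
    show "(\<lambda>w. fst (fst w) i) \<in> borel_measurable ((borel_pow {..<n} \<Otimes>\<^sub>M borel_prob) \<Otimes>\<^sub>M lborel)" if "i < n" for i
      using that by (intro measurable_compose[OF measurable_compose[OF measurable_fst measurable_fst]]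
          measurable_component_singleton) auto
  qed measurable
  then have "?g \<in> borel_measurable (borel_pow {..<n} \<Otimes>\<^sub>M borel_prob)"
    by (rule lborel.borel_measurable_nn_integral)
  from nn_cond_exp_eq[OF this] show ?thesis
    by (simp add: dev_restrict post_dist_def dist_lim_def[abs_def])
qed

text \<open>A one-sided Hunt lemma: for \<open>n \<ge> m\<close> the moving variable
  \<open>dist_lim n\<close> is below the fixed \<open>Z m\<close>, to which the upward theorem
  applies. The infimum of \<open>Z m\<close> over \<open>m\<close> is the upper limit of
  \<open>dist_lim\<close>.\<close>

lemma AE_limsup_post_dist: "AE \<omega> in \<rho>. limsup (\<lambda>n. post_dist n \<omega>) \<le> limsup (\<lambda>n. dist_lim n \<omega>)"
proof -
  interpret generating_filtration \<rho> initial by (rule generating_filtration_initial)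
  define Z where "Z m \<omega> = (SUP k\<in>{m..}. dist_lim k \<omega>)" for m \<omega>
  have [measurable]: "Z m \<in> borel_measurable \<rho>" for m
    unfolding Z_def[abs_def] by measurable
  have Z_fin: "(\<integral>\<^sup>+\<omega>. Z m \<omega> \<partial>\<rho>) < \<infinity>" if m: "m \<ge> 21" for m
  proof -
    have "Z m \<omega> \<le> (\<integral>\<^sup>+x. (SUP n\<in>{21..}. dev n \<omega> (p_lim \<omega>) x) \<partial>lborel)" for \<omega>
      unfolding Z_def dist_lim_def using m by (intro SUP_least nn_integral_mono SUP_upper) auto
    then have "(\<integral>\<^sup>+\<omega>. Z m \<omega> \<partial>\<rho>) \<le> (\<integral>\<^sup>+\<omega>. (\<integral>\<^sup>+x. (SUP n\<in>{21..}. dev n \<omega> (p_lim \<omega>) x) \<partial>lborel) \<partial>\<rho>)"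
      by (intro nn_integral_mono)
    then show ?thesis using nn_integral_SUP_dev_finite by (rule le_less_trans)
  qed
  have "AE \<omega> in \<rho>. nn_cond_exp \<rho> (initial n) (dist_lim n) \<omega> \<le> nn_cond_exp \<rho> (initial n) (Z m) \<omega>" if "n \<ge> m" for n m
  proof -
    interpret sigma_finite_subalgebra \<rho> "initial n" by (rule sigma_finite_subalgebra_F)
    show ?thesis
      using that unfolding Z_def by (intro nn_cond_exp_mono AE_I2 SUP_upper) auto
  qed
  then have mono: "AE \<omega> in \<rho>. \<forall>m. \<forall>n\<ge>m. nn_cond_exp \<rho> (initial n) (dist_lim n) \<omega> \<le> nn_cond_exp \<rho> (initial n) (Z m) \<omega>"
    by (simp add: AE_all_countable)
  have levy: "AE \<omega> in \<rho>. \<forall>m\<ge>21. limsup (\<lambda>n. nn_cond_exp \<rho> (initial n) (Z m) \<omega>) \<le> Z m \<omega>"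
    using limsup_nn_cond_exp_le[OF _ Z_fin] by (simp add: AE_all_countable)
  have eq: "AE \<omega> in \<rho>. \<forall>n\<ge>1. post_dist n \<omega> = nn_cond_exp \<rho> (initial n) (dist_lim n) \<omega>"
    using post_dist_eq_nn_cond_exp by (simp add: AE_all_countable)
  show ?thesis
    using mono levy eq
  proof eventually_elim
    case (elim \<omega>)
    have le: "limsup (\<lambda>n. post_dist n \<omega>) \<le> Z m \<omega>" if m: "m \<ge> 21" for m
    proof -
      have "limsup (\<lambda>n. post_dist n \<omega>) \<le> limsup (\<lambda>n. nn_cond_exp \<rho> (initial n) (Z m) \<omega>)"
      proof (rule Limsup_mono)
        show "\<forall>\<^sub>F n in sequentially. post_dist n \<omega> \<le> nn_cond_exp \<rho> (initial n) (Z m) \<omega>"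
          using eventually_ge_at_top[of "max m 1"] by eventually_elim (use elim in auto)
      qed
      also have "\<dots> \<le> Z m \<omega>" using elim m by blast
      finally show ?thesis .
    qed
    \<comment> \<open>Integrability of \<open>Z m\<close> is established from 21 on; as
      \<open>Z\<close> decreases in \<open>m\<close>, smaller indices inherit the bound.\<close>
    have "limsup (\<lambda>n. post_dist n \<omega>) \<le> Z m \<omega>" for m
    proof -
      have "Z (max m 21) \<omega> \<le> Z m \<omega>"
        unfolding Z_def by (intro SUP_subset_mono) auto
      with le[of "max m 21"] show ?thesis by (meson max.cobounded2 order_trans)
    qed
    then show ?case
      unfolding limsup_INF_SUP Z_def by (intro INF_greatest)
  qed
qed

lemma AE_limsup_post_dist_le:
  "AE \<omega> in \<rho>. limsup (\<lambda>n. post_dist n \<omega>) \<le>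
    (\<integral>\<^sup>+x. lil_bound \<omega> x \<partial>lborel)"
  using AE_limsup_post_dist AE_limsup_dist_lim by eventually_elim (rule order_trans)

lemma post_properties:
  assumes "n \<ge> 1"
  shows "prob_space (post n (restrict \<omega> {..<n}))" "sets (post n (restrict \<omega> {..<n})) = sets borel_prob"
proof -
  have K: "post n \<in> borel_pow {..<n} \<rightarrow>\<^sub>M prob_algebra borel_prob"
    using post[OF assms] by (simp add: regular_cond_distr_def)
  have x: "restrict \<omega> {..<n} \<in> space (borel_pow {..<n})"
    by (simp add: space_PiM)
  show "prob_space (post n (restrict \<omega> {..<n}))" "sets (post n (restrict \<omega> {..<n})) = sets borel_prob"
    by (rule prob_space_kernel[OF K x], rule sets_kernel_prob[OF K x])
qed

lemma post_dist_eq: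
  assumes n: "n \<ge> 1"
  shows "post_dist n \<omega> = ennreal (rate n) * (\<integral>\<^sup>+p. cdf_dist p (empirical n \<omega>) \<partial>post n (restrict \<omega> {..<n}))"
proof -
  let ?\<kappa> = "post n (restrict \<omega> {..<n})"
  note \<kappa> = post_properties[OF n, of \<omega>]
  have e: "empirical n \<omega> \<in> space borel_prob" by (rule empirical_in_space[OF n])
  have space_\<kappa>: "space ?\<kappa> = space borel_prob" by (rule sets_eq_imp_space_eq[OF \<kappa>(2)])
  have id_\<kappa>: "(\<lambda>p. p) \<in> ?\<kappa> \<rightarrow>\<^sub>M borel_prob"
    using \<kappa>(2) by (simp cong: measurable_cong_sets)
  have [measurable]: "(\<lambda>z. cdf (fst z) (snd z)) \<in> borel_measurable (?\<kappa> \<Otimes>\<^sub>M lborel)"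
    by (intro measurable_cdf measurable_compose[OF measurable_fst id_\<kappa>]) auto
  have [measurable]: "cdf (empirical n \<omega>) \<in> borel_measurable borel"
    by (rule measurable_cdf_const[OF e])
  have "(\<lambda>(p, x). ennreal \<bar>cdf p x - cdf (empirical n \<omega>) x\<bar>) \<in> borel_measurable (?\<kappa> \<Otimes>\<^sub>M lborel)"
    unfolding split_beta by measurable
  then have meas: "(\<lambda>p. cdf_dist p (empirical n \<omega>)) \<in> borel_measurable ?\<kappa>"
    unfolding cdf_dist_def by (rule lborel.borel_measurable_nn_integral)
  have "(\<integral>\<^sup>+x. dev n \<omega> p x \<partial>lborel) = ennreal (rate n) * cdf_dist p (empirical n \<omega>)" if "p \<in> space ?\<kappa>" for p
  proof -
    have [measurable]: "cdf p \<in> borel_measurable borel"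
      using that by (intro measurable_cdf_const) (simp add: space_\<kappa>)
    have "(\<integral>\<^sup>+x. dev n \<omega> p x \<partial>lborel) = (\<integral>\<^sup>+x. ennreal (rate n) * ennreal \<bar>cdf p x - cdf (empirical n \<omega>) x\<bar> \<partial>lborel)"
      unfolding dev_def by (simp add: cdf_empirical[OF n] abs_minus_commute)
    also have "\<dots> = ennreal (rate n) * cdf_dist p (empirical n \<omega>)"
      unfolding cdf_dist_def by (rule nn_integral_cmult) measurable
    finally show ?thesis .
  qed
  then have "post_dist n \<omega> = (\<integral>\<^sup>+p. ennreal (rate n) * cdf_dist p (empirical n \<omega>) \<partial>?\<kappa>)"
    unfolding post_dist_def by (intro nn_integral_cong)
  also have "\<dots> = ennreal (rate n) * (\<integral>\<^sup>+p. cdf_dist p (empirical n \<omega>) \<partial>?\<kappa>)"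
    by (rule nn_integral_cmult[OF meas])
  finally show ?thesis .
qed

lemma gmw_prob_le_post_dist:
  "n \<ge> 1 \<Longrightarrow> ennreal (rate n) * gmw_prob (post n (restrict \<omega> {..<n})) (return borel_prob (empirical n \<omega>)) \<le> post_dist n \<omega>"
  unfolding post_dist_eq by (intro mult_left_mono gmw_prob_le post_properties empirical_in_space) auto

lemma gmw_sym_le_post_dist:
  "m \<ge> 1 \<Longrightarrow> n \<ge> 1 \<Longrightarrow> ennreal (rate n) * gmw_sym m (product_mixture {..<m} (post n (restrict \<omega> {..<n}))) (Pi\<^sub>M {..<m} (\<lambda>_. empirical n \<omega>)) \<le> post_dist n \<omega>"
  unfolding post_dist_eq by (intro mult_left_mono gmw_sym_le post_properties empirical_in_space) auto

end

theorem theorem4: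
  fixes q :: "real measure measure"
    and \<rho> :: "(nat \<Rightarrow> real) measure"
    and p_lim :: "(nat \<Rightarrow> real) \<Rightarrow> real measure"
    and post :: "nat \<Rightarrow> (nat \<Rightarrow> real) \<Rightarrow> real measure measure"
    and \<delta> :: real
  assumes q: "prob_space q" "sets q = sets borel_prob"
    and rho: "\<rho> = product_mixture UNIV q"
    and p_lim: "p_lim \<in> \<rho> \<rightarrow>\<^sub>M borel_prob" "distr \<rho> borel_prob p_lim = q"
      "AE \<omega> in \<rho>. limitin weak_topology (\<lambda>n. empirical n \<omega>) (p_lim \<omega>) sequentially"
    and post: "\<And>n. n \<ge> 1 \<Longrightarrow> regular_cond_distr \<rho>
      (borel_pow {..<n}) (\<lambda>\<omega>. restrict \<omega> {..<n}) borel_prob p_lim (post n)"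
    and moment: "\<delta> > 0" "(\<integral>\<^sup>+ x. ennreal (\<bar>x\<bar> powr (2 + \<delta>)) \<partial>mean_measure q) < \<infinity>"
  shows "(AE \<omega> in \<rho>.
            limsup (\<lambda>n. ennreal (sqrt (real n / ln (ln (real n)))) *
              gmw_prob (post n (restrict \<omega> {..<n})) (return borel_prob (empirical n \<omega>)))
            \<le> (\<integral>\<^sup>+ x. ennreal (sqrt (2 * cdf (p_lim \<omega>) x * (1 - cdf (p_lim \<omega>) x))) \<partial>lborel)) \<and>
         (\<forall>m\<ge>1. AE \<omega> in \<rho>.
            limsup (\<lambda>n. ennreal (sqrt (real n / ln (ln (real n)))) *
              gmw_sym m (product_mixture {..<m} (post n (restrict \<omega> {..<n})))
                        (Pi\<^sub>M {..<m} (\<lambda>_. empirical n \<omega>)))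
            \<le> (\<integral>\<^sup>+ x. ennreal (sqrt (2 * cdf (p_lim \<omega>) x * (1 - cdf (p_lim \<omega>) x))) \<partial>lborel))"
proof -
  interpret posterior_law q \<rho> p_lim post \<delta>
    by (intro posterior_law.intro exchangeable_law.intro posterior_law_axioms.intro) fact+
  \<comment> \<open>Both distances enter through domination by \<open>post_dist\<close>, so one
    argument serves both. Index 0, where \<open>empirical\<close> is not a probability measure,
    drops out of the upper limit.\<close>
  have conclude: "AE \<omega> in \<rho>. limsup (\<lambda>n. ennreal (rate n) * D n \<omega>) \<le>
      (\<integral>\<^sup>+ x. lil_bound \<omega> x \<partial>lborel)"
    if D: "\<And>n \<omega>. n \<ge> 1 \<Longrightarrow> ennreal (rate n) * D n \<omega> \<le> post_dist n \<omega>" for D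
    using AE_limsup_post_dist_le
  proof eventually_elim
    case (elim \<omega>)
    have "limsup (\<lambda>n. ennreal (rate n) * D n \<omega>) \<le> limsup (\<lambda>n. post_dist n \<omega>)"
      using D by (intro Limsup_mono eventually_sequentiallyI[of 1]) auto
    then show ?case using elim by (rule order_trans)
  qed
  show ?thesis
    unfolding rate_def[symmetric]
    by (intro conjI allI impI conclude gmw_prob_le_post_dist gmw_sym_le_post_dist)
qed

end
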